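(* For every prime $p$, $g^{\square}(p) < p^{0.96}$, where $g^{\square}(p)$ denotes the least square-free primitive root modulo $p$. In particular, every prime $p$ possesses a square-free primitive root less than $p$.
   Context: A positive integer $n$ is square-free if for all primes $l \mid n$ we have $l^2 \nmid n$ (so $1$ is square-free). For a prime $p$, $g^{\square}(p)$ is the smallest positive integer that is square-free and is a primitive root modulo $p$, i.e. whose residue class generates the multiplicative group $(\mathbb{Z}/p\mathbb{Z})^{\times}$. *)

theory Defs
  imports
    Complex_Main
    "HOL-Number_Theory.Residue_Primitive_Roots"
    "HOL-Computational_Algebra.Squarefree"
begin

(* LEAST is unspecified if no such n exists, so a bound on this value carries its intended
   meaning only together with the existence of a square-free primitive root modulo p. *)
definition least_squarefree_primroot :: "nat \<Rightarrow> nat" where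
  "least_squarefree_primroot p = (LEAST n. n > 0 \<and> squarefree n \<and> residue_primroot p n)"

end

theory Submission
  imports Defs "HOL-Analysis.Analysis"
begin

text \<open>
  Count the odd numbers \<open>n = 2 * i + (2 * j + 1)\<close> with \<open>i, j < M\<close> and \<open>4 * M \<le> p powr 0.96\<close>. By
  Cauchy-Schwarz a nontrivial character has sum at most \<open>sqrt p * M\<close> over this double family, without
  any logarithm, and the same holds when \<open>n\<close> is restricted to multiples of an odd \<open>d\<^sup>2\<close>. Expanding the
  indicator of the primitive roots into characters, sieving by the larger prime factors of \<open>p - 1\<close>, and
  removing the \<open>n\<close> divisible by a square gives a squarefree primitive root unless \<open>p\<close> is small or
  \<open>p - 1\<close> has many small prime factors. For \<open>p < 4 * 10 ^ 12\<close> the remaining primes are found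
  by a verified search over the possible sets of prime factors of \<open>p - 1\<close>, and a prime primitive root
  is exhibited for each of them.
\<close>

section \<open>Multiplicative characters modulo a prime\<close>

text \<open>Each nontrivial character costs a proportion \<open>sqrt p / M\<close>, about 4 *
  p^(-0.46), of the \<open>M^2\<close> pairs. Detecting primitive roots by a full expansion
  multiplies this by 2^w, where w is the number of primes dividing \<open>p - 1\<close>. The
  explicit bound 2^w / theta <= 74 * p^0.2 makes the total error harmless once p^0.02 >= 1.78, which
  is the source of the limit 4 * 10^12. The second loss, to numbers divisible by an odd square, is a
  fixed proportion of all pairs, whereas primitive roots are only a proportion theta, which may be
  small. So the multiples of the small squares have to be sifted as well: by all primes of
  \<open>p - 1\<close> when \<open>p\<close> is large, by the prime 2 alone below the limit. There
  the full expansion is also restricted to E = {2}, {2, 3} or {2, 3, 5}, since every further prime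
  would double the factor 2^w; the other primes s of \<open>p - 1\<close> enter through a union
  bound at a cost of about 1 / s each. Failure of the criterion then needs many small primes in
  \<open>p - 1\<close>, a condition that can be enumerated.\<close>

definition mult_char :: "nat \<Rightarrow> (nat \<Rightarrow> complex) \<Rightarrow> bool" where
  "mult_char p \<psi> \<longleftrightarrow> (\<forall>a b. \<psi> (a * b) = \<psi> a * \<psi> b) \<and> (\<forall>a. \<psi> (a mod p) = \<psi> a) \<and>
     (\<forall>a. cmod (\<psi> a) = (if p dvd a then 0 else 1))"

definition nontrivial_char :: "nat \<Rightarrow> (nat \<Rightarrow> complex) \<Rightarrow> bool" where
  "nontrivial_char p \<psi> \<longleftrightarrow> mult_char p \<psi> \<and> (\<exists>h. \<not> p dvd h \<and> \<psi> h \<noteq> 1)"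

lemma bij_betw_mult_mod:
  assumes "prime p" "\<not> p dvd (h::nat)"
  shows "bij_betw (\<lambda>a. h * a mod p) {..<p} {..<p}"
proof -
  have cop: "coprime h p"
    using assms by (metis coprime_commute prime_imp_coprime_nat)
  have p: "p > 0" using assms prime_gt_0_nat by auto
  have inj: "inj_on (\<lambda>a. h * a mod p) {..<p}"
  proof (rule inj_onI)
    fix x y assume *: "x \<in> {..<p}" "y \<in> {..<p}" "h * x mod p = h * y mod p"
    hence "[h * x = h * y] (mod p)" by (simp add: Cong.cong_def)
    hence "[x = y] (mod p)" using cop cong_mult_lcancel_nat by blast
    thus "x = y" using * by (simp add: Cong.cong_def)
  qed
  moreover have "(\<lambda>a. h * a mod p) ` {..<p} \<subseteq> {..<p}" using p by auto
  ultimately show ?thesis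
    by (simp add: bij_betw_def endo_inj_surj)
qed

lemma bij_betw_add_mod:
  assumes "p > 0"
  shows "bij_betw (\<lambda>a::nat. (a + t) mod p) {..<p} {..<p}"
proof -
  have inj: "inj_on (\<lambda>a. (a + t) mod p) {..<p}"
  proof (rule inj_onI)
    fix x y assume *: "x \<in> {..<p}" "y \<in> {..<p}" "(x + t) mod p = (y + t) mod p"
    hence "[x + t = y + t] (mod p)" by (simp add: Cong.cong_def)
    hence "[x = y] (mod p)" by (simp add: cong_add_rcancel_nat)
    thus "x = y" using * by (simp add: Cong.cong_def)
  qed
  moreover have "(\<lambda>a. (a + t) mod p) ` {..<p} \<subseteq> {..<p}" using assms by auto
  ultimately show ?thesis
    by (simp add: bij_betw_def endo_inj_surj)
qed

context
  fixes p :: nat and \<psi> :: "nat \<Rightarrow> complex"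
  assumes p: "prime p" and chi: "nontrivial_char p \<psi>"
begin

lemma char_mult: "\<psi> (a * b) = \<psi> a * \<psi> b"
  using chi by (simp add: nontrivial_char_def mult_char_def)

lemma char_mod: "\<psi> (a mod p) = \<psi> a"
  using chi by (simp add: nontrivial_char_def mult_char_def)

lemma cmod_char: "cmod (\<psi> a) = (if p dvd a then 0 else 1)"
  using chi by (simp add: nontrivial_char_def mult_char_def)

lemma char_cong: "[a = b] (mod p) \<Longrightarrow> \<psi> a = \<psi> b"
  by (metis char_mod Cong.cong_def)

lemma sum_char: "(\<Sum>a<p. \<psi> a) = 0"
proof -
  obtain h where h: "\<not> p dvd h" "\<psi> h \<noteq> 1"
    using chi by (auto simp: nontrivial_char_def)
  have "(\<Sum>a<p. \<psi> a) = (\<Sum>a<p. \<psi> (h * a mod p))"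
    by (rule sum.reindex_bij_betw[symmetric, OF bij_betw_mult_mod[OF p h(1)]])
  also have "\<dots> = \<psi> h * (\<Sum>a<p. \<psi> a)"
    by (simp add: char_mod char_mult sum_distrib_left)
  finally show ?thesis using h(2) by simp
qed

lemma sum_char_shift: "(\<Sum>a<p. \<psi> (a + t)) = 0"
proof -
  have "(\<Sum>a<p. \<psi> (a + t)) = (\<Sum>a<p. \<psi> ((a + t) mod p))"
    by (simp add: char_mod)
  also have "\<dots> = (\<Sum>a<p. \<psi> a)"
    by (rule sum.reindex_bij_betw[OF bij_betw_add_mod]) (use p prime_gt_0_nat in auto)
  finally show ?thesis by (simp add: sum_char)
qed

text \<open>The autocorrelation of the character at shift \<open>t\<close>.\<close>

definition shift_sum :: "nat \<Rightarrow> complex" where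
  "shift_sum t = (\<Sum>c<p. \<psi> (c + t) * cnj (\<psi> c))"

lemma char_cnj_self: "\<psi> c * cnj (\<psi> c) = (if p dvd c then 0 else 1)"
  by (simp add: complex_norm_square[symmetric] cmod_char)

lemma sum_cnj_self: "(\<Sum>c<p. \<psi> c * cnj (\<psi> c)) = of_nat p - 1"
proof -
  have p0: "p > 0" using p prime_gt_0_nat by auto
  have "(\<Sum>c<p. \<psi> c * cnj (\<psi> c)) = (\<Sum>c<p. if c = 0 then 0 else 1)"
    by (intro sum.cong) (auto simp: char_cnj_self dest: dvd_imp_le)
  also have "\<dots> = (\<Sum>c\<in>{..<p} - {0}. 1)"
    by (intro sum.mono_neutral_cong_right) auto
  also have "\<dots> = of_nat p - 1" using p0 by (simp add: of_nat_diff)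
  finally show ?thesis .
qed

text \<open>Substituting \<open>s * c\<close> for \<open>c\<close> shows that all unit shifts give
  the same value. The total over all shifts vanishes because the character sums to zero, and the
  shift 0 contributes \<open>p - 1\<close>, so the common value is forced.\<close>

lemma shift_sum_unit:
  assumes "\<not> p dvd t"
  shows "shift_sum t = -1"
proof -
  have p1: "p > 1" using p prime_gt_1_nat by auto
  have scale: "shift_sum s = shift_sum 1" if "\<not> p dvd s" for s
  proof -
    have "shift_sum s = (\<Sum>c<p. \<psi> (s * c mod p + s) * cnj (\<psi> (s * c mod p)))"
      unfolding shift_sum_def
      by (rule sum.reindex_bij_betw[symmetric, OF bij_betw_mult_mod[OF p that]])
    also have "\<dots> = (\<Sum>c<p. \<psi> (s * (c + 1)) * cnj (\<psi> (s * c)))"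
      by (intro sum.cong refl arg_cong2[where f="(*)"] arg_cong[where f=cnj] char_cong)
         (auto simp: Cong.cong_def mod_simps algebra_simps)
    also have "\<dots> = (\<Sum>c<p. (\<psi> s * cnj (\<psi> s)) * (\<psi> (c + 1) * cnj (\<psi> c)))"
      by (intro sum.cong refl) (simp only: char_mult complex_cnj_mult mult_ac)
    also have "\<dots> = shift_sum 1"
      using that by (simp add: char_cnj_self shift_sum_def)
    finally show ?thesis .
  qed
  have "(\<Sum>t<p. shift_sum t) = (\<Sum>c<p. cnj (\<psi> c) * (\<Sum>t<p. \<psi> (t + c)))"
    unfolding shift_sum_def by (subst sum.swap) (simp add: sum_distrib_left mult_ac add_ac)
  also have "\<dots> = 0" by (simp add: sum_char_shift)
  finally have "0 = (\<Sum>t<p. shift_sum t)" by simp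
  also have "\<dots> = shift_sum 0 + (\<Sum>t\<in>{..<p} - {0}. shift_sum t)"
    using p1 by (subst sum.remove[of _ 0]) auto
  also have "(\<Sum>t\<in>{..<p} - {0}. shift_sum t) = (\<Sum>t\<in>{..<p} - {0}. shift_sum 1)"
    by (intro sum.cong refl scale) (auto dest: dvd_imp_le)
  also have "\<dots> = (of_nat p - 1) * shift_sum 1" using p1 by (simp add: of_nat_diff)
  also have "shift_sum 0 = of_nat p - 1" by (simp add: shift_sum_def sum_cnj_self)
  finally have eq: "0 = (of_nat p - 1) + (of_nat p - 1) * shift_sum 1" .
  have "x * (y + 1) = 0" if "0 = x + x * y" for x y :: complex
    using that by (simp add: distrib_left add.commute)
  from this[OF eq] have "(of_nat p - 1) * (shift_sum 1 + 1) = 0" .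
  moreover have "(of_nat p - 1 :: complex) \<noteq> 0"
    using p1 by (metis diff_eq_diff_eq diff_zero nat_neq_iff of_nat_1 of_nat_eq_iff right_minus_eq)
  ultimately have "shift_sum 1 = -1" by (metis add_eq_0_iff2 mult_eq_0_iff)
  thus ?thesis using scale[OF assms] by simp
qed

lemma char_correlation:
  assumes "b < p" "b' < p"
  shows "(\<Sum>a<p. \<psi> (a + b) * cnj (\<psi> (a + b'))) = (if b = b' then of_nat p else 0) - 1"
proof -
  have p0: "p > 0" using p prime_gt_0_nat by auto
  \<comment> \<open>\<open>t\<close> stands for \<open>b - b'\<close> modulo \<open>p\<close>, kept
    among the natural numbers; for \<open>b = b'\<close> it is \<open>p\<close> rather than
    0.\<close>
  define t where "t = b + (p - b')"
  have "(\<Sum>a<p. \<psi> (a + b) * cnj (\<psi> (a + b')))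
      = (\<Sum>a<p. \<psi> ((a + b') mod p + t) * cnj (\<psi> ((a + b') mod p)))"
  proof (intro sum.cong refl arg_cong2[where f="(*)"] arg_cong[where f=cnj] char_cong)
    fix a
    have "((a + b') mod p + t) mod p = (a + b' + t) mod p" by (simp add: mod_simps)
    also have "a + b' + t = (a + b) + p" using assms by (simp add: t_def)
    finally show "[a + b = (a + b') mod p + t] (mod p)" by (simp add: Cong.cong_def)
  qed (simp add: Cong.cong_def)
  also have "\<dots> = shift_sum t" unfolding shift_sum_def
    by (rule sum.reindex_bij_betw[OF bij_betw_add_mod[OF p0]])
  finally have eq: "(\<Sum>a<p. \<psi> (a + b) * cnj (\<psi> (a + b'))) = shift_sum t" .
  show ?thesis
  proof (cases "b = b'")
    case True
    hence "t = p" using assms by (simp add: t_def)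
    moreover have "\<psi> (c + p) = \<psi> c" for c by (rule char_cong) (simp add: Cong.cong_def)
    ultimately have "shift_sum t = of_nat p - 1" by (simp add: shift_sum_def sum_cnj_self)
    thus ?thesis using True eq by simp
  next
    case False
    have "\<not> p dvd t"
    proof
      assume "p dvd t"
      then obtain k where k: "t = p * k" by blast
      have "0 < t" "t < 2 * p" using assms by (auto simp: t_def)
      hence "k = 1" using k by (cases k) auto
      hence "b = b'" using k assms by (simp add: t_def)
      thus False using False by simp
    qed
    thus ?thesis using False eq by (simp add: shift_sum_unit)
  qed
qed

text \<open>After expanding the square, every off-diagonal correlation is exactly -1 and every
  diagonal one is \<open>p - 1\<close>. This is an identity, so Cauchy-Schwarz is the only place
  where the bilinear estimate loses anything.\<close>

lemma sum_char_translate_square: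
  assumes "B \<subseteq> {..<p}"
  shows "(\<Sum>a<p. (cmod (\<Sum>b\<in>B. \<psi> (a + b)))\<^sup>2) = real p * card B - (real (card B))\<^sup>2"
proof -
  have fB: "finite B" using assms finite_subset by blast
  have "complex_of_real (\<Sum>a<p. (cmod (\<Sum>b\<in>B. \<psi> (a + b)))\<^sup>2)
      = (\<Sum>a<p. (\<Sum>b\<in>B. \<psi> (a + b)) * cnj (\<Sum>b\<in>B. \<psi> (a + b)))"
    by (simp only: of_real_sum complex_norm_square)
  also have "\<dots> = (\<Sum>a<p. \<Sum>b\<in>B. \<Sum>b'\<in>B. \<psi> (a + b) * cnj (\<psi> (a + b')))"
    by (simp add: sum_product)
  also have "\<dots> = (\<Sum>b\<in>B. \<Sum>a<p. \<Sum>b'\<in>B. \<psi> (a + b) * cnj (\<psi> (a + b')))"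
    by (rule sum.swap)
  also have "\<dots> = (\<Sum>b\<in>B. \<Sum>b'\<in>B. \<Sum>a<p. \<psi> (a + b) * cnj (\<psi> (a + b')))"
    by (intro sum.cong[OF refl] sum.swap)
  also have "\<dots> = (\<Sum>b\<in>B. \<Sum>b'\<in>B. (if b = b' then of_nat p else 0) - 1)"
    using assms by (intro sum.cong refl char_correlation) auto
  also have "\<dots> = of_nat (card B) * of_nat p - of_nat (card B) * of_nat (card B)"
    using fB by (simp add: sum_subtractf algebra_simps)
  also have "\<dots> = complex_of_real (real p * card B - (real (card B))\<^sup>2)"
    by (simp add: power2_eq_square)
  finally show ?thesis by (simp only: of_real_eq_iff)
qed

text \<open>Subtracting the mean of the indicator of \<open>A\<close> is harmless since \<open>\<psi>\<close> sums to zero; it gains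
  the factor \<open>1 - card A / p\<close>.\<close>
lemma bilinear_char_bound:
  assumes A: "A \<subseteq> {..<p}" and B: "B \<subseteq> {..<p}"
  shows "(cmod (\<Sum>a\<in>A. \<Sum>b\<in>B. \<psi> (a + b)))\<^sup>2 \<le>
    (real (card A) - (real (card A))\<^sup>2 / p) * (real p * card B - (real (card B))\<^sup>2)"
proof -
  have p0: "p > 0" using p prime_gt_0_nat by auto
  define T where "T a = (\<Sum>b\<in>B. \<psi> (a + b))" for a
  define w where "w a = (if a \<in> A then 1 else 0) - real (card A) / p" for a
  have fA: "finite A" using A finite_subset by blast
  have "(\<Sum>a<p. T a) = (\<Sum>b\<in>B. \<Sum>a<p. \<psi> (a + b))" unfolding T_def by (rule sum.swap)
  hence T0: "(\<Sum>a<p. T a) = 0" by (simp add: sum_char_shift)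
  have "(\<Sum>a<p. of_real (w a) * T a)
      = (\<Sum>a<p. (if a \<in> A then T a else 0)) - of_real (card A / p) * (\<Sum>a<p. T a)"
    unfolding w_def sum_distrib_left sum_subtractf[symmetric]
    by (intro sum.cong refl) (auto simp: algebra_simps)
  also have "(\<Sum>a<p. (if a \<in> A then T a else 0)) = (\<Sum>a\<in>A. T a)"
    using A by (simp add: sum.If_cases Int_absorb1)
  finally have eq: "(\<Sum>a\<in>A. T a) = (\<Sum>a<p. of_real (w a) * T a)" by (simp add: T0)
  have "cmod (\<Sum>a\<in>A. T a) \<le> (\<Sum>a<p. \<bar>w a\<bar> * cmod (T a))"
    unfolding eq by (rule order_trans[OF norm_sum]) (simp add: norm_mult)
  hence "(cmod (\<Sum>a\<in>A. T a))\<^sup>2 \<le> (\<Sum>a<p. \<bar>w a\<bar> * cmod (T a))\<^sup>2"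
    by (intro power_mono) auto
  also have "\<dots> \<le> (\<Sum>a<p. \<bar>w a\<bar>\<^sup>2) * (\<Sum>a<p. (cmod (T a))\<^sup>2)"
    by (rule Cauchy_Schwarz_ineq_sum)
  also have "(\<Sum>a<p. (cmod (T a))\<^sup>2) = real p * card B - (real (card B))\<^sup>2"
    unfolding T_def by (rule sum_char_translate_square[OF B])
  also have "(\<Sum>a<p. \<bar>w a\<bar>\<^sup>2) = (\<Sum>a<p. (if a \<in> A then 1 - 2 * real (card A) / p else 0)
      + (real (card A) / p)\<^sup>2)"
    by (intro sum.cong refl) (auto simp: w_def power2_eq_square algebra_simps)
  also have "\<dots> = real (card A) * (1 - 2 * real (card A) / p) + p * (real (card A) / p)\<^sup>2"
    using A by (simp add: sum.distrib sum.If_cases Int_absorb1)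
  also have "\<dots> = real (card A) - (real (card A))\<^sup>2 / p"
    using p0 by (simp add: field_simps power2_eq_square)
  finally show ?thesis by (simp add: T_def)
qed

end

section \<open>Discrete logarithms and power residues\<close>

definition gen :: "nat \<Rightarrow> nat" where "gen p = (SOME g. residue_primroot p g)"

text \<open>Congruence determines the value only modulo \<open>p - 1\<close>, and only for
  \<open>a\<close> prime to \<open>p\<close>. This is enough for divisibility by primes dividing
  \<open>p - 1\<close> and for exponents of roots of unity of order dividing
  \<open>p - 1\<close>.\<close>

definition dlog :: "nat \<Rightarrow> nat \<Rightarrow> nat" where "dlog p a = (SOME k. [gen p ^ k = a] (mod p))"

lemma gen_primroot: "prime p \<Longrightarrow> residue_primroot p (gen p)"
  unfolding gen_def by (rule someI_ex) (use prime_primitive_root_exists prime_gt_1_nat in blast)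

lemma gen_power_dlog:
  assumes "prime p" "\<not> p dvd a"
  shows "[gen p ^ dlog p a = a] (mod p)"
proof -
  have p1: "p > 1" using assms prime_gt_1_nat by auto
  have "coprime p a" using assms prime_imp_coprime_nat by blast
  hence "coprime (a mod p) p" using p1 by (metis coprime_commute coprime_mod_left_iff not_one_less_zero)
  moreover have "0 < a mod p" using assms(2) by (simp add: mod_greater_zero_iff_not_dvd)
  moreover have "a mod p \<le> p" using p1 by (simp add: less_imp_le)
  ultimately have "a mod p \<in> totatives p"
    unfolding totatives_def mem_Collect_eq greaterThanAtMost_iff by blast
  also have "totatives p = (\<lambda>i. gen p ^ i mod p) ` {..<totient p}"
    using residue_primroot_is_generator[OF p1 gen_primroot[OF assms(1)]]
    by (simp add: bij_betw_def)
  finally obtain k where "a mod p = gen p ^ k mod p" by (rule imageE)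
  hence "gen p ^ k mod p = a mod p" by (rule sym)
  hence "\<exists>k. [gen p ^ k = a] (mod p)" by (auto simp: Cong.cong_def)
  thus ?thesis unfolding dlog_def by (rule someI_ex)
qed

lemma gen_power_cong_iff:
  assumes "prime p"
  shows "[gen p ^ i = gen p ^ j] (mod p) \<longleftrightarrow> [i = j] (mod (p - 1))"
proof -
  have "coprime p (gen p)" "ord p (gen p) = p - 1"
    using gen_primroot[OF assms] assms by (auto simp: residue_primroot_def totient_prime)
  thus ?thesis by (simp add: order_divides_expdiff)
qed

text \<open>If the order were a proper divisor of \<open>p - 1\<close>, a prime \<open>q\<close>
  dividing the cofactor would make the power with exponent \<open>(p - 1) div q\<close>
  trivial.\<close>

lemma residue_primrootI:
  assumes p: "prime p" and a: "\<not> p dvd a"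
    and *: "\<And>q. prime q \<Longrightarrow> q dvd p - 1 \<Longrightarrow> \<not> [a ^ ((p - 1) div q) = 1] (mod p)"
  shows "residue_primroot p a"
proof -
  have p1: "p > 1" using p prime_gt_1_nat by auto
  have cop: "coprime p a" using p a prime_imp_coprime_nat by blast
  have dvd: "ord p a dvd p - 1"
    using order_divides_totient[of p a] cop p by (simp add: totient_prime)
  then obtain k where k: "p - 1 = ord p a * k" by blast
  have "k = 1"
  proof (rule ccontr)
    assume "k \<noteq> 1"
    then obtain q where q: "prime q" "q dvd k" using prime_factor_nat by blast
    then obtain l where l: "k = q * l" by blast
    have "(p - 1) div q = ord p a * l" using k l q prime_gt_0_nat by auto
    hence "[a ^ ((p - 1) div q) = 1] (mod p)" by (simp only: ord_divides dvd_triv_left)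
    moreover have "q dvd p - 1" using k l by auto
    ultimately show False using * q by blast
  qed
  hence "ord p a = totient p" using k p by (simp add: totient_prime)
  thus ?thesis using p1 cop by (simp add: residue_primroot_def)
qed

text \<open>Reduces being a primitive root to one divisibility condition for each prime factor of
  \<open>p - 1\<close>, which sums over the \<open>q\<close>-th roots of unity can detect.\<close>

lemma residue_primroot_dlogI:
  assumes p: "prime p" and a: "\<not> p dvd a"
    and *: "\<And>q. q \<in> prime_factors (p - 1) \<Longrightarrow> \<not> q dvd dlog p a"
  shows "residue_primroot p a"
proof (rule residue_primrootI[OF p a], rule notI)
  fix q assume q: "prime q" "q dvd p - 1" and one: "[a ^ ((p - 1) div q) = 1] (mod p)"
  have p1: "p - 1 > 0" using p prime_gt_1_nat by auto
  define m where "m = (p - 1) div q"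
  have m: "p - 1 = q * m" using q by (simp add: m_def)
  have "[gen p ^ (dlog p a * m) = a ^ m] (mod p)"
    using cong_pow[OF gen_power_dlog[OF p a]] by (simp add: power_mult)
  hence "[gen p ^ (dlog p a * m) = gen p ^ 0] (mod p)"
    using one by (metis cong_trans m_def power_0)
  hence "p - 1 dvd dlog p a * m"
    using gen_power_cong_iff[OF p, of "dlog p a * m" 0] by (simp only: cong_0_iff)
  hence "q dvd dlog p a" using m p1 by auto
  moreover have "q \<in> prime_factors (p - 1)" using q p1 by (simp add: prime_factors_dvd)
  ultimately show False using * by blast
qed

text \<open>For \<open>z ^ (p - 1) = 1\<close> this is the Dirichlet character modulo
  \<open>p\<close> that takes the value \<open>z\<close> at the generator
  \<open>gen p\<close>.\<close>

definition char_of :: "nat \<Rightarrow> complex \<Rightarrow> nat \<Rightarrow> complex" where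
  "char_of p z a = (if p dvd a then 0 else z ^ dlog p a)"

lemma root_of_unity_power_cong:
  assumes "(z::complex) ^ n = 1" "[i = j] (mod n)"
  shows "z ^ i = z ^ j"
proof -
  have "z ^ i = z ^ (i mod n)" for i
    by (metis assms(1) div_mult_mod_eq mult.commute mult_1 power_add power_mult power_one)
  thus ?thesis using assms(2) by (metis Cong.cong_def)
qed

lemma nontrivial_char_of:
  assumes p: "prime p" and z: "z ^ (p - 1) = 1" "z \<noteq> 1"
  shows "nontrivial_char p (char_of p z)"
proof -
  have p1: "p > 1" using p prime_gt_1_nat by auto
  have "cmod z ^ (p - 1) = 1" using z(1) by (metis norm_one norm_power)
  hence nz: "cmod z = 1" using p1 z(1) power_eq_imp_eq_norm[of z "p - 1" 1] by simp
  have mult: "char_of p z (a * b) = char_of p z a * char_of p z b" for a b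
  proof (cases "p dvd a * b")
    case True
    thus ?thesis using p by (auto simp: char_of_def prime_dvd_mult_iff)
  next
    case False
    hence nd: "\<not> p dvd a" "\<not> p dvd b" by auto
    have "[gen p ^ dlog p (a * b) = gen p ^ (dlog p a + dlog p b)] (mod p)"
      using gen_power_dlog[OF p False] cong_mult[OF gen_power_dlog[OF p nd(1)] gen_power_dlog[OF p nd(2)]]
      by (simp add: power_add) (metis cong_sym cong_trans)
    hence "[dlog p (a * b) = dlog p a + dlog p b] (mod (p - 1))"
      using gen_power_cong_iff[OF p] by blast
    from root_of_unity_power_cong[OF z(1) this] show ?thesis
      using False nd by (simp add: char_of_def power_add)
  qed
  have per: "char_of p z (a mod p) = char_of p z a" for a
  proof -
    have "dlog p (a mod p) = dlog p a" by (simp add: dlog_def Cong.cong_def)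
    thus ?thesis by (simp add: char_of_def dvd_mod_iff)
  qed
  have nontriv: "\<not> p dvd gen p" "char_of p z (gen p) \<noteq> 1"
  proof -
    have "coprime p (gen p)" using gen_primroot[OF p] by (simp add: residue_primroot_def)
    thus nd: "\<not> p dvd gen p" using p1 by (metis coprime_absorb_left not_prime_1 p coprime_common_divisor_nat dvd_refl nat_neq_iff)
    have "[gen p ^ dlog p (gen p) = gen p ^ 1] (mod p)" using gen_power_dlog[OF p nd] by simp
    hence "[dlog p (gen p) = 1] (mod (p - 1))" using gen_power_cong_iff[OF p] by blast
    from root_of_unity_power_cong[OF z(1) this] show "char_of p z (gen p) \<noteq> 1"
      using nd z(2) by (simp add: char_of_def)
  qed
  show ?thesis unfolding nontrivial_char_def mult_char_def
    using mult per nontriv nz by (auto simp: char_of_def norm_power)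
qed

section \<open>Roots of unity and the expansion of divisibility conditions into characters\<close>

lemma cis_root_eq_1_iff:
  assumes "n > 0"
  shows "cis (2 * pi * real j / real n) = 1 \<longleftrightarrow> n dvd j"
proof -
  have "cis (2 * pi * real j / real n) = exp (2 * of_real pi * \<i> * of_nat j / of_nat n)"
    by (simp add: cis_conv_exp mult_ac)
  thus ?thesis using complex_root_unity_eq_1[of n j] assms by simp
qed

lemma cis_fraction_power:
  "cis (2 * pi * real j / real q) ^ m = cis (2 * pi * real (j * m) / real q)"
  by (subst Complex.DeMoivre) (simp add: mult_ac)

lemma sum_cis_root:
  assumes "q > 0"
  shows "(\<Sum>r<q. cis (2 * pi * real (r * k) / real q)) = (if q dvd k then of_nat q else 0)"
proof -
  define z where "z = cis (2 * pi * real k / real q)"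
  have *: "cis (2 * pi * real (r * k) / real q) = z ^ r" for r
    by (simp only: z_def cis_fraction_power mult.commute[of r k])
  have sum: "(\<Sum>r<q. cis (2 * pi * real (r * k) / real q)) = (\<Sum>r<q. z ^ r)"
    by (simp only: *)
  have zq: "z ^ q = 1"
    using cis_root_eq_1_iff[of q "q * k"] assms *[of q] by simp
  show ?thesis
  proof (cases "q dvd k")
    case True
    hence "z = 1" using cis_root_eq_1_iff[OF assms, of k] by (simp add: z_def)
    thus ?thesis using True unfolding sum by simp
  next
    case False
    hence "z \<noteq> 1" using cis_root_eq_1_iff[OF assms, of k] by (simp add: z_def)
    moreover have "(\<Sum>r<q. z ^ r) = (z ^ q - 1) / (z - 1)" using \<open>z \<noteq> 1\<close> by (rule geometric_sum)
    ultimately show ?thesis using False zq unfolding sum by simp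
  qed
qed

text \<open>Raising the product to the power \<open>m\<close>, the product of the other primes,
  kills every factor except that of \<open>q0\<close>; since \<open>m\<close> is prime to
  \<open>q0\<close>, that factor stays different from 1.\<close>

lemma prod_cis_neq_1:
  assumes fin: "finite T" and T: "\<And>q. q \<in> T \<Longrightarrow> prime q"
    and q0: "q0 \<in> T" "\<not> q0 dvd r q0"
  shows "(\<Prod>q\<in>T. cis (2 * pi * real (r q) / real q)) \<noteq> 1"
proof
  assume eq: "(\<Prod>q\<in>T. cis (2 * pi * real (r q) / real q)) = 1"
  define m where "m = \<Prod>(T - {q0})"
  have pos: "q > 0" if "q \<in> T" for q using T[OF that] prime_gt_0_nat by auto
  have pw: "cis (2 * pi * real (r q) / real q) ^ m = cis (2 * pi * real (r q * m) / real q)" for q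
    by (rule cis_fraction_power)
  have "1 = (\<Prod>q\<in>T. cis (2 * pi * real (r q) / real q)) ^ m" by (simp add: eq)
  also have "\<dots> = (\<Prod>q\<in>T. cis (2 * pi * real (r q * m) / real q))"
    by (simp only: prod_power_distrib pw)
  also have "\<dots> = cis (2 * pi * real (r q0 * m) / real q0) *
      (\<Prod>q\<in>T - {q0}. cis (2 * pi * real (r q * m) / real q))"
    using fin q0(1) by (rule prod.remove)
  also have "(\<Prod>q\<in>T - {q0}. cis (2 * pi * real (r q * m) / real q)) = (\<Prod>q\<in>T - {q0}. 1)"
  proof (rule prod.cong[OF refl])
    fix q assume q: "q \<in> T - {q0}"
    hence "q dvd m" unfolding m_def using fin by (intro dvd_prodI[of _ _ "\<lambda>x. x", simplified]) auto
    hence "q dvd r q * m" by simp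
    thus "cis (2 * pi * real (r q * m) / real q) = 1"
      using cis_root_eq_1_iff[of q] pos q by blast
  qed
  finally have "cis (2 * pi * real (r q0 * m) / real q0) = 1" by (simp only: prod.neutral_const mult_1_right)
  hence "q0 dvd r q0 * m" using cis_root_eq_1_iff[OF pos[OF q0(1)]] by blast
  hence "q0 dvd m" using T[OF q0(1)] q0(2) by (simp add: prime_dvd_mult_iff)
  then obtain q where "q \<in> T - {q0}" "q0 dvd q"
    unfolding m_def using T[OF q0(1)] fin by (subst (asm) prime_dvd_prod_iff) auto
  thus False using T[of q] T[OF q0(1)] primes_dvd_imp_eq by blast
qed

text \<open>Only nontrivial characters contribute to the error, since the orders of the roots of unity
  belonging to distinct primes are coprime.\<close>
lemma character_expansion_bound:
  fixes w :: "nat \<Rightarrow> nat \<Rightarrow> real"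
  assumes p: "prime p" and fin: "finite T" and T: "\<And>q. q \<in> T \<Longrightarrow> prime q \<and> q dvd p - 1"
    and I: "finite I" "\<And>t. t \<in> I \<Longrightarrow> \<not> p dvd a t"
    and B: "\<And>\<psi>. nontrivial_char p \<psi> \<Longrightarrow> cmod (\<Sum>t\<in>I. \<psi> (a t)) \<le> B"
  shows "cmod ((\<Sum>t\<in>I. \<Prod>q\<in>T. \<Sum>r<q. of_real (w q r) * cis (2 * pi * real (r * dlog p (a t)) / real q))
      - of_real ((\<Prod>q\<in>T. w q 0) * card I))
    \<le> ((\<Prod>q\<in>T. \<Sum>r<q. \<bar>w q r\<bar>) - (\<Prod>q\<in>T. \<bar>w q 0\<bar>)) * B"
proof -
  \<comment> \<open>Multiplying out the product over \<open>T\<close> selects one frequency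
    \<open>\<rho> q\<close> for each \<open>q\<close>. The all-zero selection \<open>\<rho>0\<close>
    gives the trivial character and hence the main term; every other selection gives a root of unity
    \<open>z \<rho>\<close> different from 1.\<close>
  define \<Omega> where "\<Omega> = PiE T (\<lambda>q. {..<q})"
  define z where "z \<rho> = (\<Prod>q\<in>T. cis (2 * pi * real (\<rho> q) / real q))" for \<rho>
  define W where "W \<rho> = (\<Prod>q\<in>T. w q (\<rho> q))" for \<rho>
  define \<rho>0 where "\<rho>0 = (\<lambda>q\<in>T. 0::nat)"
  have pos: "q > 0" if "q \<in> T" for q using T[OF that] prime_gt_0_nat by auto
  have fin\<Omega>: "finite \<Omega>" unfolding \<Omega>_def using fin by (intro finite_PiE) auto
  have \<rho>0: "\<rho>0 \<in> \<Omega>" using pos by (auto simp: \<Omega>_def \<rho>0_def)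
  have W0: "W \<rho>0 = (\<Prod>q\<in>T. w q 0)" unfolding W_def \<rho>0_def by (intro prod.cong) auto
  have z0: "z \<rho>0 = 1" unfolding z_def \<rho>0_def by (intro prod.neutral) auto
  have zpow: "z \<rho> ^ (p - 1) = 1" if "\<rho> \<in> \<Omega>" for \<rho>
  proof -
    have "z \<rho> ^ (p - 1) = (\<Prod>q\<in>T. cis (2 * pi * real (\<rho> q * (p - 1)) / real q))"
      by (simp only: z_def prod_power_distrib cis_fraction_power)
    also have "\<dots> = 1"
    proof (rule prod.neutral, rule ballI)
      fix q assume q: "q \<in> T"
      have "q dvd \<rho> q * (p - 1)" using T[OF q] by simp
      thus "cis (2 * pi * real (\<rho> q * (p - 1)) / real q) = 1"
        using cis_root_eq_1_iff[OF pos[OF q]] by blast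
    qed
    finally show ?thesis .
  qed
  have zne: "z \<rho> \<noteq> 1" if \<rho>: "\<rho> \<in> \<Omega>" "\<rho> \<noteq> \<rho>0" for \<rho>
  proof -
    have "\<exists>q0\<in>T. \<rho> q0 \<noteq> 0"
    proof (rule ccontr)
      assume *: "\<not> (\<exists>q0\<in>T. \<rho> q0 \<noteq> 0)"
      have "\<rho> \<in> extensional T" using \<rho>(1) by (simp add: \<Omega>_def PiE_def)
      hence "\<rho> x = \<rho>0 x" for x
        using * extensional_arb[of \<rho> T x] by (cases "x \<in> T") (auto simp: \<rho>0_def)
      thus False using \<rho>(2) by blast
    qed
    then obtain q0 where q0: "q0 \<in> T" "\<rho> q0 \<noteq> 0" by blast
    have "\<rho> q0 < q0" using \<rho>(1) q0(1) by (auto simp: \<Omega>_def)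
    hence "\<not> q0 dvd \<rho> q0" using q0(2) by (auto dest: dvd_imp_le)
    thus ?thesis unfolding z_def using prod_cis_neq_1[of T q0 \<rho>] fin T q0(1) by blast
  qed
  have expand: "(\<Prod>q\<in>T. \<Sum>r<q. of_real (w q r) * cis (2 * pi * real (r * dlog p (a t)) / real q))
      = (\<Sum>\<rho>\<in>\<Omega>. of_real (W \<rho>) * z \<rho> ^ dlog p (a t))" for t
  proof -
    have "(\<Prod>q\<in>T. \<Sum>r<q. of_real (w q r) * cis (2 * pi * real (r * dlog p (a t)) / real q))
      = (\<Sum>\<rho>\<in>\<Omega>. \<Prod>q\<in>T. of_real (w q (\<rho> q)) * cis (2 * pi * real (\<rho> q * dlog p (a t)) / real q))"
      unfolding \<Omega>_def by (rule prod_sum_PiE) (use fin in auto)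
    also have "\<dots> = (\<Sum>\<rho>\<in>\<Omega>. of_real (W \<rho>) * z \<rho> ^ dlog p (a t))"
      by (intro sum.cong refl)
         (simp only: W_def z_def prod.distrib prod_power_distrib cis_fraction_power of_real_prod)
    finally show ?thesis .
  qed
  have "(\<Sum>t\<in>I. \<Prod>q\<in>T. \<Sum>r<q. of_real (w q r) * cis (2 * pi * real (r * dlog p (a t)) / real q))
      = (\<Sum>\<rho>\<in>\<Omega>. of_real (W \<rho>) * (\<Sum>t\<in>I. z \<rho> ^ dlog p (a t)))"
    unfolding expand by (subst sum.swap) (simp add: sum_distrib_left)
  also have "\<dots> = of_real (W \<rho>0) * (\<Sum>t\<in>I. z \<rho>0 ^ dlog p (a t))
      + (\<Sum>\<rho>\<in>\<Omega> - {\<rho>0}. of_real (W \<rho>) * (\<Sum>t\<in>I. z \<rho> ^ dlog p (a t)))"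
    using fin\<Omega> \<rho>0 by (rule sum.remove)
  finally have eq: "(\<Sum>t\<in>I. \<Prod>q\<in>T. \<Sum>r<q. of_real (w q r) * cis (2 * pi * real (r * dlog p (a t)) / real q))
      - of_real ((\<Prod>q\<in>T. w q 0) * card I)
      = (\<Sum>\<rho>\<in>\<Omega> - {\<rho>0}. of_real (W \<rho>) * (\<Sum>t\<in>I. z \<rho> ^ dlog p (a t)))"
    by (simp add: z0 W0)
  have bd: "cmod (\<Sum>t\<in>I. z \<rho> ^ dlog p (a t)) \<le> B" if "\<rho> \<in> \<Omega> - {\<rho>0}" for \<rho>
  proof -
    have "(\<Sum>t\<in>I. z \<rho> ^ dlog p (a t)) = (\<Sum>t\<in>I. char_of p (z \<rho>) (a t))"
      using I by (intro sum.cong) (auto simp: char_of_def)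
    thus ?thesis using B[OF nontrivial_char_of[OF p zpow zne]] that by simp
  qed
  have "cmod (\<Sum>\<rho>\<in>\<Omega> - {\<rho>0}. of_real (W \<rho>) * (\<Sum>t\<in>I. z \<rho> ^ dlog p (a t)))
      \<le> (\<Sum>\<rho>\<in>\<Omega> - {\<rho>0}. \<bar>W \<rho>\<bar> * B)"
    by (rule order_trans[OF norm_sum], intro sum_mono)
       (auto simp: norm_mult intro!: mult_left_mono bd)
  also have "\<dots> = ((\<Sum>\<rho>\<in>\<Omega>. \<bar>W \<rho>\<bar>) - \<bar>W \<rho>0\<bar>) * B"
    using fin\<Omega> \<rho>0 by (simp add: sum_distrib_right[symmetric] sum_diff1)
  also have "(\<Sum>\<rho>\<in>\<Omega>. \<bar>W \<rho>\<bar>) = (\<Prod>q\<in>T. \<Sum>r<q. \<bar>w q r\<bar>)"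
    unfolding \<Omega>_def W_def abs_prod by (rule prod_sum_PiE[symmetric]) (use fin in auto)
  also have "\<bar>W \<rho>0\<bar> = (\<Prod>q\<in>T. \<bar>w q 0\<bar>)" by (simp add: W0 abs_prod)
  finally show ?thesis unfolding eq .
qed

section \<open>Counting odd numbers with multiplicity\<close>

text \<open>The arithmetic mean of the two sizes replaces the geometric one because it is additive:
  summed over a partition into rectangles, the sides add up.\<close>

lemma char_bound_AM_GM:
  assumes p: "prime p" and \<psi>: "nontrivial_char p \<psi>" and A: "A \<subseteq> {..<p}" and B: "B \<subseteq> {..<p}"
  shows "cmod (\<Sum>a\<in>A. \<Sum>b\<in>B. \<psi> (a + b)) \<le> sqrt p * ((real (card A) + real (card B)) / 2)"
proof -
  define x y where "x = real (card A)" and "y = real (card B)"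
  have x: "x \<ge> 0" and y: "y \<ge> 0" and xp: "x \<le> p"
    using A card_mono[of "{..<p}" A] by (auto simp: x_def y_def)
  have "(cmod (\<Sum>a\<in>A. \<Sum>b\<in>B. \<psi> (a + b)))\<^sup>2 \<le> (x - x\<^sup>2 / p) * (real p * y - y\<^sup>2)"
    using bilinear_char_bound[OF p \<psi> A B] by (simp add: x_def y_def)
  also have "\<dots> \<le> x * (real p * y)"
  proof (rule mult_mono')
    have p0: "p > 0" using p prime_gt_0_nat by auto
    have "x * x \<le> x * p" using x xp by (intro mult_left_mono) auto
    thus "0 \<le> x - x\<^sup>2 / p" using p0 by (simp add: field_simps power2_eq_square)
    have yp: "y \<le> p" using B card_mono[of "{..<p}" B] by (auto simp: y_def)
    have "y * y \<le> p * y" using y yp by (intro mult_right_mono) auto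
    thus "0 \<le> real p * y - y\<^sup>2" by (simp add: power2_eq_square)
  qed auto
  also have "\<dots> \<le> (sqrt p * ((x + y) / 2))\<^sup>2"
  proof -
    have "0 \<le> (x - y)\<^sup>2" by simp
    hence "x * y \<le> ((x + y) / 2)\<^sup>2" by (simp add: power2_eq_square field_simps)
    hence "p * (x * y) \<le> p * ((x + y) / 2)\<^sup>2" by (intro mult_left_mono) auto
    moreover have "(sqrt p * ((x + y) / 2))\<^sup>2 = p * ((x + y) / 2)\<^sup>2"
      by (subst power_mult_distrib) simp
    ultimately show ?thesis by (simp add: mult_ac)
  qed
  finally have "cmod (\<Sum>a\<in>A. \<Sum>b\<in>B. \<psi> (a + b)) \<le> sqrt p * ((x + y) / 2)"
    by (rule power2_le_imp_le) (use x y in auto)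
  thus ?thesis by (simp add: x_def y_def)
qed

text \<open>The odd numbers \<open>2 * i + (2 * j + 1)\<close>, counted with multiplicity, play the role of the interval;
  being odd they are not divisible by 4.\<close>
definition grid :: "nat \<Rightarrow> nat \<Rightarrow> (nat \<times> nat) set" where
  "grid M D = {(i, j). i < M \<and> j < M \<and> D dvd 2 * i + (2 * j + 1)}"

definition grid_val :: "nat \<times> nat \<Rightarrow> nat" where
  "grid_val = (\<lambda>(i, j). 2 * i + (2 * j + 1))"

lemma grid_subset: "grid M D \<subseteq> {..<M} \<times> {..<M}"
  by (auto simp: grid_def)

lemma finite_grid [simp]: "finite (grid M D)"
  by (rule finite_subset[OF grid_subset]) auto

lemma grid_1: "grid M 1 = {..<M} \<times> {..<M}"
  by (auto simp: grid_def)

text \<open>With both sides of size \<open>M\<close> the bilinear bound is a perfect square, so the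
  saving \<open>M^2 / p\<close> is kept; it reappears as the \<open>1 / sqrt p\<close> subtracted in
  the criterion.\<close>

lemma char_sum_grid_1:
  assumes p: "prime p" and \<psi>: "nontrivial_char p \<psi>" and M: "2 * M \<le> p"
  shows "cmod (\<Sum>t\<in>grid M 1. \<psi> (grid_val t)) \<le> sqrt p * (real M - (real M)\<^sup>2 / p)"
proof -
  define A where "A = (\<lambda>i. 2 * i) ` {..<M}"
  define B where "B = (\<lambda>j. 2 * j + 1) ` {..<M}"
  have p0: "p > 0" using p prime_gt_0_nat by auto
  have inj: "inj_on (\<lambda>i::nat. 2 * i) {..<M}" "inj_on (\<lambda>j::nat. 2 * j + 1) {..<M}"
    by (auto simp: inj_on_def)
  have cA: "card A = M" and cB: "card B = M"
    using inj by (simp_all add: A_def B_def card_image)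
  have sub: "A \<subseteq> {..<p}" "B \<subseteq> {..<p}" using M by (auto simp: A_def B_def)
  have eq: "(\<Sum>t\<in>grid M 1. \<psi> (grid_val t)) = (\<Sum>a\<in>A. \<Sum>b\<in>B. \<psi> (a + b))"
    unfolding A_def B_def grid_1 sum.reindex[OF inj(1)] sum.reindex[OF inj(2)]
    by (simp add: sum.cartesian_product grid_val_def case_prod_beta)
  have "(cmod (\<Sum>t\<in>grid M 1. \<psi> (grid_val t)))\<^sup>2 \<le>
      (real M - (real M)\<^sup>2 / p) * (real p * M - (real M)\<^sup>2)"
    using bilinear_char_bound[OF p \<psi> sub] unfolding eq cA cB .
  also have "\<dots> = (sqrt p * (real M - (real M)\<^sup>2 / p))\<^sup>2"
  proof -
    have "real p * M - (real M)\<^sup>2 = p * (real M - (real M)\<^sup>2 / p)"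
      using p0 by (simp add: field_simps)
    thus ?thesis by (subst power_mult_distrib) (simp add: power2_eq_square)
  qed
  finally show ?thesis
  proof (rule power2_le_imp_le)
    have "real M * M \<le> real M * p" using M by (intro mult_left_mono) auto
    hence "(real M)\<^sup>2 / p \<le> real M" using p0 by (simp add: field_simps power2_eq_square)
    thus "0 \<le> sqrt p * (real M - (real M)\<^sup>2 / p)" by simp
  qed
qed

lemma dvd_odd_cancel:
  assumes "odd (D::nat)" "D dvd 2 * x + c" "D dvd 2 * y + c"
  shows "x mod D = y mod D"
proof -
  have "[2 * x + c = 2 * y + c] (mod D)"
    using assms(2,3) by (metis cong_0_iff cong_sym cong_trans)
  hence "[2 * x = 2 * y] (mod D)" by (simp add: cong_add_rcancel_nat)
  moreover have "coprime 2 D" using assms(1) by (simp add: coprime_left_2_iff_odd)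
  ultimately have "[x = y] (mod D)" using cong_mult_lcancel_nat by blast
  thus ?thesis by (simp add: Cong.cong_def)
qed

text \<open>Splitting \<open>i\<close> by its residue modulo \<open>D\<close> turns the divisibility condition into rectangles.\<close>
lemma char_sum_grid:
  assumes p: "prime p" and \<psi>: "nontrivial_char p \<psi>" and M: "2 * M \<le> p" and D: "odd D"
  shows "cmod (\<Sum>t\<in>grid M D. \<psi> (grid_val t)) \<le> sqrt p * M"
proof -
  define I where "I r = {i. i < M \<and> i mod D = r}" for r
  define J where "J r = {j. j < M \<and> D dvd 2 * r + (2 * j + 1)}" for r
  have D0: "D > 0" using D by (cases D) auto
  have finI: "finite (I r)" "finite (J r)" for r by (auto simp: I_def J_def)
  have dvd_iff: "D dvd 2 * i + (2 * j + 1) \<longleftrightarrow> D dvd 2 * (i mod D) + (2 * j + 1)" for i j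
  proof -
    have "(2 * i + (2 * j + 1)) mod D = (2 * (i mod D) + (2 * j + 1)) mod D"
      by (metis mod_add_left_eq mod_mult_right_eq)
    thus ?thesis by (simp add: dvd_eq_mod_eq_0)
  qed
  have split: "grid M D = (\<Union>r<D. I r \<times> J r)"
  proof (rule equalityI; rule subsetI)
    fix t assume "t \<in> grid M D"
    then obtain i j where t: "t = (i, j)" "i < M" "j < M" "D dvd 2 * i + (2 * j + 1)"
      by (auto simp: grid_def)
    have "i mod D < D" using D0 by simp
    moreover have "t \<in> I (i mod D) \<times> J (i mod D)"
      using t dvd_iff[of i j] by (auto simp: I_def J_def)
    ultimately show "t \<in> (\<Union>r<D. I r \<times> J r)" by blast
  next
    fix t assume "t \<in> (\<Union>r<D. I r \<times> J r)"
    thus "t \<in> grid M D" using dvd_iff by (auto simp: I_def J_def grid_def)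
  qed
  have "(\<Sum>t\<in>grid M D. \<psi> (grid_val t)) = (\<Sum>r<D. \<Sum>t\<in>I r \<times> J r. \<psi> (grid_val t))"
    unfolding split by (rule sum.UNION_disjoint) (use finI in \<open>auto simp: I_def\<close>)
  also have "cmod \<dots> \<le> (\<Sum>r<D. cmod (\<Sum>t\<in>I r \<times> J r. \<psi> (grid_val t)))"
    by (rule norm_sum)
  also have "\<dots> \<le> (\<Sum>r<D. sqrt p * ((real (card (I r)) + real (card (J r))) / 2))"
  proof (rule sum_mono)
    fix r
    define A where "A = (\<lambda>i. 2 * i) ` I r"
    define B where "B = (\<lambda>j. 2 * j + 1) ` J r"
    have inj: "inj_on (\<lambda>i::nat. 2 * i) (I r)" "inj_on (\<lambda>j::nat. 2 * j + 1) (J r)"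
      by (auto simp: inj_on_def)
    have cA: "card A = card (I r)" and cB: "card B = card (J r)"
      using inj by (simp_all add: A_def B_def card_image)
    have sub: "A \<subseteq> {..<p}" "B \<subseteq> {..<p}" using M by (auto simp: A_def B_def I_def J_def)
    have eq: "(\<Sum>t\<in>I r \<times> J r. \<psi> (grid_val t)) = (\<Sum>a\<in>A. \<Sum>b\<in>B. \<psi> (a + b))"
      unfolding A_def B_def sum.reindex[OF inj(1)] sum.reindex[OF inj(2)]
      by (simp add: sum.cartesian_product grid_val_def case_prod_beta)
    show "cmod (\<Sum>t\<in>I r \<times> J r. \<psi> (grid_val t))
        \<le> sqrt p * ((real (card (I r)) + real (card (J r))) / 2)"
      using char_bound_AM_GM[OF p \<psi> sub] unfolding eq cA cB .
  qed
  also have "\<dots> = sqrt p * (((\<Sum>r<D. real (card (I r))) + (\<Sum>r<D. real (card (J r)))) / 2)"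
    by (simp add: sum_distrib_left sum.distrib sum_divide_distrib add_divide_distrib distrib_left)
  \<comment> \<open>The \<open>I r\<close> are disjoint by definition and the \<open>J r\<close>
    because 2 is invertible modulo the odd \<open>D\<close>. So the sides add up to at most
    \<open>M\<close> each, and the bound does not deteriorate with the number of classes.\<close>
  also have "\<dots> \<le> sqrt p * ((real M + real M) / 2)"
  proof (intro mult_left_mono divide_right_mono add_mono)
    have "(\<Sum>r<D. card (I r)) = card (\<Union>r<D. I r)"
      by (rule card_UN_disjoint[symmetric]) (auto simp: I_def)
    also have "\<dots> \<le> card {..<M}" by (intro card_mono) (auto simp: I_def)
    finally show "(\<Sum>r<D. real (card (I r))) \<le> real M"
      by (simp only: card_lessThan of_nat_sum[symmetric] of_nat_le_iff)
    have "(\<Sum>r<D. card (J r)) = card (\<Union>r<D. J r)"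
    proof (rule card_UN_disjoint[symmetric])
      show "\<forall>r\<in>{..<D}. \<forall>s\<in>{..<D}. r \<noteq> s \<longrightarrow> J r \<inter> J s = {}"
      proof (intro ballI impI)
        fix r s assume *: "r \<in> {..<D}" "s \<in> {..<D}" "r \<noteq> s"
        show "J r \<inter> J s = {}"
        proof (rule ccontr)
          assume "J r \<inter> J s \<noteq> {}"
          then obtain j where "D dvd 2 * r + (2 * j + 1)" "D dvd 2 * s + (2 * j + 1)"
            by (auto simp: J_def)
          from dvd_odd_cancel[OF D this] show False using * by simp
        qed
      qed
    qed (auto simp: J_def)
    also have "\<dots> \<le> card {..<M}" by (intro card_mono) (auto simp: J_def)
    finally show "(\<Sum>r<D. real (card (J r))) \<le> real M"
      by (simp only: card_lessThan of_nat_sum[symmetric] of_nat_le_iff)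
  qed auto
  finally show ?thesis by simp
qed

text \<open>For fixed \<open>i\<close>, divisibility by the odd \<open>D\<close> confines
  \<open>j\<close> to one residue class modulo \<open>D\<close>.\<close>

lemma card_grid:
  assumes D: "odd D"
  shows "real (card (grid M D)) \<le> real M * (real M / real D + 1)"
proof -
  define J where "J i = {j. j < M \<and> D dvd 2 * i + (2 * j + 1)}" for i
  have D0: "D > 0" using D by (cases D) auto
  have "grid M D = (SIGMA i:{..<M}. J i)" by (auto simp: grid_def J_def)
  hence "card (grid M D) = (\<Sum>i<M. card (J i))" by (simp add: J_def)
  also have "\<dots> \<le> (\<Sum>i<M. M div D + 1)"
  proof (rule sum_mono)
    fix i
    have "inj_on (\<lambda>j. j div D) (J i)"
    proof (rule inj_onI)
      fix x y assume *: "x \<in> J i" "y \<in> J i" "x div D = y div D"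
      have "x mod D = y mod D"
        by (rule dvd_odd_cancel[OF D, of _ "2 * i + 1"]) (use * in \<open>auto simp: J_def algebra_simps\<close>)
      thus "x = y" using * by (metis div_mult_mod_eq)
    qed
    hence "card (J i) = card ((\<lambda>j. j div D) ` J i)" by (simp add: card_image)
    also have "\<dots> \<le> card {..M div D}"
      by (intro card_mono) (auto simp: J_def intro!: div_le_mono)
    finally show "card (J i) \<le> M div D + 1" by simp
  qed
  also have "\<dots> = M * (M div D + 1)" by simp
  finally have "real (card (grid M D)) \<le> real M * (real (M div D) + 1)"
    by (metis of_nat_1 of_nat_add of_nat_le_iff of_nat_mult)
  also have "\<dots> \<le> real M * (real M / real D + 1)"
    by (intro mult_left_mono add_right_mono) (auto simp: of_nat_div_le_of_nat)
  finally show ?thesis .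
qed

definition small_primroot :: "nat \<Rightarrow> bool" where
  "small_primroot p \<longleftrightarrow> (\<exists>n. n > 0 \<and> squarefree n \<and> residue_primroot p n \<and> real n < real p powr 0.96)"

text \<open>A union bound: some good pair avoids all multiples of \<open>d^2\<close> with
  \<open>d\<close> in \<open>S\<close>. Its value is odd and below \<open>4 * M\<close>, so any
  prime square dividing it would come from a prime in \<open>S\<close>. As \<open>S\<close> may
  contain composite numbers, it can later be taken as a union of progressions.\<close>

lemma small_primroot_count:
  fixes p M :: nat
  defines "good \<equiv> (\<lambda>t. \<forall>q\<in>prime_factors (p - 1). \<not> q dvd dlog p (grid_val t))"
  assumes p: "prime p" and M: "4 * real M \<le> real p powr 0.96"
    and S: "finite S" "\<And>d. prime d \<Longrightarrow> odd d \<Longrightarrow> d\<^sup>2 \<le> 4 * M \<Longrightarrow> d \<in> S"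
    and count: "(\<Sum>d\<in>S. card {t \<in> grid M (d\<^sup>2). good t}) < card {t \<in> grid M 1. good t}"
  shows "small_primroot p"
proof -
  have p1: "p > 1" using p prime_gt_1_nat by auto
  have "card (\<Union>d\<in>S. {t \<in> grid M (d\<^sup>2). good t}) < card {t \<in> grid M 1. good t}"
    using card_UN_le[OF S(1), of "\<lambda>d. {t \<in> grid M (d\<^sup>2). good t}"] count by linarith
  hence "\<not> {t \<in> grid M 1. good t} \<subseteq> (\<Union>d\<in>S. {t \<in> grid M (d\<^sup>2). good t})"
    using card_mono[of "\<Union>d\<in>S. {t \<in> grid M (d\<^sup>2). good t}"] S(1) by (fastforce simp: not_le[symmetric])
  then obtain t where t: "t \<in> grid M 1" "good t" "\<And>d. d \<in> S \<Longrightarrow> t \<notin> grid M (d\<^sup>2)" by blast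
  define n where "n = grid_val t"
  have n: "n > 0" "n < 4 * M" "odd n" and dvd: "t \<in> grid M D \<longleftrightarrow> D dvd n" for D
    using t(1) by (auto simp: n_def grid_val_def grid_def)
  have "real n < 4 * real M" using n(2) by linarith
  hence bound: "real n < real p powr 0.96" using M by linarith
  also have "\<dots> \<le> real p powr 1" using p1 by (intro powr_mono) auto
  finally have "n < p" using p1 by simp
  hence "\<not> p dvd n" using n(1) by (auto dest: dvd_imp_le)
  hence "residue_primroot p n"
    using t(2) by (intro residue_primroot_dlogI[OF p]) (auto simp: n_def good_def)
  moreover have "squarefree n"
  proof (rule ccontr)
    assume "\<not> squarefree n"
    then obtain x where x: "x\<^sup>2 dvd n" "\<not> is_unit x" by (auto simp: squarefree_def)
    then obtain d where d: "prime d" "d dvd x" using prime_factor_nat by auto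
    hence "d\<^sup>2 dvd x\<^sup>2" by simp
    hence d2: "d\<^sup>2 dvd n" using x(1) dvd_trans by blast
    hence "odd d" using n(3) by (metis dvd_trans dvd_power pos2)
    moreover have "d\<^sup>2 \<le> 4 * M" using dvd_imp_le[OF d2] n by linarith
    ultimately have "d \<in> S" using S(2) d(1) by blast
    thus False using t(3) dvd d2 by blast
  qed
  ultimately show ?thesis using n(1) bound by (auto simp: small_primroot_def)
qed

section \<open>The sieve\<close>

text \<open>The Fourier coefficients on the residues modulo \<open>q\<close> of the indicator of
  \<open>\<not> q dvd k\<close>; applied to discrete logarithms, it marks the non-residues of
  \<open>q\<close>-th powers.\<close>

definition np_weight :: "nat \<Rightarrow> nat \<Rightarrow> real" where
  "np_weight q r = (if r = 0 then 1 else 0) - 1 / real q"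

text \<open>The Fourier coefficients of \<open>1 / q\<close> minus the indicator of
  \<open>q dvd k\<close>. Subtracting the mean makes the coefficient at 0 vanish, so this function
  produces no main term.\<close>

definition corr_weight :: "nat \<Rightarrow> nat \<Rightarrow> real" where
  "corr_weight q r = (if r = 0 then 1 / real q else 0) - 1 / real q"

lemma sum_if_0: "(q::nat) > 0 \<Longrightarrow> (\<Sum>r<q. (if r = 0 then f r else 0)) = (f 0 :: 'a :: comm_monoid_add)"
  by (subst sum.delta) auto

lemma sum_np_weight:
  assumes "q > 0"
  shows "(\<Sum>r<q. of_real (np_weight q r) * cis (2 * pi * real (r * k) / real q)) = of_bool (\<not> q dvd k)"
proof -
  have "(\<Sum>r<q. of_real (np_weight q r) * cis (2 * pi * real (r * k) / real q))
      = (\<Sum>r<q. (if r = 0 then cis (2 * pi * real (r * k) / real q) else 0))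
        - of_real (1 / real q) * (\<Sum>r<q. cis (2 * pi * real (r * k) / real q))"
    unfolding sum_distrib_left sum_subtractf[symmetric] np_weight_def
    by (intro sum.cong refl) (auto simp: algebra_simps)
  also have "\<dots> = of_bool (\<not> q dvd k)"
    unfolding sum_cis_root[OF assms] sum_if_0[OF assms] using assms by simp
  finally show ?thesis .
qed

lemma sum_corr_weight:
  assumes "q > 0"
  shows "(\<Sum>r<q. of_real (corr_weight q r) * cis (2 * pi * real (r * k) / real q))
     = of_real (1 / real q - of_bool (q dvd k))"
proof -
  have "(\<Sum>r<q. of_real (corr_weight q r) * cis (2 * pi * real (r * k) / real q))
      = (\<Sum>r<q. (if r = 0 then of_real (1 / real q) * cis (2 * pi * real (r * k) / real q) else 0))
        - of_real (1 / real q) * (\<Sum>r<q. cis (2 * pi * real (r * k) / real q))"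
    unfolding sum_distrib_left sum_subtractf[symmetric] corr_weight_def
    by (intro sum.cong refl) (auto simp: algebra_simps)
  also have "\<dots> = of_real (1 / real q - of_bool (q dvd k))"
    unfolding sum_cis_root[OF assms] sum_if_0[OF assms] using assms by simp
  finally show ?thesis .
qed

lemma sum_abs_np_weight:
  assumes "q > 0"
  shows "(\<Sum>r<q. \<bar>np_weight q r\<bar>) = 2 * (1 - 1 / real q)"
proof -
  have "(\<Sum>r<q. \<bar>np_weight q r\<bar>) = (\<Sum>r<q. (if r = 0 then 1 - 2 / real q else 0) + 1 / real q)"
    using assms by (intro sum.cong refl) (auto simp: np_weight_def)
  also have "\<dots> = 2 * (1 - 1 / real q)"
    unfolding sum.distrib sum_if_0[OF assms] using assms by (simp add: field_simps)
  finally show ?thesis .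
qed

lemma sum_abs_corr_weight:
  assumes "q > 0"
  shows "(\<Sum>r<q. \<bar>corr_weight q r\<bar>) = 1 - 1 / real q"
proof -
  have "(\<Sum>r<q. \<bar>corr_weight q r\<bar>) = (\<Sum>r<q. (if r = 0 then - 1 / real q else 0) + 1 / real q)"
    using assms by (intro sum.cong refl) (auto simp: corr_weight_def)
  also have "\<dots> = 1 - 1 / real q"
    unfolding sum.distrib sum_if_0[OF assms] using assms by (simp add: field_simps)
  finally show ?thesis .
qed

lemma prod_of_bool: "finite T \<Longrightarrow> (\<Prod>q\<in>T. of_bool (P q)) = (of_bool (\<forall>q\<in>T. P q) :: 'a :: comm_semiring_1)"
  by (induction T rule: finite_induct) auto

text \<open>For a set of primes with product n this is \<open>totient n / n\<close>, the expected
  proportion of numbers surviving the sieve by \<open>E\<close>.\<close>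

definition theta :: "nat set \<Rightarrow> real" where "theta E = (\<Prod>q\<in>E. 1 - 1 / real q)"

lemma inverse_nat_le_1: "1 / real q \<le> 1"
  by (cases q) auto

lemma theta_nonneg: "0 \<le> theta E"
  unfolding theta_def by (intro prod_nonneg) (simp add: inverse_nat_le_1)

text \<open>Abstracts from the grid: it is instantiated both by the full grid with its sharper bound
  and by the multiples of an odd number inside the grid.\<close>

locale char_sum_family =
  fixes p :: nat and I :: "'a set" and a :: "'a \<Rightarrow> nat" and B :: real
  assumes p: "prime p" and finite_I: "finite I" and nd: "\<And>t. t \<in> I \<Longrightarrow> \<not> p dvd a t"
    and char_bound: "\<And>\<psi>. nontrivial_char p \<psi> \<Longrightarrow> cmod (\<Sum>t\<in>I. \<psi> (a t)) \<le> B"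
begin

definition sifted :: "nat set \<Rightarrow> 'a set" where
  "sifted E = {t \<in> I. \<forall>q\<in>E. \<not> q dvd dlog p (a t)}"

text \<open>The trivial frequency of each \<open>q\<close> has weight \<open>1 - 1 / q\<close>,
  while the absolute values of all its weights add up to twice that. Hence the error factor
  \<open>2 ^ card E - 1\<close> relative to \<open>theta E\<close>.\<close>

lemma card_sifted:
  assumes fin: "finite E" and E: "\<And>q. q \<in> E \<Longrightarrow> prime q \<and> q dvd p - 1"
  shows "\<bar>real (card (sifted E)) - theta E * card I\<bar> \<le> theta E * (2 ^ card E - 1) * B"
proof -
  have pos: "q > 0" if "q \<in> E" for q using E[OF that] prime_gt_0_nat by auto
  have pos1: "1 - 1 / real q \<ge> 0" if "q \<in> E" for q using pos[OF that] by (simp add: field_simps)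
  have np0: "np_weight q 0 = 1 - 1 / real q" for q by (simp add: np_weight_def)
  have "(\<Sum>t\<in>I. \<Prod>q\<in>E. \<Sum>r<q. of_real (np_weight q r) * cis (2 * pi * real (r * dlog p (a t)) / real q))
      = (\<Sum>t\<in>I. \<Prod>q\<in>E. of_bool (\<not> q dvd dlog p (a t)))"
    by (intro sum.cong prod.cong refl sum_np_weight pos)
  also have "\<dots> = (\<Sum>t\<in>I. of_bool (\<forall>q\<in>E. \<not> q dvd dlog p (a t)))"
    by (simp only: prod_of_bool[OF fin])
  also have "\<dots> = of_real (real (card (sifted E)))"
    using finite_I by (simp add: sifted_def Int_def)
  finally have eq: "(\<Sum>t\<in>I. \<Prod>q\<in>E. \<Sum>r<q. of_real (np_weight q r) *
      cis (2 * pi * real (r * dlog p (a t)) / real q)) = of_real (real (card (sifted E)))" .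
  have "cmod (of_real (real (card (sifted E))) - of_real ((\<Prod>q\<in>E. np_weight q 0) * card I))
    \<le> ((\<Prod>q\<in>E. \<Sum>r<q. \<bar>np_weight q r\<bar>) - (\<Prod>q\<in>E. \<bar>np_weight q 0\<bar>)) * B"
    unfolding eq[symmetric]
    by (rule character_expansion_bound[where a = a, OF p fin E finite_I nd char_bound])
  also have "(\<Prod>q\<in>E. np_weight q 0) = theta E" by (simp add: theta_def np0)
  also have "(\<Prod>q\<in>E. \<bar>np_weight q 0\<bar>) = theta E"
    unfolding theta_def np0 by (intro prod.cong refl abs_of_nonneg pos1)
  also have "(\<Prod>q\<in>E. \<Sum>r<q. \<bar>np_weight q r\<bar>) = (\<Prod>q\<in>E. 2 * (1 - 1 / real q))"
    by (intro prod.cong refl sum_abs_np_weight pos)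
  also have "\<dots> = 2 ^ card E * theta E" by (simp only: prod.distrib prod_constant theta_def)
  finally show ?thesis by (simp only: of_real_diff[symmetric] norm_of_real) (simp add: algebra_simps)
qed

text \<open>The weights at \<open>s\<close> have no trivial frequency, so only error terms remain,
  and their absolute values add up to \<open>1 - 1 / s\<close>, half the amount for the indicator
  itself. This is why the mean is subtracted before estimating.\<close>

lemma sum_sifted_correction:
  assumes fin: "finite E" and E: "\<And>q. q \<in> E \<Longrightarrow> prime q \<and> q dvd p - 1"
    and s: "prime s" "s dvd p - 1" "s \<notin> E"
  shows "\<bar>\<Sum>t\<in>sifted E. 1 / real s - of_bool (s dvd dlog p (a t))\<bar>
     \<le> theta E * 2 ^ card E * (1 - 1 / real s) * B"
proof -
  define w where "w q = (if q = s then corr_weight q else np_weight q)" for q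
  have T: "q \<in> insert s E \<Longrightarrow> prime q \<and> q dvd p - 1" for q using E s by auto
  have fT: "finite (insert s E)" using fin by simp
  have pos: "q > 0" if "q \<in> E" for q using E[OF that] prime_gt_0_nat by auto
  have s0: "s > 0" using s(1) prime_gt_0_nat by auto
  have wE: "w q = np_weight q" if "q \<in> E" for q using that s(3) by (auto simp: w_def)
  have ws: "w s = corr_weight s" by (simp add: w_def)
  have "(\<Sum>t\<in>I. \<Prod>q\<in>insert s E. \<Sum>r<q. of_real (w q r) * cis (2 * pi * real (r * dlog p (a t)) / real q))
      = (\<Sum>t\<in>I. of_real (1 / real s - of_bool (s dvd dlog p (a t))) *
          (\<Prod>q\<in>E. of_bool (\<not> q dvd dlog p (a t))))"
    unfolding prod.insert[OF fin s(3)] ws sum_corr_weight[OF s0]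
    by (intro sum.cong arg_cong2[where f = "(*)"] prod.cong refl)
       (simp only: wE sum_np_weight[OF pos])
  also have "\<dots> = of_real (\<Sum>t\<in>I. (if \<forall>q\<in>E. \<not> q dvd dlog p (a t) then
          1 / real s - of_bool (s dvd dlog p (a t)) else 0))"
    unfolding of_real_sum by (intro sum.cong refl) (simp add: prod_of_bool[OF fin])
  also have "(\<Sum>t\<in>I. (if \<forall>q\<in>E. \<not> q dvd dlog p (a t) then
          1 / real s - of_bool (s dvd dlog p (a t)) else 0))
      = (\<Sum>t\<in>sifted E. 1 / real s - of_bool (s dvd dlog p (a t)))"
    unfolding sifted_def by (rule sum.inter_filter[OF finite_I, symmetric])
  finally have eq: "(\<Sum>t\<in>I. \<Prod>q\<in>insert s E. \<Sum>r<q. of_real (w q r) *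
      cis (2 * pi * real (r * dlog p (a t)) / real q))
      = of_real (\<Sum>t\<in>sifted E. 1 / real s - of_bool (s dvd dlog p (a t)))" .
  have w0: "(\<Prod>q\<in>insert s E. w q 0) = 0" "(\<Prod>q\<in>insert s E. \<bar>w q 0\<bar>) = 0"
    using fin s(3) by (simp_all add: ws corr_weight_def)
  have "cmod (of_real (\<Sum>t\<in>sifted E. 1 / real s - of_bool (s dvd dlog p (a t)))
       - of_real ((\<Prod>q\<in>insert s E. w q 0) * card I))
    \<le> ((\<Prod>q\<in>insert s E. \<Sum>r<q. \<bar>w q r\<bar>) - (\<Prod>q\<in>insert s E. \<bar>w q 0\<bar>)) * B"
    unfolding eq[symmetric]
    by (rule character_expansion_bound[where a = a, OF p fT T finite_I nd char_bound])
  also have "(\<Prod>q\<in>insert s E. \<Sum>r<q. \<bar>w q r\<bar>) = (1 - 1 / real s) * (\<Prod>q\<in>E. 2 * (1 - 1 / real q))"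
    unfolding prod.insert[OF fin s(3)] ws sum_abs_corr_weight[OF s0]
    by (intro arg_cong2[where f = "(*)"] prod.cong refl) (simp only: wE sum_abs_np_weight[OF pos])
  also have "(\<Prod>q\<in>E. 2 * (1 - 1 / real q)) = 2 ^ card E * theta E" by (simp only: prod.distrib prod_constant theta_def)
  finally have "cmod (of_real (\<Sum>t\<in>sifted E. 1 / real s - of_bool (s dvd dlog p (a t))))
     \<le> (1 - 1 / real s) * (2 ^ card E * theta E) * B"
    by (simp only: w0 mult_zero_left of_real_0 diff_zero)
  thus ?thesis by (simp only: norm_of_real mult_ac)
qed

text \<open>The primes in \<open>R\<close> are removed by a union bound, with the indicator of
  \<open>s dvd k\<close> written as \<open>1 / s\<close> minus its mean-free correction. They
  therefore cost a sum over \<open>R\<close> and do not enter the exponent of 2. The hypothesis on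
  the reciprocals makes \<open>1 - (\<Sum>s\<in>R. 1 / s)\<close> nonnegative, so that it may
  multiply the lower bound for \<open>sifted E\<close>.\<close>

lemma card_sifted_lower:
  assumes fin: "finite E" "finite R" and disj: "E \<inter> R = {}"
    and Q: "\<And>q. q \<in> E \<union> R \<Longrightarrow> prime q \<and> q dvd p - 1"
    and \<delta>: "(\<Sum>s\<in>R. 1 / real s) \<le> 1"
  shows "real (card (sifted (E \<union> R))) \<ge> theta E * ((1 - (\<Sum>s\<in>R. 1 / real s)) * card I
     - B * ((1 - (\<Sum>s\<in>R. 1 / real s)) * (2 ^ card E - 1) + 2 ^ card E * (\<Sum>s\<in>R. 1 - 1 / real s)))"
proof -
  let ?\<sigma> = "\<Sum>s\<in>R. 1 / real s"
  let ?k = "\<lambda>t. dlog p (a t)"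
  have finS: "finite (sifted E)" using finite_I by (simp add: sifted_def)
  have QE: "\<And>q. q \<in> E \<Longrightarrow> prime q \<and> q dvd p - 1" using Q by auto
  have "real (card (sifted (E \<union> R))) = (\<Sum>t\<in>sifted E. of_bool (\<forall>s\<in>R. \<not> s dvd ?k t))"
  proof -
    have "sifted (E \<union> R) = {t \<in> sifted E. \<forall>s\<in>R. \<not> s dvd ?k t}" by (auto simp: sifted_def)
    thus ?thesis using finS by (simp add: Int_def)
  qed
  also have "\<dots> \<ge> (\<Sum>t\<in>sifted E. 1 - (\<Sum>s\<in>R. of_bool (s dvd ?k t)))"
  proof (rule sum_mono)
    fix t
    show "1 - (\<Sum>s\<in>R. of_bool (s dvd ?k t)) \<le> (of_bool (\<forall>s\<in>R. \<not> s dvd ?k t) :: real)"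
    proof (cases "\<forall>s\<in>R. \<not> s dvd ?k t")
      case False
      then obtain s where s: "s \<in> R" "s dvd ?k t" by blast
      have "(of_bool (s dvd ?k t) :: real) \<le> (\<Sum>s\<in>R. of_bool (s dvd ?k t))"
        by (rule member_le_sum) (use s fin in auto)
      thus ?thesis using s False by simp
    qed auto
  qed
  also have "(\<Sum>t\<in>sifted E. 1 - (\<Sum>s\<in>R. of_bool (s dvd ?k t)))
      = (1 - ?\<sigma>) * card (sifted E) + (\<Sum>s\<in>R. \<Sum>t\<in>sifted E. 1 / real s - of_bool (s dvd ?k t))"
  proof -
    have "(\<Sum>s\<in>R. \<Sum>t\<in>sifted E. 1 / real s - of_bool (s dvd ?k t))
        = (\<Sum>t\<in>sifted E. ?\<sigma> - (\<Sum>s\<in>R. of_bool (s dvd ?k t)))"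
      by (subst sum.swap) (simp add: sum_subtractf)
    thus ?thesis by (simp add: sum_subtractf algebra_simps)
  qed
  finally have low: "real (card (sifted (E \<union> R))) \<ge>
      (1 - ?\<sigma>) * card (sifted E) + (\<Sum>s\<in>R. \<Sum>t\<in>sifted E. 1 / real s - of_bool (s dvd ?k t))" .
  have "theta E * card I - theta E * (2 ^ card E - 1) * B \<le> card (sifted E)"
    using card_sifted[OF fin(1) QE] by linarith
  hence 1: "(1 - ?\<sigma>) * (theta E * card I - theta E * (2 ^ card E - 1) * B) \<le> (1 - ?\<sigma>) * card (sifted E)"
    using \<delta> by (intro mult_left_mono) auto
  have 2: "(\<Sum>s\<in>R. - (theta E * 2 ^ card E * (1 - 1 / real s) * B))
      \<le> (\<Sum>s\<in>R. \<Sum>t\<in>sifted E. 1 / real s - of_bool (s dvd ?k t))"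
  proof (rule sum_mono)
    fix s assume "s \<in> R"
    hence "prime s" "s dvd p - 1" "s \<notin> E" using Q disj by auto
    from sum_sifted_correction[OF fin(1) QE this]
    show "- (theta E * 2 ^ card E * (1 - 1 / real s) * B)
      \<le> (\<Sum>t\<in>sifted E. 1 / real s - of_bool (s dvd ?k t))" by linarith
  qed
  have 3: "(\<Sum>s\<in>R. - (theta E * 2 ^ card E * (1 - 1 / real s) * B))
      = - (theta E * 2 ^ card E * B * (\<Sum>s\<in>R. 1 - 1 / real s))"
    by (simp add: sum_negf sum_distrib_left mult_ac)
  have "theta E * ((1 - ?\<sigma>) * card I
     - B * ((1 - ?\<sigma>) * (2 ^ card E - 1) + 2 ^ card E * (\<Sum>s\<in>R. 1 - 1 / real s)))
     = (1 - ?\<sigma>) * (theta E * card I - theta E * (2 ^ card E - 1) * B)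
       - theta E * 2 ^ card E * B * (\<Sum>s\<in>R. 1 - 1 / real s)"
    by (simp add: algebra_simps)
  thus ?thesis using low 1 2 3 by linarith
qed

end

section \<open>The criterion for a given set of prime factors\<close>

text \<open>Each summand is at most 1/18 of \<open>1 / (t - 1 / 2) - 1 / (t + 1 / 2)\<close>, so the
  sum telescopes; starting at \<open>t = 2\<close> it leaves 1/18 * 2/3 = 1/27.\<close>

lemma telescoping_tail:
  "(\<Sum>t=2..T. 1 / (6 * real t - 1)\<^sup>2 + 1 / (6 * real t + 1)\<^sup>2) \<le> 1 / 27"
proof -
  have term_le: "1 / (6 * real t - 1)\<^sup>2 + 1 / (6 * real t + 1)\<^sup>2
      \<le> (1 / 18) * (1 / (real t - 1 / 2) - 1 / (real t + 1 / 2))" if "t \<ge> 1" for t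
  proof -
    define u where "u = (real t)\<^sup>2"
    have t1: "real t \<ge> 1" using that by simp
    have u1: "u \<ge> 1" using t1 by (simp add: u_def one_le_power)
    have nz: "6 * real t - 1 \<noteq> 0" "6 * real t + 1 \<noteq> 0" "real t - 1 / 2 \<noteq> 0" "real t + 1 / 2 \<noteq> 0"
      using t1 by auto
    have "1 / (6 * real t - 1)\<^sup>2 + 1 / (6 * real t + 1)\<^sup>2
        = ((6 * real t + 1)\<^sup>2 + (6 * real t - 1)\<^sup>2) / ((6 * real t - 1) * (6 * real t + 1))\<^sup>2"
    proof -
      have "1 / a\<^sup>2 + 1 / b\<^sup>2 = (b\<^sup>2 + a\<^sup>2) / (a * b)\<^sup>2" if "a \<noteq> 0" "b \<noteq> 0" for a b :: real
        using that by (simp add: field_simps)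
      from this[OF nz(1,2)] show ?thesis .
    qed
    also have "(6 * real t + 1)\<^sup>2 + (6 * real t - 1)\<^sup>2 = 72 * u + 2"
      by (simp add: u_def power2_eq_square algebra_simps)
    also have "(6 * real t - 1) * (6 * real t + 1) = 36 * u - 1"
      by (simp add: u_def power2_eq_square algebra_simps)
    finally have l: "1 / (6 * real t - 1)\<^sup>2 + 1 / (6 * real t + 1)\<^sup>2 = (72 * u + 2) / (36 * u - 1)\<^sup>2" .
    have "1 / (real t - 1 / 2) - 1 / (real t + 1 / 2) = 1 / ((real t - 1 / 2) * (real t + 1 / 2))"
      using nz by (simp add: field_simps)
    also have "(real t - 1 / 2) * (real t + 1 / 2) = u - 1 / 4"
      by (simp add: u_def power2_eq_square algebra_simps)
    finally have diff: "1 / (real t - 1 / 2) - 1 / (real t + 1 / 2) = 1 / (u - 1 / 4)" .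
    have r: "(1 / 18) * (1 / (real t - 1 / 2) - 1 / (real t + 1 / 2)) = 2 / (36 * u - 9)"
      unfolding diff using u1 by (simp add: field_simps)
    have "(72 * u + 2) * (36 * u - 9) \<le> 2 * (36 * u - 1)\<^sup>2"
      using u1 by (simp add: power2_eq_square algebra_simps)
    hence "72 * u + 2 \<le> 2 * (36 * u - 1)\<^sup>2 / (36 * u - 9)"
      using u1 by (subst pos_le_divide_eq) auto
    hence "72 * u + 2 \<le> 2 / (36 * u - 9) * (36 * u - 1)\<^sup>2" by simp
    moreover have "(36 * u - 1)\<^sup>2 > 0" using u1 by (intro zero_less_power) auto
    ultimately have "(72 * u + 2) / (36 * u - 1)\<^sup>2 \<le> 2 / (36 * u - 9)"
      by (simp only: pos_divide_le_eq)
    thus ?thesis by (simp only: l r)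
  qed
  have "(\<Sum>t=2..T. 1 / (6 * real t - 1)\<^sup>2 + 1 / (6 * real t + 1)\<^sup>2)
      \<le> (1 / 18) * (2 / 3 - 1 / (real T + 1 / 2))" if "T \<ge> 1"
    using that
  proof (induction T rule: dec_induct)
    case (step n)
    have "(\<Sum>t=2..Suc n. 1 / (6 * real t - 1)\<^sup>2 + 1 / (6 * real t + 1)\<^sup>2)
        = (\<Sum>t=2..n. 1 / (6 * real t - 1)\<^sup>2 + 1 / (6 * real t + 1)\<^sup>2)
          + (1 / (6 * real (Suc n) - 1)\<^sup>2 + 1 / (6 * real (Suc n) + 1)\<^sup>2)"
      using step.hyps by (subst sum.cl_ivl_Suc) auto
    also have "\<dots> \<le> (1 / 18) * (2 / 3 - 1 / (real n + 1 / 2)) +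
        (1 / 18) * (1 / (real (Suc n) - 1 / 2) - 1 / (real (Suc n) + 1 / 2))"
      by (intro add_mono step.IH term_le) auto
    also have "real (Suc n) - 1 / 2 = real n + 1 / 2" by simp
    finally show ?case by (simp add: algebra_simps)
  qed simp
  note bound = this
  show ?thesis
  proof (cases "T \<ge> 1")
    case True
    have "1 / (real T + 1 / 2) \<ge> 0" by simp
    with bound[OF True] show ?thesis by argo
  qed (simp add: not_le)
qed

lemma grid_val_less: "t \<in> grid M D \<Longrightarrow> 0 < grid_val t \<and> grid_val t < 4 * M"
  by (auto simp: grid_def grid_val_def)

context
  fixes p M :: nat
  assumes p: "prime p" and p2: "p > 2" and M: "4 * real M \<le> real p powr 0.96"
begin

lemma four_M_le: "4 * M \<le> p"
proof -
  have "real p powr 0.96 \<le> real p powr 1" using p2 by (intro powr_mono) auto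
  hence "real (4 * M) \<le> real p" using M p2 by simp
  thus ?thesis by (simp only: of_nat_le_iff)
qed

lemma grid_val_not_dvd: "t \<in> grid M D \<Longrightarrow> \<not> p dvd grid_val t"
  using grid_val_less[of t M D] four_M_le by (auto dest: dvd_imp_le)

lemma grid_1_family: "char_sum_family p (grid M 1) grid_val (sqrt p * (real M - (real M)\<^sup>2 / p))"
  by standard (use p grid_val_not_dvd char_sum_grid_1[OF p] four_M_le in auto)

lemma grid_family: "odd D \<Longrightarrow> char_sum_family p (grid M D) grid_val (sqrt p * M)"
  by standard (use p grid_val_not_dvd char_sum_grid[OF p] four_M_le in auto)

lemma prime_factors_pred: "q \<in> prime_factors (p - 1) \<Longrightarrow> prime q \<and> q dvd p - 1"
  by (auto simp: prime_factors_dvd)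

lemma two_prime_factor: "2 \<in> prime_factors (p - 1)"
proof -
  have "odd p" using p p2 prime_odd_nat by blast
  thus ?thesis using p2 by (simp add: prime_factors_dvd)
qed

abbreviation sift :: "nat \<Rightarrow> nat set \<Rightarrow> (nat \<times> nat) set" where
  "sift D Q \<equiv> char_sum_family.sifted p (grid M D) grid_val Q"

lemma sift_eq: "odd D \<Longrightarrow> sift D Q = {t \<in> grid M D. \<forall>q\<in>Q. \<not> q dvd dlog p (grid_val t)}"
  using char_sum_family.sifted_def[OF grid_family] .

lemma card_sift_le_grid: "odd D \<Longrightarrow> card (sift D Q) \<le> card (grid M D)"
  unfolding sift_eq by (intro card_mono) auto

text \<open>A primitive root is a quadratic nonresidue; this costs only one nontrivial character.\<close>
lemma card_sift_le_half:
  assumes D: "odd D"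
  shows "real (card (sift D (prime_factors (p - 1)))) \<le> (card (grid M D) + sqrt p * M) / 2"
proof -
  interpret char_sum_family p "grid M D" grid_val "sqrt p * M" by (rule grid_family[OF D])
  have "card (sifted (prime_factors (p - 1))) \<le> card (sifted {2})"
    unfolding sifted_def using two_prime_factor by (intro card_mono) auto
  moreover have "\<bar>real (card (sifted {2})) - theta {2} * card (grid M D)\<bar>
      \<le> theta {2} * (2 ^ card {2::nat} - 1) * (sqrt p * M)"
    using prime_factors_pred[OF two_prime_factor] by (intro card_sifted) auto
  moreover have "theta {2} = 1 / 2" by (simp add: theta_def)
  ultimately show ?thesis by (simp add: field_simps)
qed

lemma sum_card_union_le:
  fixes g :: "nat \<Rightarrow> nat"
  shows "finite A \<Longrightarrow> finite B \<Longrightarrow> sum g (A \<union> B) \<le> sum g A + sum g B"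
  by (metis le_add1 sum.union_inter)

text \<open>The constants \<open>1 / 18\<close>, \<open>1 / 50\<close>, \<open>1 / 98\<close> are half the densities of the multiples of \<open>3\<^sup>2\<close>,
  \<open>5\<^sup>2\<close>, \<open>7\<^sup>2\<close>, and \<open>1 / 27\<close> accounts for \<open>d = 6 * t - 1\<close> and \<open>d = 6 * t + 1\<close> with \<open>t \<ge> 2\<close>.\<close>
lemma small_primroot_criterion:
  fixes e f h :: real and E R :: "nat set"
  assumes M7: "M \<ge> 7"
    and Q: "prime_factors (p - 1) = E \<union> R" "E \<inter> R = {}"
    and e: "sqrt p / M \<le> e" and f: "sqrt p / M - 1 / sqrt p \<le> f" and h: "1 / sqrt M \<le> h"
    and main: "1 / 18 + 1 / 50 + 1 / 98 + 1 / 27 + 3 / 2 * e + 2 / 3 * h <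
      theta E * (1 - f * (2 ^ card E - 1) - (\<Sum>s\<in>R. 1 / s + f * (1 / s + 2 ^ card E * (1 - 2 / s))))"
  shows "small_primroot p"
proof -
  define m where "m = real M"
  have m: "m \<ge> 7" using M7 by (simp add: m_def)
  have p0: "real p > 0" using p2 by simp
  have fin: "finite E" "finite R" using Q(1) by (metis finite_Un finite_set_mset)+
  have QE: "\<And>q. q \<in> E \<union> R \<Longrightarrow> prime q \<and> q dvd p - 1"
    using prime_factors_pred Q(1) by blast
  have R2: "real s \<ge> 2" if "s \<in> R" for s using QE[of s] that prime_ge_2_nat by force
  define \<sigma> where "\<sigma> = (\<Sum>s\<in>R. 1 / real s)"
  define \<phi> where "\<phi> = sqrt p / m - 1 / sqrt p"
  define k where "k = (2::real) ^ card E"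
  have k1: "k \<ge> 1" by (simp add: k_def)
  have "m \<le> p" using four_M_le by (simp add: m_def)
  hence \<phi>0: "\<phi> \<ge> 0" using m p0 by (simp add: \<phi>_def field_simps)
  have f0: "f \<ge> 0" using f \<phi>0 by (simp add: \<phi>_def m_def)
  have h0: "h \<ge> 0" using h by (meson divide_nonneg_nonneg order_trans real_sqrt_ge_zero of_nat_0_le_iff zero_le_one)
  have e0: "e \<ge> 0" using e by (meson divide_nonneg_nonneg order_trans real_sqrt_ge_zero of_nat_0_le_iff)
  \<comment> \<open>The lower bound for sifted pairs in units of \<open>theta E * M^2\<close>,
    arranged so that each \<open>s\<close> in \<open>R\<close> has a separate cost. The fact
    \<open>br_eq\<close> regroups it into the form delivered by
    \<open>card_sifted_lower\<close>.\<close>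
  define br where "br = 1 - f * (k - 1) - (\<Sum>s\<in>R. 1 / s + f * (1 / s + k * (1 - 2 / s)))"
  have lossmain: "1 / 18 + 1 / 50 + 1 / 98 + 1 / 27 + 3 / 2 * e + 2 / 3 * h < theta E * br"
    using main by (simp add: br_def k_def)
  have br0: "br > 0"
  proof (rule ccontr)
    assume "\<not> br > 0"
    hence "theta E * br \<le> 0" using theta_nonneg[of E] by (simp add: mult_nonneg_nonpos)
    thus False using lossmain e0 h0 by linarith
  qed
  \<comment> \<open>The sieve bound presupposes \<open>\<sigma> \<le> 1\<close>; this need not be
    checked separately, because \<open>br > 0\<close> already forces it.\<close>
  have \<sigma>1: "\<sigma> \<le> 1"
  proof -
    have "br \<le> 1 - \<sigma>"
    proof -
      have "\<sigma> \<le> (\<Sum>s\<in>R. 1 / s + f * (1 / s + k * (1 - 2 / s)))"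
        unfolding \<sigma>_def
      proof (rule sum_mono)
        fix s assume "s \<in> R"
        from R2[OF this] have "1 - 2 / real s \<ge> 0" by simp
        thus "1 / real s \<le> 1 / real s + f * (1 / real s + k * (1 - 2 / real s))"
          using f0 k1 by simp
      qed
      moreover have "f * (k - 1) \<ge> 0" using f0 k1 by simp
      ultimately show ?thesis by (simp add: br_def)
    qed
    thus ?thesis using br0 by simp
  qed
  define K where "K = (1 - \<sigma>) * (k - 1) + k * (\<Sum>s\<in>R. 1 - 1 / real s)"
  have K0: "K \<ge> 0"
    unfolding K_def using \<sigma>1 k1 by (intro add_nonneg_nonneg mult_nonneg_nonneg sum_nonneg) (auto simp: inverse_nat_le_1)
  have br_eq: "br = (1 - \<sigma>) - f * K"
  proof -
    have "(\<Sum>s\<in>R. 1 / s + f * (1 / s + k * (1 - 2 / s)))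
        = (\<Sum>s\<in>R. 1 / real s + f * (1 / s) - f * k * (1 / s) + f * k * (1 - 1 / real s))"
      by (intro sum.cong refl) (simp add: algebra_simps)
    also have "\<dots> = \<sigma> + f * \<sigma> - f * k * \<sigma> + f * k * (\<Sum>s\<in>R. 1 - 1 / real s)"
    proof -
      have "(\<Sum>s\<in>R. A s + f * A s - f * k * A s + f * k * C s)
          = sum A R + f * sum A R - f * k * sum A R + f * k * sum C R" for A C :: "nat \<Rightarrow> real"
        by (simp add: sum.distrib sum_subtractf sum_distrib_left)
      thus ?thesis unfolding \<sigma>_def .
    qed
    finally show ?thesis unfolding br_def K_def by (simp add: algebra_simps)
  qed
  interpret G1: char_sum_family p "grid M 1" grid_val "sqrt p * (real M - (real M)\<^sup>2 / p)"
    by (rule grid_1_family)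
  have B1: "sqrt p * (real M - (real M)\<^sup>2 / p) = m\<^sup>2 * \<phi>"
  proof -
    have "sqrt p * ((real M)\<^sup>2 / p) = m\<^sup>2 * (sqrt p / p)" by (simp add: m_def)
    also have "sqrt p / p = 1 / sqrt p" using p0 by (simp add: real_div_sqrt field_simps)
    finally show ?thesis using m by (simp add: \<phi>_def m_def right_diff_distrib power2_eq_square)
  qed
  have cardI: "real (card (grid M 1)) = m\<^sup>2"
    by (simp only: grid_1 card_cartesian_product card_lessThan m_def of_nat_mult power2_eq_square)
  have "theta E * ((1 - \<sigma>) * m\<^sup>2 - m\<^sup>2 * \<phi> * K) \<le> card (sift 1 (E \<union> R))"
    using G1.card_sifted_lower[OF fin Q(2) QE \<sigma>1[unfolded \<sigma>_def]]
    unfolding B1 cardI \<sigma>_def[symmetric] k_def[symmetric] K_def[symmetric] .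
  moreover have "theta E * br * m\<^sup>2 \<le> theta E * ((1 - \<sigma>) * m\<^sup>2 - m\<^sup>2 * \<phi> * K)"
  proof -
    have "\<phi> * K \<le> f * K" using f K0 by (intro mult_right_mono) (auto simp: \<phi>_def m_def)
    hence "br \<le> (1 - \<sigma>) - \<phi> * K" by (simp add: br_eq)
    hence "theta E * m\<^sup>2 * br \<le> theta E * m\<^sup>2 * ((1 - \<sigma>) - \<phi> * K)"
      by (intro mult_left_mono mult_nonneg_nonneg theta_nonneg) auto
    thus ?thesis by (simp add: algebra_simps)
  qed
  ultimately have lower: "theta E * br * m\<^sup>2 \<le> card (sift 1 (prime_factors (p - 1)))"
    unfolding Q(1) by linarith

  define g where "g d = card {t \<in> grid M (d\<^sup>2). \<forall>q\<in>prime_factors (p - 1). \<not> q dvd dlog p (grid_val t)}"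
    for d :: nat
  have g_eq: "g d = card (sift (d\<^sup>2) (prime_factors (p - 1)))" if "odd d" for d
    unfolding g_def by (subst sift_eq) (use that in auto)
  \<comment> \<open>A prime with \<open>d^2 \<le> 4 * M\<close> is at most
    \<open>2 * sqrt m\<close>, and \<open>d\<close> is at least \<open>6 * t - 1\<close>, which
    limits \<open>t\<close> to this value.\<close>
  define T where "T = nat \<lfloor>(2 * sqrt m + 1) / 6\<rfloor>"
  define S where "S = {3, 5, 7} \<union> ((\<lambda>t. 6 * t - 1) ` {2..T} \<union> (\<lambda>t. 6 * t + 1) ` {2..T})"
  have sqm: "sqrt m \<ge> 5 / 2"
    by (rule real_le_rsqrt) (use m in \<open>simp add: power2_eq_square\<close>)
  have T_le: "real T \<le> (2 * sqrt m + 1) / 6" unfolding T_def using sqm by (intro of_nat_floor) simp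
  have T1: "T \<ge> 1" unfolding T_def using sqm by (simp add: le_nat_iff le_floor_iff)
  have finS: "finite S" by (simp add: S_def)
  have cover: "d \<in> S" if d: "prime d" "odd d" "d\<^sup>2 \<le> 4 * M" for d
  proof (cases "d \<in> {3, 5, 7}")
    case False
    have d2: "d \<ge> 2" using d(1) prime_ge_2_nat by auto
    have "\<not> 3 dvd d" using d(1) False primes_dvd_imp_eq[of 3 d] by auto
    hence "d mod 6 = 1 \<or> d mod 6 = 5" using d(2) by presburger
    moreover have "d \<noteq> 1" "d \<noteq> 5" "d \<noteq> 7" using False d2 by auto
    ultimately obtain t where t: "t \<ge> 2" "d = 6 * t - 1 \<or> d = 6 * t + 1"
    proof -
      assume *: "d mod 6 = 1 \<or> d mod 6 = 5" and ne: "d \<noteq> 1" "d \<noteq> 5" "d \<noteq> 7"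
        and th: "\<And>t. 2 \<le> t \<Longrightarrow> d = 6 * t - 1 \<or> d = 6 * t + 1 \<Longrightarrow> thesis"
      have "2 \<le> (d + 1) div 6" "d = 6 * ((d + 1) div 6) - 1 \<or> d = 6 * ((d + 1) div 6) + 1"
        using * ne by presburger+
      thus thesis by (rule th)
    qed
    have "(real d)\<^sup>2 \<le> (2 * sqrt m)\<^sup>2"
    proof -
      have "real (d\<^sup>2) \<le> real (4 * M)" using d(3) by (simp only: of_nat_le_iff)
      thus ?thesis by (simp add: power_mult_distrib m_def)
    qed
    hence "real d \<le> 2 * sqrt m" by (rule power2_le_imp_le) (use m in auto)
    moreover have "6 * real t - 1 \<le> real d" using t by auto
    ultimately have "6 * real t \<le> 2 * sqrt m + 1" by argo
    hence "real t \<le> (2 * sqrt m + 1) / 6" by (simp add: pos_le_divide_eq)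
    hence "t \<le> T" unfolding T_def by (simp add: le_nat_floor)
    thus ?thesis using t by (auto simp: S_def)
  qed (auto simp: S_def)

  \<comment> \<open>\<open>w\<close> is the error of the bound through the quadratic character.
    Being of order \<open>sqrt p * m\<close> it is accepted only for d = 3, 5, 7. For the roughly
    \<open>2 / 3 * sqrt m\<close> larger \<open>d\<close> the trivial count, with error only
    \<open>m\<close>, is better although it forgoes the factor 1/2 in the density.\<close>
  define w where "w = (m + sqrt p * m) / 2"
  have half: "real (g d) \<le> m\<^sup>2 * (1 / (2 * (real d)\<^sup>2)) + w" if "odd d" for d
  proof -
    have "real (g d) \<le> (card (grid M (d\<^sup>2)) + sqrt p * M) / 2"
      unfolding g_eq[OF that] by (rule card_sift_le_half) (use that in simp)
    also have "\<dots> \<le> (real M * (real M / real (d\<^sup>2) + 1) + sqrt p * M) / 2"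
      by (intro divide_right_mono add_mono card_grid) (use that in auto)
    also have "\<dots> = m\<^sup>2 * (1 / (2 * (real d)\<^sup>2)) + w"
      by (simp add: w_def m_def field_simps power2_eq_square)
    finally show ?thesis .
  qed
  have triv: "real (g d) \<le> m\<^sup>2 * (1 / (real d)\<^sup>2) + m" if "odd d" for d
  proof -
    have "real (g d) \<le> real (card (grid M (d\<^sup>2)))"
      unfolding g_eq[OF that] of_nat_le_iff by (rule card_sift_le_grid) (use that in simp)
    also have "\<dots> \<le> real M * (real M / real (d\<^sup>2) + 1)" by (rule card_grid) (use that in simp)
    also have "\<dots> = m\<^sup>2 * (1 / (real d)\<^sup>2) + m" by (simp add: m_def field_simps power2_eq_square)
    finally show ?thesis .
  qed
  have "sum g S \<le> sum g {3, 5, 7} + (sum g ((\<lambda>t. 6 * t - 1) ` {2..T}) + sum g ((\<lambda>t. 6 * t + 1) ` {2..T}))"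
    unfolding S_def
    by (rule order_trans[OF sum_card_union_le add_left_mono[OF sum_card_union_le]]) auto
  also have "sum g ((\<lambda>t. 6 * t - 1) ` {2..T}) = (\<Sum>t=2..T. g (6 * t - 1))"
    by (subst sum.reindex) (auto simp: inj_on_def)
  also have "sum g ((\<lambda>t. 6 * t + 1) ` {2..T}) = (\<Sum>t=2..T. g (6 * t + 1))"
    by (subst sum.reindex) (auto simp: inj_on_def)
  finally have "real (sum g S) \<le> real (g 3 + (g 5 + g 7)) + (\<Sum>t=2..T. real (g (6 * t - 1)) + real (g (6 * t + 1)))"
    by (simp only: sum.distrib[symmetric] of_nat_sum[symmetric] of_nat_add[symmetric] of_nat_le_iff) simp
  also have "\<dots> \<le> (m\<^sup>2 * (1 / 18 + 1 / 50 + 1 / 98) + 3 * w) +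
      (\<Sum>t=2..T. m\<^sup>2 * (1 / (6 * real t - 1)\<^sup>2 + 1 / (6 * real t + 1)\<^sup>2) + 2 * m)"
  proof (rule add_mono[OF _ sum_mono])
    show "real (g 3 + (g 5 + g 7)) \<le> m\<^sup>2 * (1 / 18 + 1 / 50 + 1 / 98) + 3 * w"
    proof -
      have "real (g 3) \<le> m\<^sup>2 * (1 / 18) + w" "real (g 5) \<le> m\<^sup>2 * (1 / 50) + w"
        "real (g 7) \<le> m\<^sup>2 * (1 / 98) + w"
        using half[of 3] half[of 5] half[of 7] by simp_all
      thus ?thesis unfolding of_nat_add by argo
    qed
  next
    fix t assume t: "t \<in> {2..T}"
    have "odd (6 * t - 1)" "odd (6 * t + 1)" using t by auto
    note tr = triv[OF this(1)] triv[OF this(2)]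
    have r: "real (6 * t - 1) = 6 * real t - 1" "real (6 * t + 1) = 6 * real t + 1"
      using t by (simp_all add: of_nat_diff)
    have "m\<^sup>2 * (1 / (6 * real t - 1)\<^sup>2 + 1 / (6 * real t + 1)\<^sup>2) + 2 * m
        = (m\<^sup>2 * (1 / (6 * real t - 1)\<^sup>2) + m) + (m\<^sup>2 * (1 / (6 * real t + 1)\<^sup>2) + m)"
      unfolding distrib_left by simp
    thus "real (g (6 * t - 1)) + real (g (6 * t + 1))
        \<le> m\<^sup>2 * (1 / (6 * real t - 1)\<^sup>2 + 1 / (6 * real t + 1)\<^sup>2) + 2 * m"
      using add_mono[OF tr[unfolded r]] by (simp only:)
  qed
  also have "(\<Sum>t=2..T. m\<^sup>2 * (1 / (6 * real t - 1)\<^sup>2 + 1 / (6 * real t + 1)\<^sup>2) + 2 * m)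
      = m\<^sup>2 * (\<Sum>t=2..T. 1 / (6 * real t - 1)\<^sup>2 + 1 / (6 * real t + 1)\<^sup>2) + (real T - 1) * (2 * m)"
  proof -
    have "(\<Sum>t=2..T. m\<^sup>2 * F t + 2 * m) = m\<^sup>2 * sum F {2..T} + (real T - 1) * (2 * m)" for F
      using T1 by (simp add: sum.distrib sum_distrib_left of_nat_diff)
    thus ?thesis .
  qed
  also have "\<dots> \<le> m\<^sup>2 * (1 / 27) + ((2 * sqrt m + 1) / 6 - 1) * (2 * m)"
    using telescoping_tail[of T] T_le m
    by (intro add_mono[OF mult_left_mono mult_right_mono]) auto
  also have "m\<^sup>2 * (1 / 18 + 1 / 50 + 1 / 98) + 3 * w +
      (m\<^sup>2 * (1 / 27) + ((2 * sqrt m + 1) / 6 - 1) * (2 * m))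
      \<le> m\<^sup>2 * (1 / 18 + 1 / 50 + 1 / 98 + 1 / 27 + 3 / 2 * (sqrt p / m) + 2 / 3 * (1 / sqrt m))"
  proof -
    have "m\<^sup>2 * (sqrt p / m) = sqrt p * m" using m by (simp add: power2_eq_square)
    moreover have "m\<^sup>2 * (1 / sqrt m) = sqrt m * m"
      using m by (simp add: power2_eq_square field_simps)
    moreover have "m\<^sup>2 * (1 / 18 + 1 / 50 + 1 / 98 + 1 / 27 + 3 / 2 * u + 2 / 3 * v)
        = m\<^sup>2 * (1 / 18 + 1 / 50 + 1 / 98) + m\<^sup>2 * (1 / 27) + 3 / 2 * (m\<^sup>2 * u) + 2 / 3 * (m\<^sup>2 * v)"
      for u v by (simp only: distrib_left mult_ac)
    moreover have "((2 * sqrt m + 1) / 6 - 1) * (2 * m) = 2 / 3 * (sqrt m * m) - 5 / 3 * m"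
      by (simp add: field_simps)
    ultimately show ?thesis using m unfolding w_def by argo
  qed
  also have "\<dots> \<le> m\<^sup>2 * (1 / 18 + 1 / 50 + 1 / 98 + 1 / 27 + 3 / 2 * e + 2 / 3 * h)"
    using e h by (intro mult_left_mono add_mono) (auto simp: m_def)
  also have "\<dots> < m\<^sup>2 * (theta E * br)"
    using lossmain m by (intro mult_strict_left_mono) auto
  also have "\<dots> \<le> card (sift 1 (prime_factors (p - 1)))" using lower by (simp add: mult_ac)
  finally have "sum g S < card (sift 1 (prime_factors (p - 1)))" by (simp only: of_nat_less_iff)
  thus ?thesis
    using small_primroot_count[OF p M finS cover] unfolding g_def sift_eq[OF odd_one] by blast
qed

end

section \<open>Large primes\<close>

text \<open>As \<open>4 * x * (x + 1) \<le> (2 * x + 1)^2\<close>, the sum is dominated by a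
  telescoping one. For \<open>a = 0\<close> it bounds the loss to all odd squares beyond 1 by a
  quarter.\<close>

lemma sum_inverse_odd_squares:
  "(\<Sum>t\<in>{a<..b}. 1 / (2 * real t + 1)\<^sup>2) \<le> 1 / (4 * (real a + 1))"
proof -
  have "(\<Sum>t\<in>{a<..b}. 1 / (2 * real t + 1)\<^sup>2) \<le> 1 / 4 * (1 / (real a + 1) - 1 / (real b + 1))"
    if "a \<le> b" using that
  proof (induction b rule: dec_induct)
    case (step n)
    define x where "x = real n + 1"
    have x: "x > 0" by (simp add: x_def)
    have "4 * (x * (x + 1)) \<le> (2 * x + 1)\<^sup>2" by (simp add: power2_eq_square algebra_simps)
    hence "1 / (2 * x + 1)\<^sup>2 \<le> 1 / (4 * (x * (x + 1)))"
      using x by (intro divide_left_mono mult_pos_pos) auto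
    also have "\<dots> = 1 / 4 * (1 / x - 1 / (x + 1))" using x by (simp add: field_simps)
    finally have le: "1 / (2 * x + 1)\<^sup>2 \<le> 1 / 4 * (1 / x - 1 / (x + 1))" .
    have ins: "{a<..Suc n} = insert (Suc n) {a<..n}" using step.hyps by auto
    have "(\<Sum>t\<in>{a<..Suc n}. 1 / (2 * real t + 1)\<^sup>2)
        = 1 / (2 * x + 1)\<^sup>2 + (\<Sum>t\<in>{a<..n}. 1 / (2 * real t + 1)\<^sup>2)"
      unfolding ins x_def by (subst sum.insert) (auto simp: add_ac)
    also have "\<dots> \<le> 1 / 4 * (1 / x - 1 / (x + 1)) + 1 / 4 * (1 / (real a + 1) - 1 / (real n + 1))"
      by (intro add_mono le step.IH)
    finally show ?case by (simp add: x_def algebra_simps)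
  qed simp
  moreover have "1 / 4 * (1 / (real a + 1) - 1 / (real b + 1)) \<le> 1 / (4 * (real a + 1))"
    by (simp add: right_diff_distrib)
  ultimately show ?thesis by (cases "a \<le> b") (force, simp)
qed

text \<open>Rounded-up values of \<open>2 / (1 - 1 / q) / q powr 0.2\<close>; their product is below 74.\<close>
definition small_prime_factor_bound :: "nat \<Rightarrow> real" where
  "small_prime_factor_bound q =
    (if q = 2 then 3483 / 1000 else if q = 3 then 2409 / 1000 else if q = 5 then 1813 / 1000
     else if q = 7 then 1582 / 1000 else if q = 11 then 1362 / 1000 else if q = 13 then 1298 / 1000
     else if q = 17 then 1206 / 1000 else if q = 19 then 1172 / 1000 else if q = 23 then 1117 / 1000
     else if q = 29 then 1057 / 1000 else if q = 31 then 1040 / 1000 else 1)"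

lemma le_powr_fifth:
  assumes "0 \<le> x" "x ^ 5 \<le> real q"
  shows "x \<le> real q powr 0.2"
proof -
  have "(real q powr 0.2) ^ 5 = real q powr (5 * 0.2)"
    by (cases "q = 0") (simp_all add: powr_powr[symmetric] powr_realpow[symmetric] powr_powr)
  hence "x ^ 5 \<le> (real q powr 0.2) ^ 5" using assms by (cases "q = 0") auto
  thus ?thesis by (rule power_le_imp_le_base[of x 4, simplified]) simp
qed

lemma prime_cases_le_31:
  assumes "prime (q::nat)" "q < 37"
  shows "q \<in> {2, 3, 5, 7, 11, 13, 17, 19, 23, 29, 31}"
proof -
  have dv: "\<not> d dvd q" if "prime d" "q \<noteq> d" for d using assms(1) that primes_dvd_imp_eq by blast
  have "q \<ge> 2" using assms(1) prime_ge_2_nat by auto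
  moreover have "q = 2 \<or> \<not> 2 dvd q" "q = 3 \<or> \<not> 3 dvd q" "q = 5 \<or> \<not> 5 dvd q"
    using dv[of 2] dv[of 3] dv[of 5] by auto
  ultimately have "q = 2 \<or> q = 3 \<or> q = 5 \<or> q = 7 \<or> q = 11 \<or> q = 13 \<or> q = 17 \<or> q = 19 \<or> q = 23
      \<or> q = 29 \<or> q = 31"
    using assms(2) by presburger
  thus ?thesis by simp
qed

lemma two_over_theta_factor:
  assumes "prime q"
  shows "2 / (1 - 1 / real q) \<le> small_prime_factor_bound q * real q powr 0.2"
proof (cases "q < 37")
  case True
  have *: "2 / (1 - 1 / real q) \<le> c * real q powr 0.2"
    if "0 < c" "0 \<le> 2 / (1 - 1 / real q) / c" "(2 / (1 - 1 / real q) / c) ^ 5 \<le> real q" for c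
    using le_powr_fifth[OF that(2,3)] that(1) by (simp only: pos_divide_le_eq mult.commute)
  let ?c = "small_prime_factor_bound q"
  have "0 < ?c \<and> 0 \<le> 2 / (1 - 1 / real q) / ?c \<and> (2 / (1 - 1 / real q) / ?c) ^ 5 \<le> real q"
    using prime_cases_le_31[OF assms True] by (auto simp: small_prime_factor_bound_def power_divide)
  thus ?thesis using * by blast
next
  case False
  hence q: "real q \<ge> 37" by simp
  have "1 / real q \<le> 1 / 37" using q by (simp add: field_simps)
  hence "2 / (1 - 1 / real q) \<le> 2 / (36 / 37)" by (intro divide_left_mono) auto
  also have "\<dots> \<le> real q powr 0.2" by (rule le_powr_fifth) (use q in \<open>simp_all add: power_divide\<close>)
  finally show ?thesis using False by (simp add: small_prime_factor_bound_def)
qed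

lemma prod_primes_dvd:
  assumes "finite (Q::nat set)" "\<And>q. q \<in> Q \<Longrightarrow> prime q \<and> q dvd n"
  shows "\<Prod>Q dvd n"
  using assms
proof (induction Q rule: finite_induct)
  case (insert x F)
  have "coprime x (\<Prod>F)"
    by (rule prod_coprime_right) (use insert in \<open>auto intro!: primes_coprime\<close>)
  thus ?case using insert by (auto intro: divides_mult)
qed simp

text \<open>The factors \<open>q powr 0.2\<close> multiply to a power of the product of
  \<open>Q\<close>, which divides \<open>n\<close>; only the eleven primes up to 31 contribute a
  constant larger than 1.\<close>

lemma power_over_theta_le:
  assumes fin: "finite (Q::nat set)" and Q: "\<And>q. q \<in> Q \<Longrightarrow> prime q \<and> q dvd n" and n: "n > 0"
  shows "2 ^ card Q / theta Q \<le> 74 * real n powr 0.2"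
proof -
  let ?c = small_prime_factor_bound
  define S where "S = {2, 3, 5, 7, 11, 13, 17, 19, 23, 29, 31 :: nat}"
  have c1: "?c q \<ge> 1" for q by (simp add: small_prime_factor_bound_def)
  have cS: "?c q = 1" if "q \<notin> S" for q using that by (simp add: small_prime_factor_bound_def S_def)
  have q2: "real q \<ge> 2" if "q \<in> Q" for q using Q[OF that] prime_ge_2_nat by force
  have "2 ^ card Q / theta Q = (\<Prod>q\<in>Q. 2 / (1 - 1 / real q))"
    by (simp add: theta_def prod_dividef)
  also have "\<dots> \<le> (\<Prod>q\<in>Q. ?c q * real q powr 0.2)"
  proof (rule prod_mono)
    fix q assume q: "q \<in> Q"
    have "0 \<le> 2 / (1 - 1 / real q)" using q2[OF q] by (simp add: field_simps)
    thus "0 \<le> 2 / (1 - 1 / real q) \<and> 2 / (1 - 1 / real q) \<le> ?c q * real q powr 0.2"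
      using two_over_theta_factor[of q] Q[OF q] by blast
  qed
  also have "\<dots> = prod ?c Q * (\<Prod>q\<in>Q. real q powr 0.2)" by (rule prod.distrib)
  also have "(\<Prod>q\<in>Q. real q powr 0.2) = real (\<Prod>Q) powr 0.2"
    by (simp add: prod_powr_distrib)
  also have "prod ?c Q * real (\<Prod>Q) powr 0.2 \<le> 74 * real n powr 0.2"
  proof (rule mult_mono)
    have "prod ?c Q = prod ?c (Q \<inter> S)"
      by (rule prod.mono_neutral_right) (use fin cS in auto)
    also have "\<dots> \<le> prod ?c S"
      by (rule prod_mono2) (use c1 in \<open>auto simp: S_def intro: order_trans[OF zero_le_one]\<close>)
    also have "\<dots> \<le> 74" by (simp add: S_def small_prime_factor_bound_def)
    finally show "prod ?c Q \<le> 74" .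
    have "\<Prod>Q \<le> n" using prod_primes_dvd[OF fin Q] n by (rule dvd_imp_le)
    thus "real (\<Prod>Q) powr 0.2 \<le> real n powr 0.2" 
      by (intro powr_mono2) (simp_all del: of_nat_prod)
  qed auto
  finally show ?thesis .
qed

text \<open>Here all prime factors of \<open>p - 1\<close> are expanded at once, without the union
  bound. Squares of small odd \<open>d\<close> are sifted too and lose at most
  \<open>\<theta> / 4\<close> plus errors; large \<open>d\<close> are counted trivially, and their
  tail is cut off late enough to lose another \<open>\<theta> / 4\<close>. Half of the main term is
  left to absorb the errors.\<close>

lemma small_primroot_large:
  assumes p: "prime p" and p_large: "p \<ge> 4000000000000"
  shows "small_primroot p"
proof -
  \<comment> \<open>In terms of \<open>u\<close> the bound \<open>p powr 0.96\<close> is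
    \<open>u ^ 48\<close> and \<open>sqrt p\<close> is \<open>u ^ 25\<close>, so all estimates
    compare integer powers. The numerical input is \<open>u \<ge> 178 / 100\<close>, valid because
    1.78^50 is below 4 * 10^12.\<close>
  define u where "u = real p powr 0.02"
  have p0: "real p > 0" using p_large by simp
  have u0: "u > 0" using p0 by (simp add: u_def)
  have upow: "u ^ k = real p powr (0.02 * real k)" for k
    using p0 by (simp add: u_def powr_powr powr_realpow[symmetric])
  have u50: "u ^ 50 = p" using p0 by (simp add: upow)
  have u: "u \<ge> 178 / 100"
  proof (rule ccontr)
    assume "\<not> u \<ge> 178 / 100"
    hence "u ^ 50 \<le> (178 / 100) ^ 50" using u0 by (intro power_mono) auto
    also have "\<dots> < 4000000000000" by (simp add: power_divide)
    finally show False using u50 p_large by linarith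
  qed
  have x: "real p powr 0.96 = u ^ 48" by (simp add: upow)
  have sqrtp: "sqrt p = u ^ 25"
  proof (rule real_sqrt_unique)
    show "(u ^ 25)\<^sup>2 = p" using u50 by (simp add: power_mult[symmetric])
  qed (use u0 in simp)
  define M where "M = nat \<lfloor>u ^ 48 / 4\<rfloor>"
  have "(178 / 100) ^ 48 \<le> u ^ 48" using u by (intro power_mono) auto
  moreover have "(1000000 :: real) \<le> (178 / 100) ^ 48" by (simp add: power_divide)
  ultimately have u48: "u ^ 48 \<ge> 1000000" by linarith
  have M_le: "4 * real M \<le> u ^ 48"
  proof -
    have "real M \<le> u ^ 48 / 4" unfolding M_def using u0 by (intro of_nat_floor) simp
    thus ?thesis by simp
  qed
  have M_ge: "real M \<ge> u ^ 48 / 5"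
  proof -
    have "real M > u ^ 48 / 4 - 1" unfolding M_def using u48 by linarith
    thus ?thesis using u48 by linarith
  qed
  have Mpos: "real M > 0" using M_ge u48 by linarith
  have p2: "p > 2" using p_large by simp
  have M: "4 * real M \<le> real p powr 0.96" using M_le x by simp
  define Q where "Q = prime_factors (p - 1)"
  define \<theta> where "\<theta> = theta Q"
  define k where "k = (2::real) ^ card Q"
  have QP: "\<And>q. q \<in> Q \<Longrightarrow> prime q \<and> q dvd p - 1" by (auto simp: Q_def prime_factors_dvd)
  have finQ: "finite Q" by (simp add: Q_def)
  have \<theta>0: "\<theta> > 0" unfolding \<theta>_def theta_def
  proof (rule prod_pos)
    fix q assume "q \<in> Q"
    hence "real q \<ge> 2" using QP[of q] prime_ge_2_nat by force
    thus "0 < 1 - 1 / real q" by (simp add: field_simps)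
  qed
  have \<theta>1: "\<theta> \<le> 1" unfolding \<theta>_def theta_def
    by (intro prod_le_1) (auto simp: inverse_nat_le_1)
  have k2: "k \<ge> 2"
  proof -
    have "card Q > 0" using two_prime_factor[OF p p2 M] finQ by (auto simp: card_gt_0_iff Q_def)
    hence "(2::real) ^ 1 \<le> 2 ^ card Q" by (intro power_increasing) auto
    thus ?thesis by (simp add: k_def)
  qed
  have K: "k / \<theta> \<le> 74 * u ^ 10"
  proof -
    have "k / \<theta> \<le> 74 * real (p - 1) powr 0.2"
      unfolding k_def \<theta>_def by (rule power_over_theta_le[OF finQ QP]) (use p2 in auto)
    also have "real (p - 1) powr 0.2 \<le> real p powr 0.2" by (intro powr_mono2) auto
    also have "real p powr 0.2 = u ^ 10" by (simp add: upow)
    finally show ?thesis by simp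
  qed
  \<comment> \<open>The cut between sifted and trivial counting. Up to \<open>Y\<close> there are at
    most \<open>1 / \<theta>\<close> errors of size \<open>\<theta> * \<eta>\<close>, in total at
    most \<open>\<eta>\<close>; beyond it the reciprocal squares sum to at most
    \<open>1 / (4 * (Y + 1))\<close>, hence to at most \<open>\<theta> / 4\<close>.\<close>
  define Y where "Y = nat \<lfloor>1 / \<theta>\<rfloor>"
  define T where "T = nat \<lfloor>sqrt M\<rfloor>"
  define \<epsilon> where "\<epsilon> = u ^ 25 / M"
  have \<epsilon>0: "\<epsilon> \<ge> 0" using u0 by (simp add: \<epsilon>_def)
  have Y_le: "real Y \<le> 1 / \<theta>" unfolding Y_def using \<theta>0 by (intro of_nat_floor) simp
  have Y_ge: "real Y + 1 \<ge> 1 / \<theta>" unfolding Y_def using \<theta>0 by linarith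
  have T_le: "real T \<le> sqrt M" unfolding T_def by (intro of_nat_floor) simp
  define g where "g d = card {t \<in> grid M (d\<^sup>2). \<forall>q\<in>Q. \<not> q dvd dlog p (grid_val t)}" for d :: nat
  have sif: "\<bar>real (g d) - \<theta> * card (grid M (d\<^sup>2))\<bar> \<le> \<theta> * (k - 1) * (u ^ 25 * M)" if "odd d" for d
  proof -
    have od: "odd (d\<^sup>2)" using that by simp
    interpret char_sum_family p "grid M (d\<^sup>2)" grid_val "sqrt p * M"
      by (rule grid_family[OF p p2 M od])
    show ?thesis using card_sifted[OF finQ QP] unfolding g_def sifted_def \<theta>_def k_def sqrtp .
  qed
  have low: "real (g 1) \<ge> (real M)\<^sup>2 * (\<theta> * (1 - k * \<epsilon>))"
  proof -
    have card1: "real (card (grid M (1\<^sup>2))) = (real M)\<^sup>2"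
      unfolding power_one grid_1 by (simp add: power2_eq_square)
    have "real (g 1) \<ge> \<theta> * (real M)\<^sup>2 - \<theta> * (k - 1) * (u ^ 25 * M)"
      using sif[OF odd_one] unfolding card1 by linarith
    moreover have "\<theta> * (k - 1) * (u ^ 25 * M) \<le> \<theta> * k * (u ^ 25 * M)"
      using \<theta>0 u0 by (intro mult_right_mono mult_left_mono) auto
    moreover have "u ^ 25 * M = (real M)\<^sup>2 * \<epsilon>" using Mpos by (simp add: \<epsilon>_def power2_eq_square)
    ultimately show ?thesis by (simp add: algebra_simps)
  qed
  have up: "real (g d) \<le> (real M)\<^sup>2 * (\<theta> * (1 / (real d)\<^sup>2 + 1 / M + k * \<epsilon>))" if "odd d" for d
  proof -
    have "real (card (grid M (d\<^sup>2))) \<le> real M * (real M / real (d\<^sup>2) + 1)"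
      by (rule card_grid) (use that in simp)
    also have "\<dots> = (real M)\<^sup>2 * (1 / (real d)\<^sup>2 + 1 / M)"
      using Mpos by (simp add: power2_eq_square field_simps)
    finally have "\<theta> * card (grid M (d\<^sup>2)) \<le> \<theta> * ((real M)\<^sup>2 * (1 / (real d)\<^sup>2 + 1 / M))"
      using \<theta>0 by (intro mult_left_mono) auto
    moreover have "\<theta> * (k - 1) * (u ^ 25 * M) \<le> \<theta> * k * (u ^ 25 * M)"
      using \<theta>0 u0 by (intro mult_right_mono mult_left_mono) auto
    moreover have eq: "u ^ 25 * M = (real M)\<^sup>2 * \<epsilon>" using Mpos by (simp add: \<epsilon>_def power2_eq_square)
    ultimately have "real (g d) \<le> \<theta> * ((real M)\<^sup>2 * (1 / (real d)\<^sup>2 + 1 / M)) + \<theta> * k * ((real M)\<^sup>2 * \<epsilon>)"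
      using sif[OF that] unfolding eq abs_le_iff by argo
    thus ?thesis by (simp only: distrib_left mult_ac)
  qed
  have triv: "real (g d) \<le> (real M)\<^sup>2 * (1 / (real d)\<^sup>2 + 1 / M)" if "odd d" for d
  proof -
    have "real (g d) \<le> real (card (grid M (d\<^sup>2)))"
      unfolding of_nat_le_iff g_def by (intro card_mono) auto
    also have "\<dots> \<le> real M * (real M / real (d\<^sup>2) + 1)"
      by (rule card_grid) (use that in simp)
    also have "\<dots> = (real M)\<^sup>2 * (1 / (real d)\<^sup>2 + 1 / M)"
      using Mpos by (simp add: power2_eq_square field_simps)
    finally show ?thesis .
  qed
  define S where "S = (\<lambda>t. 2 * t + 1) ` ({0<..Y} \<union> {Y<..T})"
  have finS: "finite S" by (simp add: S_def)
  have cover: "d \<in> S" if d: "prime d" "odd d" "d\<^sup>2 \<le> 4 * M" for d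
  proof -
    obtain t where t: "d = 2 * t + 1" using d(2) by (elim oddE)
    have "t > 0" using d(1) t by (cases t) auto
    have "(real d)\<^sup>2 \<le> (2 * sqrt M)\<^sup>2"
    proof -
      have "real (d\<^sup>2) \<le> real (4 * M)" using d(3) by (simp only: of_nat_le_iff)
      thus ?thesis by (simp add: power_mult_distrib)
    qed
    hence "real d \<le> 2 * sqrt M" by (rule power2_le_imp_le) simp
    hence "real t \<le> sqrt M" using t by simp
    hence "t \<le> T" unfolding T_def by (simp add: le_nat_floor)
    hence "t \<in> {0<..Y} \<union> {Y<..T}" using \<open>t > 0\<close> by auto
    thus ?thesis using t by (auto simp: S_def)
  qed
  define \<eta> where "\<eta> = 1 / M + k * \<epsilon>"
  have "real (sum g S) = (\<Sum>t\<in>{0<..Y} \<union> {Y<..T}. real (g (2 * t + 1)))"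
    unfolding S_def by (subst sum.reindex) (auto simp: inj_on_def)
  also have "\<dots> = (\<Sum>t\<in>{0<..Y}. real (g (2 * t + 1))) + (\<Sum>t\<in>{Y<..T}. real (g (2 * t + 1)))"
    by (rule sum.union_disjoint) auto
  also have "\<dots> \<le> (\<Sum>t\<in>{0<..Y}. (real M)\<^sup>2 * (\<theta> * (1 / (2 * real t + 1)\<^sup>2 + \<eta>)))
     + (\<Sum>t\<in>{Y<..T}. (real M)\<^sup>2 * (1 / (2 * real t + 1)\<^sup>2 + 1 / M))"
  proof (rule add_mono[OF sum_mono sum_mono])
    fix t :: nat
    have odd: "odd (2 * t + 1)" by simp
    have eq: "real (2 * t + 1) = 2 * real t + 1" by simp
    show "real (g (2 * t + 1)) \<le> (real M)\<^sup>2 * (\<theta> * (1 / (2 * real t + 1)\<^sup>2 + \<eta>))"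
      using up[OF odd] unfolding eq add.assoc \<eta>_def .
    show "real (g (2 * t + 1)) \<le> (real M)\<^sup>2 * (1 / (2 * real t + 1)\<^sup>2 + 1 / M)"
      using triv[OF odd] unfolding eq .
  qed
  also have "\<dots> = (real M)\<^sup>2 * (\<theta> * ((\<Sum>t\<in>{0<..Y}. 1 / (2 * real t + 1)\<^sup>2) + Y * \<eta>))
     + (real M)\<^sup>2 * ((\<Sum>t\<in>{Y<..T}. 1 / (2 * real t + 1)\<^sup>2) + real (T - Y) * (1 / M))"
    by (simp only: sum_distrib_left[symmetric] sum.distrib sum_constant card_greaterThanAtMost diff_zero)
  also have "\<dots> \<le> (real M)\<^sup>2 * (\<theta> * (1 / 4 + 1 / \<theta> * \<eta>))
     + (real M)\<^sup>2 * (\<theta> / 4 + sqrt M * (1 / M))"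
  proof (rule add_mono[OF mult_left_mono[OF mult_left_mono[OF add_mono]] mult_left_mono[OF add_mono]])
    show "(\<Sum>t\<in>{0<..Y}. 1 / (2 * real t + 1)\<^sup>2) \<le> 1 / 4"
      using sum_inverse_odd_squares[of 0 Y] by simp
    show "real Y * \<eta> \<le> 1 / \<theta> * \<eta>"
      using Y_le \<epsilon>0 k2 unfolding \<eta>_def
      by (intro mult_right_mono add_nonneg_nonneg mult_nonneg_nonneg) auto
    have "1 / (4 * (real Y + 1)) \<le> \<theta> / 4"
    proof -
      have "1 \<le> \<theta> * (real Y + 1)" using Y_ge \<theta>0 by (simp add: field_simps)
      thus ?thesis by (simp add: field_simps)
    qed
    thus "(\<Sum>t\<in>{Y<..T}. 1 / (2 * real t + 1)\<^sup>2) \<le> \<theta> / 4"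
      using sum_inverse_odd_squares[of Y T] by linarith
    have "real (T - Y) \<le> sqrt M" using T_le by linarith
    thus "real (T - Y) * (1 / M) \<le> sqrt M * (1 / M)" by (intro mult_right_mono) auto
  qed (use \<theta>0 in auto)
  also have "\<dots> < (real M)\<^sup>2 * (\<theta> * (1 - k * \<epsilon>))"
  proof -
    define s where "s = 1 / sqrt M"
    have sM: "sqrt M * (1 / M) = s" using Mpos by (simp add: s_def real_div_sqrt field_simps)
    have a: "k / \<theta> * \<epsilon> \<le> 370 / u ^ 13"
    proof -
      have "\<epsilon> \<le> u ^ 25 / (u ^ 48 / 5)"
        unfolding \<epsilon>_def using M_ge Mpos u0 by (intro divide_left_mono mult_pos_pos) auto
      also have "\<dots> = 5 / u ^ 23" using u0 by (simp add: field_simps flip: power_add)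
      finally have "k / \<theta> * \<epsilon> \<le> 74 * u ^ 10 * (5 / u ^ 23)"
        using K \<epsilon>0 k2 \<theta>0 u0 by (intro mult_mono) auto
      also have "\<dots> = 370 / u ^ 13" using u0 by (simp add: field_simps flip: power_add)
      finally show ?thesis .
    qed
    have b: "1 / \<theta> \<le> 37 * u ^ 10"
    proof -
      have "2 / \<theta> \<le> k / \<theta>" using k2 \<theta>0 by (intro divide_right_mono) auto
      thus ?thesis using K by simp
    qed
    have c: "s \<le> 3 / u ^ 24"
    proof -
      have "u ^ 24 / 3 \<le> sqrt M"
      proof (rule real_le_rsqrt)
        have "(u ^ 24 / 3)\<^sup>2 = u ^ 48 / 9" by (simp add: power_divide power_mult[symmetric])
        thus "(u ^ 24 / 3)\<^sup>2 \<le> M" using M_ge u48 by linarith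
      qed
      hence "s \<le> 1 / (u ^ 24 / 3)"
        unfolding s_def using u0 Mpos by (intro divide_left_mono mult_pos_pos) auto
      thus ?thesis by simp
    qed
    have d: "1 / real M \<le> s"
    proof -
      have "sqrt M \<le> M" using Mpos by (intro real_le_lsqrt) (auto simp: power2_eq_square)
      thus ?thesis unfolding s_def using Mpos by (intro divide_left_mono mult_pos_pos) auto
    qed
    have e: "1 / \<theta> * s \<le> 111 / u ^ 14"
    proof -
      have "1 / \<theta> * s \<le> 37 * u ^ 10 * (3 / u ^ 24)"
        using b c \<theta>0 u0 by (intro mult_mono) (auto simp: s_def)
      also have "\<dots> = 111 / u ^ 14" using u0 by (simp add: field_simps flip: power_add)
      finally show ?thesis .
    qed
    have u13: "370 / u ^ 13 \<le> 21 / 100"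
    proof -
      have "(178 / 100) ^ 13 \<le> u ^ 13" using u by (intro power_mono) auto
      hence "370 / u ^ 13 \<le> 370 / (178 / 100) ^ 13" using u0 by (intro divide_left_mono mult_pos_pos) auto
      also have "\<dots> \<le> 21 / 100" by (simp add: power_divide)
      finally show ?thesis .
    qed
    have u14: "111 / u ^ 14 \<le> 36 / 1000"
    proof -
      have "(178 / 100) ^ 14 \<le> u ^ 14" using u by (intro power_mono) auto
      hence "111 / u ^ 14 \<le> 111 / (178 / 100) ^ 14" using u0 by (intro divide_left_mono mult_pos_pos) auto
      also have "\<dots> \<le> 36 / 1000" by (simp add: power_divide)
      finally show ?thesis .
    qed
    have ke: "k * \<epsilon> \<le> k / \<theta> * \<epsilon>"
      using \<theta>0 \<theta>1 k2 \<epsilon>0 by (intro mult_right_mono) (auto simp: field_simps)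
    \<comment> \<open>The left-hand side is at most 0.5 + 0.21 + 2 * 0.036 = 0.782, and the
      right-hand side is at least 1 - 0.21 = 0.79. This narrow margin is what the size of
      \<open>p\<close> has to provide.\<close>
    have "1 / 4 + 1 / \<theta> * \<eta> + (1 / 4 + 1 / \<theta> * s) < 1 - k * \<epsilon>"
    proof -
      have "1 / \<theta> * (1 / M) \<le> 1 / \<theta> * s" using d \<theta>0 by (intro mult_left_mono) auto
      moreover have "1 / \<theta> * \<eta> = 1 / \<theta> * (1 / M) + k / \<theta> * \<epsilon>"
        by (simp add: distrib_left \<eta>_def)
      ultimately show ?thesis using a e u13 u14 ke by linarith
    qed
    hence "(real M)\<^sup>2 * \<theta> * (1 / 4 + 1 / \<theta> * \<eta> + (1 / 4 + 1 / \<theta> * s))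
        < (real M)\<^sup>2 * \<theta> * (1 - k * \<epsilon>)"
      using Mpos \<theta>0 by (intro mult_strict_left_mono) auto
    hence "(real M)\<^sup>2 * (\<theta> * (1 / 4 + 1 / \<theta> * \<eta>)) + (real M)\<^sup>2 * (\<theta> * (1 / 4 + 1 / \<theta> * s))
        < (real M)\<^sup>2 * (\<theta> * (1 - k * \<epsilon>))"
      by (simp only: distrib_left mult.assoc)
    moreover have "\<theta> * (1 / 4 + 1 / \<theta> * s) = \<theta> / 4 + s" using \<theta>0 by (simp add: distrib_left)
    ultimately show ?thesis unfolding sM by (simp only:)
  qed
  also have "\<dots> \<le> g 1" by (rule low)
  finally have "sum g S < g 1" by (simp only: of_nat_less_iff)
  thus ?thesis
    using small_primroot_count[OF p M finS cover] unfolding g_def Q_def power_one by blast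
qed

section \<open>Arithmetic on binary numerals\<close>

text \<open>The checks are evaluated by rewriting, so arithmetic works directly on the binary
  constructors. Of a negative difference only the sign is kept, which suffices for comparison and
  reduction.\<close>

datatype dnum = Neg | Zer | Pnum num

fun dbl :: "dnum \<Rightarrow> dnum" where
  "dbl Neg = Neg" | "dbl Zer = Zer" | "dbl (Pnum n) = Pnum (num.Bit0 n)"

fun dbl1 :: "dnum \<Rightarrow> dnum" where
  "dbl1 Neg = Neg" | "dbl1 Zer = Pnum num.One" | "dbl1 (Pnum n) = Pnum (num.Bit1 n)"

fun num_dec :: "num \<Rightarrow> dnum" where
  "num_dec num.One = Zer" | "num_dec (num.Bit0 m) = Pnum (Num.BitM m)" | "num_dec (num.Bit1 m) = Pnum (num.Bit0 m)"

text \<open>\<open>num_diff k l\<close> is \<open>k - l\<close> and \<open>num_diff1 k l\<close> is \<open>k - l - 1\<close>, with all negative values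
  collapsed to \<open>Neg\<close>.\<close>
fun num_diff :: "num \<Rightarrow> num \<Rightarrow> dnum" and num_diff1 :: "num \<Rightarrow> num \<Rightarrow> dnum" where
  "num_diff num.One num.One = Zer"
| "num_diff num.One (num.Bit0 n) = Neg"
| "num_diff num.One (num.Bit1 n) = Neg"
| "num_diff (num.Bit0 m) num.One = Pnum (Num.BitM m)"
| "num_diff (num.Bit1 m) num.One = Pnum (num.Bit0 m)"
| "num_diff (num.Bit0 m) (num.Bit0 n) = dbl (num_diff m n)"
| "num_diff (num.Bit1 m) (num.Bit1 n) = dbl (num_diff m n)"
| "num_diff (num.Bit1 m) (num.Bit0 n) = dbl1 (num_diff m n)"
| "num_diff (num.Bit0 m) (num.Bit1 n) = dbl1 (num_diff1 m n)"
| "num_diff1 num.One n = Neg"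
| "num_diff1 (num.Bit0 m) num.One = dbl (num_dec m)"
| "num_diff1 (num.Bit1 m) num.One = Pnum (Num.BitM m)"
| "num_diff1 (num.Bit0 m) (num.Bit0 n) = dbl1 (num_diff1 m n)"
| "num_diff1 (num.Bit1 m) (num.Bit1 n) = dbl1 (num_diff1 m n)"
| "num_diff1 (num.Bit1 m) (num.Bit0 n) = dbl (num_diff m n)"
| "num_diff1 (num.Bit0 m) (num.Bit1 n) = dbl (num_diff1 m n)"

definition num_val :: "num \<Rightarrow> int" where "num_val n = int (nat_of_num n)"

lemma num_val_simps:
  "num_val num.One = 1" "num_val (num.Bit0 n) = 2 * num_val n" "num_val (num.Bit1 n) = 2 * num_val n + 1"
  "num_val (m * n) = num_val m * num_val n"
  by (simp_all add: num_val_def nat_of_num_mult)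

lemma num_val_BitM: "num_val (Num.BitM n) = 2 * num_val n - 1"
  by (induction n) (simp_all add: num_val_simps)

lemma num_val_ge_1: "num_val n \<ge> 1"
  using nat_of_num_pos[of n] by (simp add: num_val_def del: nat_of_num_pos)

fun represents :: "dnum \<Rightarrow> int \<Rightarrow> bool" where
  "represents Neg z \<longleftrightarrow> z < 0"
| "represents Zer z \<longleftrightarrow> z = 0"
| "represents (Pnum n) z \<longleftrightarrow> z = num_val n"

lemma represents_dbl: "represents d z \<Longrightarrow> represents (dbl d) (2 * z)"
  by (cases d) (auto simp: num_val_simps)

lemma represents_dbl1: "represents d z \<Longrightarrow> represents (dbl1 d) (2 * z + 1)"
  by (cases d) (auto simp: num_val_simps)

lemma represents_num_dec: "represents (num_dec n) (num_val n - 1)"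
  by (cases n) (auto simp: num_val_simps num_val_BitM)

lemma represents_num_diff:
  "represents (num_diff k l) (num_val k - num_val l)"
  "represents (num_diff1 k l) (num_val k - num_val l - 1)"
proof (induction k l and k l rule: num_diff_num_diff1.induct)
  case (2 n) show ?case using num_val_ge_1[of n] by (simp add: num_val_simps)
next
  case (3 n) show ?case using num_val_ge_1[of n] by (simp add: num_val_simps)
next
  case (6 m n) from represents_dbl[OF this] show ?case by (simp add: num_val_simps)
next
  case (7 m n) from represents_dbl[OF this] show ?case by (simp add: num_val_simps)
next
  case (8 m n) from represents_dbl1[OF this] show ?case by (simp add: num_val_simps algebra_simps)
next
  case (9 m n) from represents_dbl1[OF this] show ?case by (simp add: num_val_simps algebra_simps)
next
  case (10 n) show ?case using num_val_ge_1[of n] by (simp add: num_val_simps)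
next
  case (11 m) from represents_dbl[OF represents_num_dec[of m]] show ?case by (simp add: num_val_simps)
next
  case (13 m n) from represents_dbl1[OF this] show ?case by (simp add: num_val_simps algebra_simps)
next
  case (14 m n) from represents_dbl1[OF this] show ?case by (simp add: num_val_simps algebra_simps)
next
  case (15 m n) from represents_dbl[OF this] show ?case by (simp add: num_val_simps)
next
  case (16 m n) from represents_dbl[OF this] show ?case by (simp add: num_val_simps algebra_simps)
qed (simp_all add: num_val_simps num_val_BitM)

fun pick_diff :: "dnum \<Rightarrow> num \<Rightarrow> dnum" where
  "pick_diff Neg r = Pnum r" | "pick_diff Zer r = Zer" | "pick_diff (Pnum x) r = Pnum x"

fun reduce :: "dnum \<Rightarrow> num \<Rightarrow> dnum" where
  "reduce Neg p = Neg" | "reduce Zer p = Zer" | "reduce (Pnum r) p = pick_diff (num_diff r p) r"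

text \<open>Horner evaluation from the leading bit: doubling a residue and adding a bit stays below
  twice the modulus, so one conditional subtraction reduces it.\<close>

fun num_mod :: "num \<Rightarrow> num \<Rightarrow> dnum" where
  "num_mod num.One p = reduce (Pnum num.One) p"
| "num_mod (num.Bit0 m) p = reduce (dbl (num_mod m p)) p"
| "num_mod (num.Bit1 m) p = reduce (dbl1 (num_mod m p)) p"

lemma represents_reduce:
  assumes "represents d z" "0 \<le> z" "z < 2 * num_val p"
  shows "represents (reduce d p) (z mod num_val p)"
proof (cases d)
  case (Pnum r)
  hence z: "z = num_val r" using assms by simp
  have rep: "represents (num_diff r p) (z - num_val p)" using represents_num_diff(1)[of r p] z by simp
  show ?thesis
  proof (cases "z < num_val p")
    case True
    hence "z - num_val p \<noteq> num_val x" for x using num_val_ge_1[of x] by linarith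
    hence "num_diff r p = Neg" using rep True by (cases "num_diff r p") auto
    thus ?thesis using True assms Pnum z by simp
  next
    case False
    hence "z mod num_val p = (z - num_val p) mod num_val p" by simp
    also have "\<dots> = z - num_val p" using False assms by (intro mod_pos_pos_trivial) auto
    finally have "z mod num_val p = z - num_val p" .
    thus ?thesis using Pnum rep False by (cases "num_diff r p") auto
  qed
qed (use assms in auto)

lemma represents_num_mod: "represents (num_mod m p) (num_val m mod num_val p)"
proof (induction m)
  case One
  have "(1::int) < 2 * num_val p" using num_val_ge_1[of p] by linarith
  thus ?case using represents_reduce[of "Pnum num.One" 1 p] by (simp add: num_val_simps)
next
  case (Bit0 m)
  define r where "r = (num_val m :: int) mod num_val p"
  have "0 \<le> r" "r < num_val p" using num_val_ge_1[of p] by (simp_all add: r_def)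
  hence "represents (reduce (dbl (num_mod m p)) p) (2 * r mod num_val p)"
    using represents_dbl[OF Bit0] by (intro represents_reduce) (auto simp: r_def)
  also have "2 * r mod num_val p = 2 * num_val m mod num_val p" by (simp add: r_def mod_mult_right_eq)
  finally show ?case by (simp only: num_val_simps num_mod.simps)
next
  case (Bit1 m)
  define r where "r = (num_val m :: int) mod num_val p"
  have "0 \<le> r" "r < num_val p" using num_val_ge_1[of p] by (simp_all add: r_def)
  hence "represents (reduce (dbl1 (num_mod m p)) p) ((2 * r + 1) mod num_val p)"
    using represents_dbl1[OF Bit1] by (intro represents_reduce) (auto simp: r_def)
  also have "(2 * r + 1) mod num_val p = (2 * num_val m + 1) mod num_val p"
    unfolding r_def by (metis mod_add_left_eq mod_mult_right_eq)
  finally show ?case by (simp only: num_val_simps num_mod.simps)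
qed

section \<open>Modular powers and the test for primitive roots\<close>

fun mod_mult :: "num \<Rightarrow> dnum \<Rightarrow> dnum \<Rightarrow> dnum" where
  "mod_mult p (Pnum x) (Pnum y) = num_mod (x * y) p"
| "mod_mult p _ _ = Zer"

fun mod_power :: "num \<Rightarrow> dnum \<Rightarrow> num \<Rightarrow> dnum" where
  "mod_power p y num.One = y"
| "mod_power p y (num.Bit0 e) = (let z = mod_power p y e in mod_mult p z z)"
| "mod_power p y (num.Bit1 e) = (let z = mod_power p y e in mod_mult p (mod_mult p z z) y)"

fun mod_power_list :: "num \<Rightarrow> dnum \<Rightarrow> num list \<Rightarrow> dnum" where
  "mod_power_list p y [] = y"
| "mod_power_list p y (e # es) = mod_power_list p (mod_power p y e) es"

fun is_one :: "dnum \<Rightarrow> bool" where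
  "is_one (Pnum num.One) = True"
| "is_one _ = False"

text \<open>\<open>y\<close> is successively raised to the entries of the list, so that every proper complementary
  product is met exactly once.\<close>
fun order_test :: "num \<Rightarrow> num list \<Rightarrow> dnum \<Rightarrow> bool" where
  "order_test p [] y = True"
| "order_test p (q # qs) y =
    (if is_one (mod_power_list p y qs) then False else order_test p qs (mod_power p y q))"

lemma represents_mod_mult:
  assumes "represents x (a mod num_val p)" "represents y (b mod num_val p)"
  shows "represents (mod_mult p x y) (a * b mod num_val p)"
proof (cases "\<exists>k l. x = Pnum k \<and> y = Pnum l")
  case True
  then obtain k l where kl: "x = Pnum k" "y = Pnum l" by blast
  have "represents (num_mod (k * l) p) (num_val (k * l) mod num_val p)" by (rule represents_num_mod)
  also have "num_val (k * l) = (a mod num_val p) * (b mod num_val p)"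
    using assms kl by (simp add: num_val_simps)
  finally show ?thesis using kl by (simp add: mod_mult_eq)
next
  case False
  have nn: "0 \<le> a mod num_val p" "0 \<le> b mod num_val p" using num_val_ge_1[of p] by simp_all
  hence "a mod num_val p = 0 \<or> b mod num_val p = 0"
    using assms False by (cases x; cases y) auto
  hence "a * b mod num_val p = 0" by (metis mod_mult_eq mod_0 mult_zero_left mult_zero_right)
  moreover have "mod_mult p x y = Zer" using False by (cases x; cases y) auto
  ultimately show ?thesis by simp
qed

lemma represents_mod_power:
  "represents y (a mod num_val p) \<Longrightarrow> represents (mod_power p y e) (a ^ nat_of_num e mod num_val p)"
proof (induction e)
  case (Bit0 e)
  thus ?case using represents_mod_mult[OF Bit0.IH Bit0.IH] by (simp add: Let_def power_add)
next
  case (Bit1 e)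
  from represents_mod_mult[OF represents_mod_mult[OF Bit1.IH Bit1.IH] Bit1.prems] Bit1.prems
  show ?case by (simp add: Let_def power_add mult_ac)
qed simp

definition num_prod :: "num list \<Rightarrow> nat" where "num_prod es = prod_list (map nat_of_num es)"

lemma num_prod_simps [simp]:
  "num_prod [] = 1" "num_prod (e # es) = nat_of_num e * num_prod es"
  "num_prod (xs @ ys) = num_prod xs * num_prod ys"
  by (simp_all add: num_prod_def)

lemma represents_mod_power_list:
  "represents y (a mod num_val p) \<Longrightarrow> represents (mod_power_list p y es) (a ^ num_prod es mod num_val p)"
  by (induction es arbitrary: y a) (auto dest: represents_mod_power simp: power_mult)

lemma is_one_iff: "represents y 1 \<longleftrightarrow> is_one y"
proof (cases y)
  case (Pnum n)
  show ?thesis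
  proof (cases n)
    case (Bit0 m)
    thus ?thesis using Pnum num_val_ge_1[of m] by (simp add: num_val_simps)
  next
    case (Bit1 m)
    thus ?thesis using Pnum num_val_ge_1[of m] by (simp add: num_val_simps)
  qed (simp add: Pnum num_val_simps)
qed simp_all

text \<open>Once the entries \<open>xs\<close> have been passed, the current residue is
  \<open>a\<close> raised to their product; the test at \<open>q\<close> raises it further to the
  product of \<open>ys\<close>, so exactly the entry \<open>q\<close> is left out of the
  exponent.\<close>

lemma order_test_sound:
  assumes "order_test p qs y" "represents y (a mod num_val p)" "qs = xs @ q # ys"
  shows "a ^ (num_prod xs * num_prod ys) mod num_val p \<noteq> (1 :: int)"
  using assms
proof (induction qs arbitrary: y a xs)
  case (Cons q' qs)
  have ne: "\<not> is_one (mod_power_list p y qs)" and ot: "order_test p qs (mod_power p y q')"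
    using Cons.prems(1) by (auto split: if_splits)
  show ?case
  proof (cases xs)
    case Nil
    thus ?thesis using Cons.prems represents_mod_power_list[OF Cons.prems(2), of qs] ne is_one_iff by force
  next
    case (Cons x xs')
    thus ?thesis
      using Cons.IH[OF ot represents_mod_power[OF Cons.prems(2)], of xs'] Cons.prems(3)
      by (simp add: power_mult mult.assoc)
  qed
qed simp

section \<open>Certificates for the numbers composed of a given set of primes\<close>

definition num_of_int :: "int \<Rightarrow> num" where "num_of_int k = num_of_nat (nat k)"

lemma num_of_int_code [code]:
  "num_of_int 0 = num.One" "num_of_int (Int.Pos n) = n" "num_of_int (Int.Neg n) = num.One"
  by (simp_all add: num_of_int_def nat_of_num_numeral[symmetric] nat_of_num_inverse del: nat_of_num_numeral)

lemma nat_of_num_of_int: "0 < k \<Longrightarrow> nat_of_num (num_of_int k) = nat k"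
  by (simp add: num_of_int_def num_of_nat_inverse)

text \<open>A fixed list of primes, so that membership settles the primality of a positive
  hint.\<close>

definition root_primes :: "int list" where
  "root_primes = [2, 3, 5, 7, 11, 13, 17, 19, 23, 29, 31, 37, 41, 43, 47, 53, 59, 61, 67, 71, 73, 79, 83, 89, 97,
    101, 103, 107, 109]"

lemma root_primes_prime: "k \<in> set root_primes \<Longrightarrow> k > 0 \<and> prime (nat k)"
  unfolding root_primes_def by (auto simp: prime_nat_numeral_eq)

text \<open>A negative hint \<open>-d\<close> certifies that \<open>n + 1\<close> has the divisor \<open>d\<close>, a positive hint is a prime
  primitive root modulo \<open>n + 1\<close>.\<close>
fun hint_test :: "num list \<Rightarrow> num \<Rightarrow> num list \<Rightarrow> int list \<Rightarrow> int list option" where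
  "hint_test L n es [] = None"
| "hint_test L n es (k # hs) =
    (if k < 0 then
       (let d = num_of_int (- k) in
        if num.One < d \<and> d \<le> n \<and> num_mod (n + num.One) d = Zer then Some hs else None)
     else
       (let g = num_of_int k; p = n + num.One in
        if k \<in> set root_primes \<and> (if g * g \<le> n then True else g * g * g * g < p * p * p) then
          (if order_test p L (mod_power_list p (Pnum g) es) then Some hs else None)
        else None))"

text \<open>Runs through the multiples of \<open>n\<close> below \<open>B\<close> whose additional
  factors come from \<open>ls\<close>, with \<open>es\<close> recording these factors; every number
  from \<open>A\<close> on that is reached consumes one hint. The branch without a further factor
  \<open>l\<close> comes first, then one more factor \<open>l\<close> is taken. The comparison with
  \<open>num.Bit0 n\<close> stops as soon as no proper multiple fits. The first list is only fuel,
  and running out of it counts as failure.\<close>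

fun smooth_search :: "'x list \<Rightarrow> num \<Rightarrow> num \<Rightarrow> num list \<Rightarrow> num list \<Rightarrow> num \<Rightarrow> num list \<Rightarrow> int list \<Rightarrow> int list option" where
  "smooth_search [] A B L ls n es hs = None"
| "smooth_search (f # fs) A B L [] n es hs = (if n < A then Some hs else hint_test L n es hs)"
| "smooth_search (f # fs) A B L (l # ls) n es hs =
     (if B \<le> num.Bit0 n then (if n < A then Some hs else hint_test L n es hs)
      else (case smooth_search fs A B L ls n es hs of None \<Rightarrow> None | Some hs' \<Rightarrow>
       (let n' = n * l in
        if B \<le> n' then Some hs' else smooth_search fs A B L (l # ls) n' (l # es) hs')))"

text \<open>\<open>L\<close> carries each prime of \<open>n\<close> once and \<open>es\<close> the
  remaining multiplicities. Raising \<open>g\<close> to the product of \<open>es\<close> beforehand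
  turns the complementary products in \<open>L\<close> into the exponents
  \<open>(p - 1) div q\<close>.\<close>

lemma order_test_primroot:
  assumes p: "prime p" and pn: "p = nat_of_num n + 1" and g: "prime (nat_of_num g)" "nat_of_num g < p"
    and n: "nat_of_num n = num_prod L * num_prod es"
    and L: "\<And>q. prime q \<Longrightarrow> q dvd nat_of_num n \<Longrightarrow> q \<in> nat_of_num ` set L"
    and test: "order_test (n + num.One) L (mod_power_list (n + num.One) (Pnum g) es)"
  shows "residue_primroot p (nat_of_num g)"
proof (rule residue_primrootI[OF p])
  have g0: "nat_of_num g > 0" by (rule nat_of_num_pos)
  show "\<not> p dvd nat_of_num g" using g g0 by (auto dest: dvd_imp_le)
  fix q assume q: "prime q" "q dvd p - 1"
  obtain q' where q': "q' \<in> set L" "q = nat_of_num q'" using L[of q] q pn by auto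
  then obtain xs ys where L_eq: "L = xs @ q' # ys" by (meson split_list)
  have pv: "num_val (n + num.One) = int p" by (simp add: num_val_def nat_of_num_add pn)
  have "represents (Pnum g) (int (nat_of_num g) mod num_val (n + num.One))"
    using g(2) unfolding represents.simps pv by (simp add: num_val_def)
  from represents_mod_power_list[OF this, of es]
  have rep: "represents (mod_power_list (n + num.One) (Pnum g) es)
      (int (nat_of_num g) ^ num_prod es mod num_val (n + num.One))" .
  have "(p - 1) div q = num_prod es * (num_prod xs * num_prod ys)"
  proof -
    have "p - 1 = q * (num_prod es * (num_prod xs * num_prod ys))"
      using n pn by (simp add: L_eq q' mult_ac)
    thus ?thesis using q(1) prime_gt_0_nat by simp
  qed
  moreover have "int (nat_of_num g ^ (num_prod es * (num_prod xs * num_prod ys)) mod p) \<noteq> 1"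
    using order_test_sound[OF test rep L_eq] by (simp add: pv power_mult zmod_int)
  moreover have "p > 1" using p prime_gt_1_nat by auto
  ultimately show "\<not> [nat_of_num g ^ ((p - 1) div q) = 1] (mod p)"
    by (auto simp: Cong.cong_def)
qed

text \<open>The exponent 3/4 is below 0.96 and gives a condition on integers, which can be evaluated
  without real powers.\<close>

lemma small_primrootI_prime:
  assumes "prime g" "residue_primroot p g" "g ^ 4 < p ^ 3"
  shows "small_primroot p"
proof -
  have p0: "p > 0" using assms(3) by (cases p) auto
  have g0: "g > 0" using assms(1) prime_gt_0_nat by auto
  have "real g ^ 4 < real p ^ 3" using assms(3) by (metis of_nat_less_iff of_nat_power)
  also have "\<dots> = (real p powr 0.75) ^ 4"
  proof -
    have "(real p powr 0.75) ^ 4 = (real p powr 0.75) powr real 4"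
      using p0 by (subst powr_realpow) auto
    also have "\<dots> = real p powr real 3" by (simp add: powr_powr)
    also have "\<dots> = real p ^ 3" using p0 by (subst powr_realpow) auto
    finally show ?thesis by simp
  qed
  finally have "real g < real p powr 0.75" by (rule power_less_imp_less_base) simp
  also have "\<dots> \<le> real p powr 0.96" using p0 by (intro powr_mono) auto
  finally show ?thesis
    using assms g0 squarefree_prime[of g] by (auto simp: small_primroot_def)
qed

text \<open>The hints need no trust: an accepted divisor contradicts the primality of
  \<open>p\<close>, and an accepted root is verified to be prime, small enough and of full
  order.\<close>

lemma hint_test_sound:
  assumes p: "prime p" and pn: "p = nat_of_num n + 1"
    and n: "nat_of_num n = num_prod L * num_prod es"
    and L: "\<And>q. prime q \<Longrightarrow> q dvd nat_of_num n \<Longrightarrow> q \<in> nat_of_num ` set L"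
    and test: "hint_test L n es hs = Some hs'"
  shows "small_primroot p"
proof (cases hs)
  case (Cons k ks)
  show ?thesis
  proof (cases "k < 0")
    case True
    define d where "d = num_of_int (- k)"
    have d: "num.One < d" "d \<le> n" "num_mod (n + num.One) d = Zer"
      using test Cons True by (auto simp: d_def Let_def split: if_splits)
    have "num_val (n + num.One) mod num_val d = 0"
      using represents_num_mod[of "n + num.One" d] d(3) by simp
    hence "nat_of_num d dvd p"
      by (simp add: num_val_def nat_of_num_add pn mod_eq_0_iff_dvd) (metis int_dvd_int_iff of_nat_Suc)
    moreover have "nat_of_num d > 1" "nat_of_num d \<le> nat_of_num n"
      using d(1,2) by (simp_all add: less_num_def less_eq_num_def)
    ultimately show ?thesis using p pn by (auto simp: prime_nat_iff)
  next
    case False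
    define g where "g = num_of_int k"
    have k: "k \<in> set root_primes" using test Cons False by (auto simp: Let_def split: if_splits)
    hence gk: "nat_of_num g = nat k" and gp: "prime (nat_of_num g)"
      using root_primes_prime[of k] by (simp_all add: g_def nat_of_num_of_int)
    have size: "g * g \<le> n \<or> g * g * g * g < (n + num.One) * (n + num.One) * (n + num.One)"
      and ot: "order_test (n + num.One) L (mod_power_list (n + num.One) (Pnum g) es)"
      using test Cons False by (auto simp: g_def Let_def split: if_splits)
    define G where "G = nat_of_num g"
    have G4: "G ^ 4 < p ^ 3"
      using size
    proof
      assume "g * g \<le> n"
      hence "G * G < p" by (simp add: less_eq_num_def nat_of_num_mult G_def pn)
      hence "(G * G) * (G * G) < p * p" by (intro mult_strict_mono) auto
      also have "\<dots> \<le> p * p * p" using prime_gt_0_nat[OF p] by (simp add: Suc_le_eq)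
      finally show ?thesis by (simp add: eval_nat_numeral mult_ac)
    next
      assume "g * g * g * g < (n + num.One) * (n + num.One) * (n + num.One)"
      hence "G * G * G * G < p * p * p"
        by (simp add: less_num_def nat_of_num_mult nat_of_num_add G_def pn)
      thus ?thesis by (simp add: eval_nat_numeral mult_ac)
    qed
    have "G < p"
    proof (rule ccontr)
      assume "\<not> G < p"
      hence "p ^ 4 \<le> G ^ 4" by (intro power_mono) auto
      moreover have "p ^ 3 \<le> p ^ 4" using p prime_gt_0_nat[of p] by (intro power_increasing) auto
      ultimately show False using G4 by linarith
    qed
    thus ?thesis
      using small_primrootI_prime[OF gp order_test_primroot[OF p pn gp _ n L ot]] G4
      by (simp add: G_def)
  qed
qed (use test in simp)

text \<open>The invariant is the cofactor \<open>m\<close> with \<open>n0 = n * m\<close>, whose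
  primes all lie in the list still available. If \<open>l\<close> divides \<open>m\<close>, the
  search for \<open>n * l\<close> leads to \<open>n0\<close>, otherwise the search without
  \<open>l\<close> does.\<close>

lemma smooth_search_sound:
  assumes p: "prime p" and n0: "p = n0 + 1" "nat_of_num A \<le> n0" "n0 < nat_of_num B"
    and L: "\<And>q. prime q \<Longrightarrow> q dvd n0 \<Longrightarrow> q \<in> nat_of_num ` set L"
  shows "smooth_search fs A B L ls n es hs = Some hs' \<Longrightarrow> nat_of_num n = num_prod L * num_prod es \<Longrightarrow>
    n0 = nat_of_num n * m \<Longrightarrow> (\<And>q. prime q \<Longrightarrow> q dvd m \<Longrightarrow> q \<in> nat_of_num ` set ls) \<Longrightarrow>
    small_primroot p"
  using n0(2,3) L
proof (induction fs A B L ls n es hs arbitrary: m hs' rule: smooth_search.induct)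
  case (2 f fs A B L n es hs)
  note run = "2.prems"(1) and n = "2.prems"(2) and n0_eq = "2.prems"(3) and m = "2.prems"(4)
    and A = "2.prems"(5) and L = "2.prems"(7)
  have "m = 1"
  proof (rule ccontr)
    assume "m \<noteq> 1"
    then obtain q where "prime q" "q dvd m" using prime_factor_nat by blast
    thus False using m[of q] by simp
  qed
  hence eq: "n0 = nat_of_num n" using n0_eq by simp
  have "\<not> n < A" using A eq by (simp add: less_num_def not_less)
  hence "hint_test L n es hs = Some hs'" using run by simp
  from hint_test_sound[OF p _ n _ this] show ?case using L n0(1) eq by simp
next
  case (3 f fs A B L l ls n es hs)
  note run = "3.prems"(1) and n = "3.prems"(2) and n0_eq = "3.prems"(3) and m = "3.prems"(4)
    and bounds = "3.prems"(5,6) and L = "3.prems"(7)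
  have n0_pos: "n0 > 0" using p prime_gt_1_nat n0(1) by auto
  show ?case
  proof (cases "B \<le> num.Bit0 n")
    case True
    have "m = 1"
    proof (rule ccontr)
      assume "m \<noteq> 1"
      hence "2 \<le> m" using n0_pos n0_eq by (cases m) auto
      hence "nat_of_num n * 2 \<le> n0" unfolding n0_eq by (rule mult_le_mono2)
      thus False using True bounds(2) by (simp add: less_eq_num_def)
    qed
    hence eq: "n0 = nat_of_num n" using n0_eq by simp
    have "\<not> n < A" using bounds(1) eq by (simp add: less_num_def not_less)
    hence "hint_test L n es hs = Some hs'" using run True by simp
    from hint_test_sound[OF p _ n _ this] show ?thesis using L n0(1) eq by simp
  next
    case False
    note nB2 = this
    obtain hs1 where hs1: "smooth_search fs A B L ls n es hs = Some hs1"
      using run False by (auto split: option.splits)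
    show ?thesis
    proof (cases "nat_of_num l dvd m")
      case True
      then obtain m' where m': "m = nat_of_num l * m'" by blast
      have n0_eq': "n0 = nat_of_num (n * l) * m'" using n0_eq m' by (simp add: nat_of_num_mult)
      have "n0 > 0" using p prime_gt_1_nat n0(1) by auto
      hence "m' > 0" using n0_eq' by (cases m') auto
      hence "nat_of_num (n * l) \<le> n0" using n0_eq' by simp
      hence nB: "\<not> B \<le> n * l" using bounds(2) by (simp add: less_eq_num_def)
      hence run': "smooth_search fs A B L (l # ls) (n * l) (l # es) hs1 = Some hs'"
        using run hs1 nB2 by (simp add: Let_def)
      show ?thesis
      proof (rule "3.IH"(2)[OF nB2 hs1 refl nB run' _ n0_eq' _ bounds L])
        show "nat_of_num (n * l) = num_prod L * num_prod (l # es)"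
          using n by (simp add: nat_of_num_mult)
      qed (use m m' in auto)
    next
      case False
      show ?thesis
      proof (rule "3.IH"(1)[OF nB2 hs1 n n0_eq _ bounds L])
        fix q assume q: "prime q" "q dvd m"
        hence "q \<in> nat_of_num ` set (l # ls)" using m by blast
        thus "q \<in> nat_of_num ` set ls" using False q by auto
      qed
    qed
  qed
qed simp

section \<open>Searching the sets of prime factors\<close>

text \<open>\<open>P\<close> is the product of the primes chosen so far and \<open>C\<close> their total cost; every further prime is at
  least \<open>q\<close> and costs at most \<open>c\<close>. The list argument only bounds the number of steps.\<close>
fun crit_holds :: "'x list \<Rightarrow> num \<Rightarrow> num \<Rightarrow> num \<Rightarrow> num \<Rightarrow> num \<Rightarrow> num \<Rightarrow> bool" where
  "crit_holds [] B d c q C P = False"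
| "crit_holds (f # fs) B d c q C P =
     (if d < C then False
      else (let P' = P * q in if B \<le> P' then True else crit_holds fs B d c q (C + c) P'))"

text \<open>A triple \<open>(a, b, d)\<close> is the criterion for a fixed set \<open>E\<close>, scaled by \<open>10 ^ 7\<close>: a prime \<open>r\<close> outside \<open>E\<close>
  costs \<open>a * 10 ^ 5 / r + b\<close>, where the tables provide \<open>u \<ge> 10 ^ 5 / r\<close>, and \<open>d\<close> is the budget. Costs
  start at 2 because a \<^typ>\<open>num\<close> cannot be zero and the criterion is strict.\<close>
type_synonym crit = "num \<times> num \<times> num"

fun cost :: "crit \<Rightarrow> num \<Rightarrow> num" where "cost (a, b, d) u = u * a + b"

fun bound :: "crit \<Rightarrow> num" where "bound (a, b, d) = d"

text \<open>Decides prime by prime whether \<open>q\<close> divides \<open>p - 1\<close>, first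
  assuming that it does. A branch closes when one of the two criteria covers all completions by
  primes not below \<open>q\<close>. If no further prime fits below \<open>B\<close>, the set
  \<open>L\<close> is complete and the numbers with exactly these prime factors are
  examined.\<close>

fun set_search :: "(num \<times> num) list \<Rightarrow> (num \<times> num) list \<Rightarrow> num \<Rightarrow> num \<Rightarrow> crit \<Rightarrow> crit \<Rightarrow> num list \<Rightarrow>
    num \<Rightarrow> num \<Rightarrow> num \<Rightarrow> int list \<Rightarrow> int list option" where
  "set_search [] F A B k k' L P C C' hs = None"
| "set_search ((q, u) # ps) F A B k k' L P C C' hs =
    (let c = cost k u; c' = cost k' u in
     if crit_holds F B (bound k) c q C P then Some hs
     else if crit_holds F B (bound k') c' q C' P then Some hs
     else let P' = P * q in
       if B \<le> P' then smooth_search F A B L L P [] hs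
       else (case set_search ps F A B k k' (q # L) P' (C + c) (C' + c') hs of
           None \<Rightarrow> None
         | Some hs' \<Rightarrow> set_search ps F A B k k' L P C C' hs'))"

definition real_cost :: "crit \<Rightarrow> nat \<Rightarrow> real" where
  "real_cost k r = (case k of (a, b, d) \<Rightarrow> 100000 / real r * real (nat_of_num a) + real (nat_of_num b))"

definition crit_sound :: "nat \<Rightarrow> nat set \<Rightarrow> crit \<Rightarrow> bool" where
  "crit_sound p E k \<longleftrightarrow> (\<forall>R. prime_factors (p - 1) = E \<union> R \<longrightarrow> E \<inter> R = {} \<longrightarrow>
     2 + (\<Sum>r\<in>R. real_cost k r) \<le> real (nat_of_num (bound k)) \<longrightarrow> small_primroot p)"

text \<open>Replacing every further prime by the smaller \<open>q\<close> only lowers the product,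
  so the number of factors \<open>q\<close> that fit below \<open>B\<close> bounds
  \<open>card R\<close>, and the budget is checked after each of them.\<close>

lemma crit_holds_sound:
  assumes "crit_holds fs B d c q C P" "finite R" "\<And>r. r \<in> R \<Longrightarrow> nat_of_num q \<le> r"
    "nat_of_num P * \<Prod>R < nat_of_num B"
  shows "nat_of_num C + card R * nat_of_num c \<le> nat_of_num d"
  using assms
proof (induction fs B d c q C P arbitrary: R rule: crit_holds.induct)
  case (2 f fs B d c q C P)
  have dC: "\<not> d < C" using "2.prems"(1) by (auto split: if_splits)
  show ?case
  proof (cases "R = {}")
    case True
    thus ?thesis using dC by (simp add: less_num_def not_less)
  next
    case False
    then obtain r where r: "r \<in> R" by blast
    have qr: "nat_of_num q \<le> r" using "2.prems"(3) r by blast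
    have R0: "\<Prod>(R - {r}) \<noteq> 0"
    proof -
      have "0 \<notin> R" using "2.prems"(3)[of 0] nat_of_num_pos[of q] by linarith
      thus ?thesis using "2.prems"(2) by auto
    qed
    have prod: "\<Prod>R = r * \<Prod>(R - {r})" using "2.prems"(2) r by (rule prod.remove)
    have "nat_of_num (P * q) * \<Prod>(R - {r}) \<le> nat_of_num P * \<Prod>R"
      unfolding prod nat_of_num_mult using qr by (simp add: mult_ac)
    hence less: "nat_of_num (P * q) * \<Prod>(R - {r}) < nat_of_num B" using "2.prems"(4) by simp
    have "nat_of_num (P * q) * 1 \<le> nat_of_num (P * q) * \<Prod>(R - {r})"
      using R0 by (intro mult_le_mono2) simp
    hence "nat_of_num (P * q) < nat_of_num B" using less by linarith
    hence nB: "\<not> B \<le> P * q" by (simp add: less_eq_num_def)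
    hence "crit_holds fs B d c q (C + c) (P * q)"
      using "2.prems"(1) dC by (simp add: Let_def)
    from "2.IH"[OF dC refl nB this _ _ less]
    have "nat_of_num (C + c) + card (R - {r}) * nat_of_num c \<le> nat_of_num d"
      using "2.prems"(2,3) by auto
    moreover have "card R = Suc (card (R - {r}))" using "2.prems"(2) r by (metis card_Suc_Diff1)
    ultimately show ?thesis by (simp add: nat_of_num_add)
  qed
qed simp

fun table_ok :: "(num \<times> num) list \<Rightarrow> bool" where
  "table_ok [] = True"
| "table_ok ((q, u) # ps) \<longleftrightarrow> prime (nat_of_num q) \<and> 100000 \<le> nat_of_num q * nat_of_num u \<and>
     (\<forall>r. prime r \<and> nat_of_num q < r \<longrightarrow> (case ps of [] \<Rightarrow> True | (q', u') # _ \<Rightarrow> nat_of_num q' \<le> r)) \<and> table_ok ps"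

text \<open>The default 0 makes the lower bound on undecided primes vacuous once the table is
  exhausted.\<close>

definition table_head :: "(num \<times> num) list \<Rightarrow> nat" where
  "table_head ps = (case ps of [] \<Rightarrow> 0 | (q, u) # _ \<Rightarrow> nat_of_num q)"

lemma real_cost_le:
  assumes "100000 \<le> nat_of_num q * nat_of_num u" "nat_of_num q \<le> r"
  shows "real_cost k r \<le> real (nat_of_num (cost k u))"
proof -
  obtain a b d where k: "k = (a, b, d)" by (cases k) auto
  have q0: "nat_of_num q > 0" by (rule nat_of_num_pos)
  have "real 100000 \<le> real (nat_of_num q * nat_of_num u)" using assms(1) by (simp only: of_nat_le_iff)
  also have "\<dots> \<le> real r * real (nat_of_num u)" using assms(2) by (simp add: mult_right_mono)
  finally have "100000 / real r \<le> real (nat_of_num u)"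
    using q0 assms(2) by (simp add: field_simps)
  hence "100000 / real r * real (nat_of_num a) \<le> real (nat_of_num u) * real (nat_of_num a)"
    by (intro mult_right_mono) auto
  thus ?thesis by (simp add: k real_cost_def nat_of_num_add nat_of_num_mult)
qed

lemma prod_list_distinct_num:
  "distinct L \<Longrightarrow> num_prod L = \<Prod>(nat_of_num ` set L)"
proof (induction L)
  case (Cons l L)
  have "nat_of_num l \<notin> nat_of_num ` set L"
    using Cons.prems by (auto simp: image_iff) (metis nat_of_num_inverse)
  thus ?case using Cons by simp
qed simp

text \<open>The invariant: \<open>L\<close> lists prime factors of \<open>n0\<close> decided so far,
  and every other prime factor is at least the head of the table. Whether \<open>q\<close> divides
  \<open>n0\<close> selects the recursive call to follow; as the table has no gaps, the next head is
  a valid lower bound in both cases.\<close>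

lemma set_search_sound:
  assumes p: "prime p" and n0: "p = n0 + 1" "nat_of_num A \<le> n0" "n0 < nat_of_num B"
    and k: "crit_sound p E k" and k': "crit_sound p E' k'"
  shows "set_search ps F A B k k' L P C C' hs = Some hs' \<Longrightarrow> table_ok ps \<Longrightarrow>
    distinct L \<Longrightarrow> nat_of_num ` set L \<subseteq> prime_factors n0 \<Longrightarrow> nat_of_num P = num_prod L \<Longrightarrow>
    E \<subseteq> nat_of_num ` set L \<Longrightarrow> E' \<subseteq> nat_of_num ` set L \<Longrightarrow>
    2 + (\<Sum>r\<in>nat_of_num ` set L - E. real_cost k r) \<le> real (nat_of_num C) \<Longrightarrow>
    2 + (\<Sum>r\<in>nat_of_num ` set L - E'. real_cost k' r) \<le> real (nat_of_num C') \<Longrightarrow>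
    (\<And>r. r \<in> prime_factors n0 - nat_of_num ` set L \<Longrightarrow> table_head ps \<le> r) \<Longrightarrow> small_primroot p"
  using n0(2,3) k k'
proof (induction ps F A B k k' L P C C' hs arbitrary: hs' rule: set_search.induct)
  case (2 q u ps F A B k k' L P C C' hs)
  note run = "2.prems"(1) and tab = "2.prems"(2) and dist = "2.prems"(3) and sub = "2.prems"(4)
    and P = "2.prems"(5) and E = "2.prems"(6) and E' = "2.prems"(7) and C = "2.prems"(8)
    and C' = "2.prems"(9) and others = "2.prems"(10) and bounds = "2.prems"(11,12)
    and k = "2.prems"(13) and k' = "2.prems"(14)
  define V where "V = nat_of_num ` set L"
  define Q where "Q = prime_factors n0"
  have finV: "finite V" and finQ: "finite Q" by (auto simp: V_def Q_def)
  have VQ: "V \<subseteq> Q" using sub by (simp add: V_def Q_def)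
  have Qp1: "Q = prime_factors (p - 1)" using n0(1) by (simp add: Q_def)
  have n0_pos: "n0 > 0" using p prime_gt_1_nat n0(1) by auto
  have QP: "\<And>q. q \<in> Q \<Longrightarrow> prime q \<and> q dvd n0" by (auto simp: Q_def prime_factors_dvd)
  have PV: "nat_of_num P = \<Prod>V" using P prod_list_distinct_num[OF dist] by (simp add: V_def)
  have le_q: "nat_of_num q \<le> r" if "r \<in> Q - V" for r
    using others[of r] that by (simp add: table_head_def Q_def V_def)
  have q: "prime (nat_of_num q)" "100000 \<le> nat_of_num q * nat_of_num u" and tab': "table_ok ps"
    using tab by auto
  have "\<Prod>Q \<le> n0" using prod_primes_dvd[OF finQ QP] n0_pos by (rule dvd_imp_le)
  moreover have "\<Prod>Q = \<Prod>V * \<Prod>(Q - V)"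
    using prod.subset_diff[OF VQ finQ, of "\<lambda>x. x"] by (simp add: mult.commute)
  ultimately have PQ: "nat_of_num P * \<Prod>(Q - V) < nat_of_num B" using bounds(2) by (simp add: PV)
  \<comment> \<open>The cost at \<open>q\<close> dominates that of every prime factor not yet
    decided, since each of them is at least \<open>q\<close>; so a closed branch fulfils the budget
    for the actual set \<open>Q\<close>.\<close>
  have crit_case: "small_primroot p"
    if holds: "crit_holds F B (bound \<kappa>) (cost \<kappa> u) q c P" and snd: "crit_sound p G \<kappa>"
      and G: "G \<subseteq> V" and cost: "2 + (\<Sum>r\<in>V - G. real_cost \<kappa> r) \<le> real (nat_of_num c)" for \<kappa> c G
  proof -
    have "nat_of_num c + card (Q - V) * nat_of_num (cost \<kappa> u) \<le> nat_of_num (bound \<kappa>)"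
      using crit_holds_sound[OF holds _ le_q PQ] finQ by simp
    hence "real (nat_of_num c + card (Q - V) * nat_of_num (cost \<kappa> u)) \<le> real (nat_of_num (bound \<kappa>))"
      by (simp only: of_nat_le_iff)
    moreover have "(\<Sum>r\<in>Q - V. real_cost \<kappa> r) \<le> (\<Sum>r\<in>Q - V. real (nat_of_num (cost \<kappa> u)))"
      by (intro sum_mono real_cost_le[OF q(2)] le_q)
    moreover have "(\<Sum>r\<in>Q - G. real_cost \<kappa> r) = (\<Sum>r\<in>V - G. real_cost \<kappa> r) + (\<Sum>r\<in>Q - V. real_cost \<kappa> r)"
    proof -
      have "Q - G = (V - G) \<union> (Q - V)" using VQ G by blast
      thus ?thesis using finV finQ by (simp only:) (rule sum.union_disjoint, auto)
    qed
    ultimately have "2 + (\<Sum>r\<in>Q - G. real_cost \<kappa> r) \<le> real (nat_of_num (bound \<kappa>))"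
      using cost by simp
    moreover have "Q = G \<union> (Q - G)" "G \<inter> (Q - G) = {}" using VQ G by auto
    ultimately show ?thesis using snd unfolding crit_sound_def Qp1[symmetric] by blast
  qed
  show ?case
  proof (cases "crit_holds F B (bound k) (cost k u) q C P")
    case True
    from crit_case[OF this k E[folded V_def] C[folded V_def]] show ?thesis .
  next
    case nk: False
    show ?thesis
    proof (cases "crit_holds F B (bound k') (cost k' u) q C' P")
      case True
      from crit_case[OF this k' E'[folded V_def] C'[folded V_def]] show ?thesis .
    next
      case nk': False
      show ?thesis
      proof (cases "B \<le> P * q")
        case True
        have "Q - V = {}"
        proof (rule ccontr)
          assume "Q - V \<noteq> {}"
          then obtain r where r: "r \<in> Q - V" by blast
          have "r dvd \<Prod>(Q - V)" using r finQ by (intro dvd_prodI[of _ _ "\<lambda>x. x", simplified]) auto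
          moreover have "\<Prod>(Q - V) > 0"
            using QP by (intro prod_pos) (auto simp: prime_gt_0_nat)
          ultimately have "r \<le> \<Prod>(Q - V)" by (rule dvd_imp_le)
          hence "nat_of_num q \<le> \<Prod>(Q - V)" using le_q[OF r] by linarith
          hence "nat_of_num (P * q) \<le> nat_of_num P * \<Prod>(Q - V)" by (simp add: nat_of_num_mult)
          thus False using PQ True by (simp add: less_eq_num_def)
        qed
        hence VQ': "V = Q" using VQ by blast
        obtain m where m: "n0 = nat_of_num P * m"
          using prod_primes_dvd[OF finQ QP] by (auto simp: PV VQ' elim: dvdE)
        have run': "smooth_search F A B L L P [] hs = Some hs'"
          using run nk nk' True by (simp add: Let_def)
        have inV: "r \<in> nat_of_num ` set L" if "prime r" "r dvd n0" for r
          using that n0_pos VQ' by (auto simp: V_def[symmetric] Q_def prime_factors_dvd)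
        show ?thesis
          by (rule smooth_search_sound[OF p n0(1) bounds inV run' _ m]) (use P inV m in auto)
      next
        case False
        obtain hs1 where hs1: "set_search ps F A B k k' (q # L) (P * q) (C + cost k u) (C' + cost k' u) hs = Some hs1"
          using run nk nk' False by (auto simp: Let_def split: option.splits)
        have hs2: "set_search ps F A B k k' L P C C' hs1 = Some hs'"
          using run nk nk' False hs1 by (simp add: Let_def)
        have head: "table_head ps \<le> r" if "r \<in> Q - V" "r \<noteq> nat_of_num q" for r
        proof -
          have "nat_of_num q < r" using le_q[OF that(1)] that(2) by simp
          moreover have "prime r" using QP that(1) by blast
          ultimately show ?thesis
            using tab by (auto simp: table_head_def split: list.splits prod.splits)
        qed
        show ?thesis
        proof (cases "nat_of_num q \<in> Q - V")
          case qQ: True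
          have V': "nat_of_num ` set (q # L) = insert (nat_of_num q) V" by (simp add: V_def)
          have cost_insert: "2 + (\<Sum>r\<in>nat_of_num ` set (q # L) - G. real_cost \<kappa> r)
              \<le> real (nat_of_num (c + cost \<kappa> u))"
            if "G \<subseteq> V" "2 + (\<Sum>r\<in>V - G. real_cost \<kappa> r) \<le> real (nat_of_num c)" for G c \<kappa>
          proof -
            have ins: "insert (nat_of_num q) V - G = insert (nat_of_num q) (V - G)"
              using that(1) qQ by auto
            have "(\<Sum>r\<in>insert (nat_of_num q) V - G. real_cost \<kappa> r)
                = real_cost \<kappa> (nat_of_num q) + (\<Sum>r\<in>V - G. real_cost \<kappa> r)"
              unfolding ins by (rule sum.insert) (use qQ finV in auto)
            moreover have "real_cost \<kappa> (nat_of_num q) \<le> real (nat_of_num (cost \<kappa> u))"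
              by (rule real_cost_le[OF q(2) order_refl])
            ultimately show ?thesis
              using that(2) unfolding V' nat_of_num_add of_nat_add by linarith
          qed
          show ?thesis
          proof (rule "2.IH"(1)[OF refl refl nk nk' refl False hs1 tab' _ _ _ _ _ _ _ _ bounds k k'])
            show "distinct (q # L)" using dist qQ by (auto simp: V_def)
            show "nat_of_num ` set (q # L) \<subseteq> prime_factors n0"
              using qQ VQ by (simp add: V_def[symmetric] Q_def[symmetric])
            show "nat_of_num (P * q) = num_prod (q # L)" using P by (simp add: nat_of_num_mult)
            show "E \<subseteq> nat_of_num ` set (q # L)" "E' \<subseteq> nat_of_num ` set (q # L)" using E E' by auto
            show "table_head ps \<le> r" if "r \<in> prime_factors n0 - nat_of_num ` set (q # L)" for r
              using head[of r] that by (simp add: V_def Q_def)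
            show "2 + (\<Sum>r\<in>nat_of_num ` set (q # L) - E. real_cost k r) \<le> real (nat_of_num (C + cost k u))"
              by (rule cost_insert[OF E[folded V_def] C[folded V_def]])
            show "2 + (\<Sum>r\<in>nat_of_num ` set (q # L) - E'. real_cost k' r) \<le> real (nat_of_num (C' + cost k' u))"
              by (rule cost_insert[OF E'[folded V_def] C'[folded V_def]])
          qed
        next
          case False
          show ?thesis
          proof (rule "2.IH"(2)[OF refl refl nk nk' refl \<open>\<not> B \<le> P * q\<close> hs1 hs2 tab' dist sub P E E' C C' _ bounds k k'])
            show "table_head ps \<le> r" if "r \<in> prime_factors n0 - nat_of_num ` set L" for r
              using head[of r] that False by (auto simp: V_def Q_def)
          qed
        qed
      qed
    qed
  qed
qed simp

section \<open>Soundness of the search on an interval\<close>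

text \<open>The primes from 5 to 1999, each with \<open>10 ^ 5 / q\<close> rounded up (for 5, to the
  next integer). The primes 2 and 3 are absent because \<open>run_search\<close> fixes their role
  beforehand.\<close>

definition prime_table :: "(int \<times> int) list" where
  "prime_table = [
    (5,20001), (7,14286), (11,9091), (13,7693), (17,5883), (19,5264), (23,4348), (29,3449), (31,3226),
    (37,2703), (41,2440), (43,2326), (47,2128), (53,1887), (59,1695), (61,1640), (67,1493), (71,1409),
    (73,1370), (79,1266), (83,1205), (89,1124), (97,1031), (101,991), (103,971), (107,935), (109,918),
    (113,885), (127,788), (131,764), (137,730), (139,720), (149,672), (151,663), (157,637), (163,614),
    (167,599), (173,579), (179,559), (181,553), (191,524), (193,519), (197,508), (199,503), (211,474),
    (223,449), (227,441), (229,437), (233,430), (239,419), (241,415), (251,399), (257,390), (263,381),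
    (269,372), (271,370), (277,362), (281,356), (283,354), (293,342), (307,326), (311,322), (313,320),
    (317,316), (331,303), (337,297), (347,289), (349,287), (353,284), (359,279), (367,273), (373,269),
    (379,264), (383,262), (389,258), (397,252), (401,250), (409,245), (419,239), (421,238), (431,233),
    (433,231), (439,228), (443,226), (449,223), (457,219), (461,217), (463,216), (467,215), (479,209),
    (487,206), (491,204), (499,201), (503,199), (509,197), (521,192), (523,192), (541,185), (547,183),
    (557,180), (563,178), (569,176), (571,176), (577,174), (587,171), (593,169), (599,167), (601,167),
    (607,165), (613,164), (617,163), (619,162), (631,159), (641,157), (643,156), (647,155), (653,154),
    (659,152), (661,152), (673,149), (677,148), (683,147), (691,145), (701,143), (709,142), (719,140),
    (727,138), (733,137), (739,136), (743,135), (751,134), (757,133), (761,132), (769,131), (773,130),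
    (787,128), (797,126), (809,124), (811,124), (821,122), (823,122), (827,121), (829,121), (839,120),
    (853,118), (857,117), (859,117), (863,116), (877,115), (881,114), (883,114), (887,113), (907,111),
    (911,110), (919,109), (929,108), (937,107), (941,107), (947,106), (953,105), (967,104), (971,103),
    (977,103), (983,102), (991,101), (997,101), (1009,100), (1013,99), (1019,99), (1021,98), (1031,97),
    (1033,97), (1039,97), (1049,96), (1051,96), (1061,95), (1063,95), (1069,94), (1087,92), (1091,92),
    (1093,92), (1097,92), (1103,91), (1109,91), (1117,90), (1123,90), (1129,89), (1151,87), (1153,87),
    (1163,86), (1171,86), (1181,85), (1187,85), (1193,84), (1201,84), (1213,83), (1217,83), (1223,82),
    (1229,82), (1231,82), (1237,81), (1249,81), (1259,80), (1277,79), (1279,79), (1283,78), (1289,78),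
    (1291,78), (1297,78), (1301,77), (1303,77), (1307,77), (1319,76), (1321,76), (1327,76), (1361,74),
    (1367,74), (1373,73), (1381,73), (1399,72), (1409,71), (1423,71), (1427,71), (1429,70), (1433,70),
    (1439,70), (1447,70), (1451,69), (1453,69), (1459,69), (1471,68), (1481,68), (1483,68), (1487,68),
    (1489,68), (1493,67), (1499,67), (1511,67), (1523,66), (1531,66), (1543,65), (1549,65), (1553,65),
    (1559,65), (1567,64), (1571,64), (1579,64), (1583,64), (1597,63), (1601,63), (1607,63), (1609,63),
    (1613,62), (1619,62), (1621,62), (1627,62), (1637,62), (1657,61), (1663,61), (1667,60), (1669,60),
    (1693,60), (1697,59), (1699,59), (1709,59), (1721,59), (1723,59), (1733,58), (1741,58), (1747,58),
    (1753,58), (1759,57), (1777,57), (1783,57), (1787,56), (1789,56), (1801,56), (1811,56), (1823,55),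
    (1831,55), (1847,55), (1861,54), (1867,54), (1871,54), (1873,54), (1877,54), (1879,54), (1889,53),
    (1901,53), (1907,53), (1913,53), (1931,52), (1933,52), (1949,52), (1951,52), (1973,51), (1979,51),
    (1987,51), (1993,51), (1997,51), (1999,51)]"

definition trial_primes :: "int list" where
  "trial_primes = [2, 3, 5, 7, 11, 13, 17, 19, 23, 29, 31, 37, 41, 43]"

fun no_factor_in :: "int list \<Rightarrow> int \<Rightarrow> bool" where
  "no_factor_in [] k = True"
| "no_factor_in (d # ds) k =
    (if k = d then no_factor_in ds k
     else if num_mod (num_of_int k) (num_of_int d) = Zer then False else no_factor_in ds k)"

definition no_small_factor :: "int \<Rightarrow> bool" where
  "no_small_factor = no_factor_in trial_primes"

lemma no_factor_in_iff:
  "no_factor_in ds k \<longleftrightarrow> (\<forall>d\<in>set ds. k = d \<or> num_mod (num_of_int k) (num_of_int d) \<noteq> Zer)"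
  by (induction ds) auto

fun table_check :: "(int \<times> int) list \<Rightarrow> bool" where
  "table_check [] = True"
| "table_check [(q, u)] \<longleftrightarrow>
     2 \<le> q \<and> q < 2209 \<and> 0 < u \<and> 100000 \<le> q * u \<and> no_small_factor q"
| "table_check ((q, u) # (q', u') # ps) \<longleftrightarrow>
     2 \<le> q \<and> q < 2209 \<and> 0 < u \<and> 100000 \<le> q * u \<and> no_small_factor q \<and>
     list_all (\<lambda>k. \<not> no_small_factor k) [q + 1..q' - 1] \<and> table_check ((q', u') # ps)"

lemma table_check_prime_table: "table_check prime_table"
  by code_simp

lemma num_mod_eq_Zer_iff:
  assumes "k > 0" "d > 0"
  shows "num_mod (num_of_int k) (num_of_int d) = Zer \<longleftrightarrow> d dvd k"
proof -
  have v: "num_val (num_of_int k) = k" "num_val (num_of_int d) = d"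
    using assms by (simp_all add: num_val_def nat_of_num_of_int)
  have rep: "represents (num_mod (num_of_int k) (num_of_int d)) (k mod d)"
    using represents_num_mod[of "num_of_int k" "num_of_int d"] by (simp add: v)
  show ?thesis
  proof (cases "num_mod (num_of_int k) (num_of_int d)")
    case Neg
    thus ?thesis using rep assms by simp (metis not_less pos_mod_sign)
  next
    case Zer
    thus ?thesis using rep by (simp add: mod_eq_0_iff_dvd)
  next
    case (Pnum n)
    thus ?thesis using rep num_val_ge_1[of n] by (auto simp: dvd_eq_mod_eq_0)
  qed
qed

text \<open>The limit is 47^2 = 2209: a composite number below it has a prime divisor at most 43,
  and these are the trial primes.\<close>

lemma no_small_factor_iff:
  assumes "2 \<le> k" "k < 2209"
  shows "no_small_factor k \<longleftrightarrow> prime (nat k)"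
proof
  assume pk: "prime (nat k)"
  show "no_small_factor k" unfolding no_small_factor_def no_factor_in_iff
  proof
    fix d assume d: "d \<in> set trial_primes"
    hence d2: "d \<ge> 2" by (auto simp: trial_primes_def)
    have "k = d" if "d dvd k"
    proof -
      have "nat d dvd nat k" using that d2 assms(1) by (simp add: nat_dvd_iff)
      hence "nat d = 1 \<or> nat d = nat k" using \<open>prime (nat k)\<close> prime_nat_iff by blast
      thus ?thesis using d2 assms(1) by linarith
    qed
    thus "k = d \<or> num_mod (num_of_int k) (num_of_int d) \<noteq> Zer"
      using num_mod_eq_Zer_iff[of k d] assms d2 by auto
  qed
next
  assume nf: "no_small_factor k"
  show "prime (nat k)"
  proof (rule ccontr)
    assume np: "\<not> prime (nat k)"
    define n where "n = nat k"
    have n: "n \<ge> 2" "n < 2209" and kn: "k = int n" using assms by (auto simp: n_def)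
    obtain q where q: "prime q" "q dvd n" "q * q \<le> n"
    proof -
      have "\<not> prime n" using np by (simp add: n_def)
      then obtain a where "a dvd n" "a \<noteq> 1" "a \<noteq> n" using n(1) by (auto simp: prime_nat_iff)
      then obtain b where ab0: "n = a * b" "a \<noteq> 1" "a \<noteq> n" by blast
      have "a \<noteq> 0" "b \<noteq> 0" "b \<noteq> 1" using ab0 n(1) by (auto intro: ccontr)
      hence ab: "n = a * b" "1 < a" "1 < b" using ab0 by auto
      define c where "c = min a b"
      have c: "c * c \<le> n" "c dvd n" "c \<noteq> 1" "c > 0"
        using ab by (auto simp: c_def min_def intro!: mult_le_mono)
      obtain q where q: "prime q" "q dvd c" using prime_factor_nat[OF c(3)] by blast
      have "q \<le> c" using q(2) c(4) by (rule dvd_imp_le)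
      hence "q * q \<le> c * c" by (intro mult_le_mono)
      thus thesis using that[of q] q c by (meson dvd_trans le_trans)
    qed
    have "q < 47"
    proof (rule ccontr)
      assume "\<not> q < 47"
      hence "47 * 47 \<le> q * q" by (intro mult_le_mono) auto
      thus False using q(3) n(2) by simp
    qed
    have "q \<in> {2, 3, 5, 7, 11, 13, 17, 19, 23, 29, 31} \<or> q \<in> {37..46}"
      using prime_cases_le_31[OF q(1)] \<open>q < 47\<close> by force
    moreover have "\<not> d dvd q" if "prime d" "q \<noteq> d" for d using q(1) that primes_dvd_imp_eq by blast
    hence "q = 2 \<or> \<not> 2 dvd q" "q = 3 \<or> \<not> 3 dvd q" by auto
    ultimately have qt: "int q \<in> set trial_primes"
      unfolding trial_primes_def by simp presburger
    have "q \<noteq> n" using np q(1) by (auto simp: n_def)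
    hence "num_mod (num_of_int k) (num_of_int (int q)) \<noteq> Zer"
      using nf qt kn by (auto simp: no_small_factor_def no_factor_in_iff)
    moreover have "int q dvd k" using q(2) kn by simp
    ultimately show False
      using num_mod_eq_Zer_iff[of k "int q"] assms prime_gt_0_nat[OF q(1)] by simp
  qed
qed

definition search_table :: "(num \<times> num) list" where
  "search_table = map (\<lambda>(q, u). (num_of_int q, num_of_int u)) prime_table"

lemma table_ok_of_check:
  "table_check ps \<Longrightarrow> table_ok (map (\<lambda>(q, u). (num_of_int q, num_of_int u)) ps)"
proof (induction ps rule: table_check.induct)
  case (2 q u)
  hence *: "2 \<le> q" "q < 2209" "0 < u" "100000 \<le> q * u" "no_small_factor q" by auto
  hence "100000 \<le> nat q * nat u" by (simp flip: nat_mult_distrib)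
  thus ?case using * no_small_factor_iff[of q] by (simp add: nat_of_num_of_int)
next
  case (3 q u q' u' ps)
  have *: "2 \<le> q" "q < 2209" "0 < u" "100000 \<le> q * u" "no_small_factor q"
    and gap: "\<And>k. q < k \<Longrightarrow> k < q' \<Longrightarrow> \<not> no_small_factor k" and rest: "table_check ((q', u') # ps)"
    using "3.prems" by (auto simp: list_all_iff)
  have q': "q' < 2209" "2 \<le> q'" using rest by (cases ps; auto)+
  have "nat q' \<le> r" if r: "prime r" "nat q < r" for r
  proof (rule ccontr)
    assume "\<not> nat q' \<le> r"
    hence less: "int r < q'" by simp
    hence "\<not> no_small_factor (int r)" using r(2) *(1) by (intro gap) auto
    thus False using no_small_factor_iff[of "int r"] r less q' prime_ge_2_nat[OF r(1)] by simp
  qed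
  moreover have "100000 \<le> nat q * nat u" using * by (simp flip: nat_mult_distrib)
  ultimately show ?case
    using * "3.IH"[OF rest] no_small_factor_iff[of q] q' by (simp add: nat_of_num_of_int)
qed simp

lemma table_ok_search_table: "table_ok search_table"
  unfolding search_table_def by (rule table_ok_of_check[OF table_check_prime_table])

lemma search_table_Cons:
  "search_table = (num_of_int 5, num_of_int 20001) # (num_of_int 7, num_of_int 14286) # tl (tl search_table)"
  by (simp add: search_table_def prime_table_def)

fun crit_of :: "int \<times> int \<times> int \<Rightarrow> crit" where
  "crit_of (a, b, d) = (num_of_int a, num_of_int b, num_of_int d)"

text \<open>The simplifier renormalises whatever passes through \<open>if\<close> and \<open>case\<close>. The following equations
  branch by pattern matching instead, so that long lists are never traversed.\<close>
definition smooth_leaf :: "bool \<Rightarrow> num list \<Rightarrow> num \<Rightarrow> num list \<Rightarrow> int list \<Rightarrow> int list option" where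
  "smooth_leaf c L n es hs = (if c then Some hs else hint_test L n es hs)"

definition smooth_next :: "bool \<Rightarrow> 'x list \<Rightarrow> num \<Rightarrow> num \<Rightarrow> num list \<Rightarrow> num list \<Rightarrow> num \<Rightarrow> num list \<Rightarrow> int list \<Rightarrow> int list option" where
  "smooth_next c fs A B L ls n es hs = (if c then Some hs else smooth_search fs A B L ls n es hs)"

definition smooth_cont :: "int list option \<Rightarrow> 'x list \<Rightarrow> num \<Rightarrow> num \<Rightarrow> num list \<Rightarrow> num \<Rightarrow> num list \<Rightarrow> num \<Rightarrow> num list \<Rightarrow> int list option" where
  "smooth_cont r fs A B L l ls n es =
    (case r of None \<Rightarrow> None | Some hs \<Rightarrow> smooth_next (B \<le> n) fs A B L (l # ls) n (l # es) hs)"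

definition smooth_step :: "bool \<Rightarrow> 'x list \<Rightarrow> num \<Rightarrow> num \<Rightarrow> num list \<Rightarrow> num \<Rightarrow> num list \<Rightarrow> num \<Rightarrow> num list \<Rightarrow> int list \<Rightarrow> int list option" where
  "smooth_step c fs A B L l ls n es hs =
    (if c then smooth_leaf (n < A) L n es hs
     else smooth_cont (smooth_search fs A B L ls n es hs) fs A B L l ls (n * l) es)"

definition hint_value :: "num list \<Rightarrow> num \<Rightarrow> num list \<Rightarrow> int \<Rightarrow> bool" where
  "hint_value L n es k \<longleftrightarrow> hint_test L n es [k] \<noteq> None"

definition hint_cont :: "bool \<Rightarrow> int list \<Rightarrow> int list option" where
  "hint_cont c hs = (if c then Some hs else None)"

lemma smooth_code [code]:
  "smooth_leaf True L n es hs = Some hs" "smooth_leaf False L n es hs = hint_test L n es hs"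
  "smooth_next True fs A B L ls n es hs = Some hs"
  "smooth_next False fs A B L ls n es hs = smooth_search fs A B L ls n es hs"
  "smooth_cont None fs A B L l ls n es = None"
  "smooth_cont (Some hs) fs A B L l ls n es = smooth_next (B \<le> n) fs A B L (l # ls) n (l # es) hs"
  "hint_cont True hs = Some hs" "hint_cont False hs = None"
  by (simp_all add: smooth_leaf_def smooth_next_def smooth_cont_def hint_cont_def)

lemma smooth_search_code [code]:
  "smooth_search [] A B L ls n es hs = None"
  "smooth_search (f # fs) A B L [] n es hs = smooth_leaf (n < A) L n es hs"
  "smooth_search (f # fs) A B L (l # ls) n es hs = smooth_step (B \<le> num.Bit0 n) fs A B L l ls n es hs"
  "smooth_step True fs A B L l ls n es hs = smooth_leaf (n < A) L n es hs"
  "smooth_step False fs A B L l ls n es hs =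
     smooth_cont (smooth_search fs A B L ls n es hs) fs A B L l ls (n * l) es"
  by (auto simp: smooth_step_def smooth_leaf_def smooth_cont_def smooth_next_def Let_def split: option.splits)

lemma hint_code [code]:
  "hint_test L n es [] = None"
  "hint_test L n es (k # hs) = hint_cont (hint_value L n es k) hs"
  "hint_value L n es k \<longleftrightarrow>
    (if k < 0 then
       (let d = num_of_int (- k) in num.One < d \<and> d \<le> n \<and> num_mod (n + num.One) d = Zer)
     else
       (let g = num_of_int k; p = n + num.One in
        if k \<in> set root_primes \<and> (if g * g \<le> n then True else g * g * g * g < p * p * p)
        then order_test p L (mod_power_list p (Pnum g) es) else False))"
  by (simp_all add: hint_cont_def hint_value_def Let_def)

definition set_test :: "bool \<Rightarrow> bool \<Rightarrow> num \<Rightarrow> num \<Rightarrow> (num \<times> num) list \<Rightarrow> (num \<times> num) list \<Rightarrow> num \<Rightarrow> num \<Rightarrow>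
    crit \<Rightarrow> crit \<Rightarrow> num list \<Rightarrow> num \<Rightarrow> num \<Rightarrow> num \<Rightarrow> int list \<Rightarrow> int list option" where
  "set_test c c' q u ps F A B k k' L P C C' hs =
    (if c then Some hs else if c' then Some hs else
       let P' = P * q in
       if B \<le> P' then smooth_search F A B L L P [] hs
       else (case set_search ps F A B k k' (q # L) P' (C + cost k u) (C' + cost k' u) hs of
           None \<Rightarrow> None
         | Some hs' \<Rightarrow> set_search ps F A B k k' L P C C' hs'))"

definition set_branch :: "bool \<Rightarrow> num \<Rightarrow> num \<Rightarrow> num \<Rightarrow> (num \<times> num) list \<Rightarrow> (num \<times> num) list \<Rightarrow> num \<Rightarrow> num \<Rightarrow>
    crit \<Rightarrow> crit \<Rightarrow> num list \<Rightarrow> num \<Rightarrow> num \<Rightarrow> num \<Rightarrow> int list \<Rightarrow> int list option" where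
  "set_branch c P' q u ps F A B k k' L P C C' hs =
    (if c then smooth_search F A B L L P [] hs
       else (case set_search ps F A B k k' (q # L) P' (C + cost k u) (C' + cost k' u) hs of
           None \<Rightarrow> None
         | Some hs' \<Rightarrow> set_search ps F A B k k' L P C C' hs'))"

definition set_cont :: "int list option \<Rightarrow> (num \<times> num) list \<Rightarrow> (num \<times> num) list \<Rightarrow> num \<Rightarrow> num \<Rightarrow>
    crit \<Rightarrow> crit \<Rightarrow> num list \<Rightarrow> num \<Rightarrow> num \<Rightarrow> num \<Rightarrow> int list option" where
  "set_cont r ps F A B k k' L P C C' =
    (case r of None \<Rightarrow> None | Some hs \<Rightarrow> set_search ps F A B k k' L P C C' hs)"

lemma set_search_code [code]:
  "set_search [] F A B k k' L P C C' hs = None"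
  "set_search ((q, u) # ps) F A B k k' L P C C' hs =
     set_test (crit_holds F B (bound k) (cost k u) q C P) (crit_holds F B (bound k') (cost k' u) q C' P)
       q u ps F A B k k' L P C C' hs"
  "set_test True c' q u ps F A B k k' L P C C' hs = Some hs"
  "set_test False True q u ps F A B k k' L P C C' hs = Some hs"
  "set_test False False q u ps F A B k k' L P C C' hs =
     set_branch (B \<le> P * q) (P * q) q u ps F A B k k' L P C C' hs"
  "set_branch True P' q u ps F A B k k' L P C C' hs = smooth_search F A B L L P [] hs"
  "set_branch False P' q u ps F A B k k' L P C C' hs =
     set_cont (set_search ps F A B k k' (q # L) P' (C + cost k u) (C' + cost k' u) hs)
       ps F A B k k' L P C C'"
  "set_cont None ps F A B k k' L P C C' = None"
  "set_cont (Some hs) ps F A B k k' L P C C' = set_search ps F A B k k' L P C C' hs"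
  by (simp_all add: set_test_def set_branch_def set_cont_def Let_def)

definition crit_next :: "bool \<Rightarrow> 'x list \<Rightarrow> num \<Rightarrow> num \<Rightarrow> num \<Rightarrow> num \<Rightarrow> num \<Rightarrow> num \<Rightarrow> bool" where
  "crit_next x fs B d c q C P \<longleftrightarrow> (if x then True else crit_holds fs B d c q C P)"

definition crit_first :: "bool \<Rightarrow> 'x list \<Rightarrow> num \<Rightarrow> num \<Rightarrow> num \<Rightarrow> num \<Rightarrow> num \<Rightarrow> num \<Rightarrow> bool" where
  "crit_first x fs B d c q C P \<longleftrightarrow>
     (if x then False else crit_next (B \<le> P * q) fs B d c q (C + c) (P * q))"

lemma crit_holds_code [code]:
  "crit_holds [] B d c q C P = False"
  "crit_holds (f # fs) B d c q C P = crit_first (d < C) fs B d c q C P"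
  "crit_first True fs B d c q C P = False"
  "crit_first False fs B d c q C P = crit_next (B \<le> P * q) fs B d c q (C + c) (P * q)"
  "crit_next True fs B d c q C P = True"
  "crit_next False fs B d c q C P = crit_holds fs B d c q C P"
  by (simp_all add: crit_first_def crit_next_def Let_def)

text \<open>Three searches, according to the behaviour of 3 and 5. If 3 does not divide
  \<open>p - 1\<close>, only the criterion for {2} applies. If 3 does but 5 does not, those for {2}
  and {2, 3} compete. If both do, those for {2, 3} and {2, 3, 5}. The constants 33334 and 20000 are
  \<open>10 ^ 5 / 3\<close> rounded up and \<open>10 ^ 5 / 5\<close>, charged where the chosen prime
  lies outside the set of the first criterion.\<close>

definition run_search :: "int \<Rightarrow> int \<Rightarrow> int \<times> int \<times> int \<Rightarrow> int \<times> int \<times> int \<Rightarrow> int \<times> int \<times> int \<Rightarrow> int list \<Rightarrow> bool" where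
  "run_search A B c1 c2 c3 hs =
    (let A = num_of_int A; B = num_of_int B; k1 = crit_of c1; k2 = crit_of c2; k3 = crit_of c3;
       T = search_table; n2 = num_of_int 2; n3 = num_of_int 3; n5 = num_of_int 5 in
     case set_search T T A B k1 k1 [n2] n2 n2 n2 hs of None \<Rightarrow> False | Some hs \<Rightarrow>
       (case set_search (tl T) T A B k1 k2 [n3, n2] (num_of_int 6) (n2 + cost k1 (num_of_int 33334)) n2 hs of
         None \<Rightarrow> False | Some hs \<Rightarrow>
         (case set_search (tl T) T A B k2 k3 [n5, n3, n2] (num_of_int 30) (n2 + cost k2 (num_of_int 20000)) n2 hs of
           None \<Rightarrow> False | Some hs \<Rightarrow> True)))"

lemma run_search_sound:
  assumes run: "run_search A B c1 c2 c3 hs" and p: "prime p" and A: "2 \<le> A" "A < int p" "int p \<le> B"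
    and c1: "crit_sound p {2} (crit_of c1)" and c2: "crit_sound p {2, 3} (crit_of c2)"
    and c3: "crit_sound p {2, 3, 5} (crit_of c3)"
  shows "small_primroot p"
proof -
  define n0 where "n0 = p - 1"
  define Q where "Q = prime_factors n0"
  have p1: "p > 1" using p prime_gt_1_nat by auto
  have n0: "p = n0 + 1" "nat_of_num (num_of_int A) \<le> n0" "n0 < nat_of_num (num_of_int B)"
    using A p1 by (auto simp: n0_def nat_of_num_of_int)
  have odd: "odd p" using p A prime_odd_nat[of p] by auto
  have n0_pos: "n0 > 0" using p1 by (simp add: n0_def)
  have Q2: "2 \<in> Q" using odd n0_pos p1 by (simp add: Q_def n0_def prime_factors_dvd)
  have v: "nat_of_num (num_of_int 2) = 2" "nat_of_num (num_of_int 3) = 3" "nat_of_num (num_of_int 5) = 5"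
    "nat_of_num (num_of_int 6) = 6" "nat_of_num (num_of_int 7) = 7" "nat_of_num (num_of_int 30) = 30"
    by (simp_all add: nat_of_num_of_int)
  have ne: "num_of_int 2 \<noteq> num_of_int 3" "num_of_int 2 \<noteq> num_of_int 5" "num_of_int 3 \<noteq> num_of_int 5"
    using v by (metis numeral_eq_iff num.simps)+
  have prQ: "prime r" if "r \<in> Q" for r using that by (auto simp: Q_def)
  have ge5: "r \<ge> 5" if "r \<in> Q" "r \<noteq> 2" "r \<noteq> 3" for r
  proof -
    have "r \<ge> 2" "r \<noteq> 4" using prQ[OF that(1)] prime_ge_2_nat[of r] by (auto dest: prime_odd_nat)
    thus ?thesis using that by linarith
  qed
  have ge7: "r \<ge> 7" if "r \<in> Q" "r \<noteq> 2" "r \<noteq> 3" "r \<noteq> 5" for r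
  proof -
    have "r \<noteq> 6" using prQ[OF that(1)] prime_odd_nat[of r] by auto
    thus ?thesis using ge5[OF that(1-3)] that(4) by linarith
  qed
  have tab: "table_ok search_table" "table_ok (tl search_table)"
    using table_ok_search_table search_table_Cons by (metis table_ok.simps(2) list.sel(3))+
  have head: "table_head search_table = 5" "table_head (tl search_table) = 7"
    using v search_table_Cons by (metis (no_types, lifting) table_head_def list.simps(5) case_prod_conv list.sel(3))+
  let ?T = search_table and ?A = "num_of_int A" and ?B = "num_of_int B"
  let ?k1 = "crit_of c1" and ?k2 = "crit_of c2" and ?k3 = "crit_of c3"
  let ?n2 = "num_of_int 2" and ?n3 = "num_of_int 3" and ?n5 = "num_of_int 5"
  obtain hs1 where r1: "set_search ?T ?T ?A ?B ?k1 ?k1 [?n2] ?n2 ?n2 ?n2 hs = Some hs1"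
    using run by (auto simp: run_search_def Let_def split: option.splits)
  obtain hs2 where r2: "set_search (tl ?T) ?T ?A ?B ?k1 ?k2 [?n3, ?n2] (num_of_int 6)
      (?n2 + cost ?k1 (num_of_int 33334)) ?n2 hs1 = Some hs2"
    using run r1 by (auto simp: run_search_def Let_def split: option.splits)
  obtain hs3 where r3: "set_search (tl ?T) ?T ?A ?B ?k2 ?k3 [?n5, ?n3, ?n2] (num_of_int 30)
      (?n2 + cost ?k2 (num_of_int 20000)) ?n2 hs2 = Some hs3"
    using run r1 r2 by (auto simp: run_search_def Let_def split: option.splits)
  show ?thesis
  proof (cases "3 \<in> Q")
    case False
    show ?thesis
      by (rule set_search_sound[OF p n0 c1 c1 r1 tab(1)])
         (use Q2 ge5 False in \<open>auto simp: v head Q_def[symmetric]\<close>)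
  next
    case Q3: True
    have c33334: "real_cost ?k1 3 \<le> real (nat_of_num (cost ?k1 (num_of_int 33334)))"
      by (rule real_cost_le[of ?n3]) (simp_all add: nat_of_num_of_int)
    have c20000: "real_cost ?k2 5 \<le> real (nat_of_num (cost ?k2 (num_of_int 20000)))"
      by (rule real_cost_le[of ?n5]) (simp_all add: nat_of_num_of_int)
    show ?thesis
    proof (cases "5 \<in> Q")
      case False
      have d: "{3, 2} - {2} = {3 :: nat}" "{3, 2} - {2, 3} = ({} :: nat set)" by auto
      show ?thesis
        by (rule set_search_sound[OF p n0 c1 c2 r2 tab(2)])
           (use Q2 Q3 ge7 False ne c33334 in \<open>auto simp: v head d nat_of_num_add Q_def[symmetric]\<close>)
    next
      case Q5: True
      have d: "{5, 3, 2} - {2, 3} = {5 :: nat}" "{5, 3, 2} - {2, 3, 5} = ({} :: nat set)" by auto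
      show ?thesis
        by (rule set_search_sound[OF p n0 c2 c3 r3 tab(2)])
           (use Q2 Q3 Q5 ge7 ne c20000 in \<open>auto simp: v head d nat_of_num_add Q_def[symmetric]\<close>)
    qed
  qed
qed

text \<open>\<open>\<kappa>\<close> bounds \<open>p powr 0.04\<close> on the interval, so that \<open>M\<close> can be taken as the floor of \<open>p / (4 * \<kappa>)\<close>; a
  budget \<open>d \<le> 1\<close> in \<open>crit_ok\<close> marks a criterion that is never met.\<close>
definition interval_ok :: "int \<Rightarrow> int \<Rightarrow> real \<Rightarrow> real \<Rightarrow> real \<Rightarrow> real \<Rightarrow> real \<Rightarrow> real \<Rightarrow> real \<Rightarrow> bool" where
  "interval_ok A B \<kappa> s s' m e f h \<longleftrightarrow>
     1 \<le> \<kappa> \<and> real_of_int B \<le> \<kappa> ^ 25 \<and> 0 < s \<and> s\<^sup>2 \<le> real_of_int A \<and> 0 < s / (4 * \<kappa>) - 1 / s \<and>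
     1 / (s / (4 * \<kappa>) - 1 / s) \<le> e \<and> 0 < s' \<and> real_of_int B \<le> s'\<^sup>2 \<and> e - 1 / s' \<le> f \<and> 0 \<le> f \<and>
     0 < m \<and> m\<^sup>2 \<le> real_of_int A / (4 * \<kappa>) - 1 \<and> 1 / m \<le> h \<and> 8 \<le> real_of_int A / (4 * \<kappa>)"

text \<open>Collecting the terms in \<open>1 / r\<close>, a prime costs
  \<open>(1 - (2 * K - 1) * f) / r + K * f\<close> in the criterion; scaling by
  \<open>10 ^ 7\<close> yields the conditions on \<open>a\<close> and \<open>b\<close>. The budget
  \<open>d\<close> is what remains after dividing the main inequality by
  \<open>\<theta>\<close>.\<close>

definition crit_ok :: "real \<Rightarrow> real \<Rightarrow> real \<Rightarrow> real \<Rightarrow> real \<Rightarrow> int \<times> int \<times> int \<Rightarrow> bool" where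
  "crit_ok e f h K \<theta> c \<longleftrightarrow> (case c of (a, b, d) \<Rightarrow> 0 < a \<and> 0 < b \<and> 0 < d \<and> (d \<le> 1 \<or>
     100 * (1 - (2 * K - 1) * f) \<le> real_of_int a \<and> 10000000 * (K * f) \<le> real_of_int b \<and>
     real_of_int d \<le> 10000000 * (1 - f * (K - 1)
       - (1 / 18 + 1 / 50 + 1 / 98 + 1 / 27 + 3 / 2 * e + 2 / 3 * h) / \<theta>)))"

lemma real_cost_nonneg: "0 \<le> real_cost k r"
  by (simp add: real_cost_def split: prod.splits)

text \<open>Costs start at 2, so a budget of 1 is exceeded by every set of primes.\<close>

lemma crit_sound_trivial: "crit_sound p E (crit_of (a, b, 1))"
proof -
  have "nat_of_num (num_of_int 1) = 1" by (simp add: nat_of_num_of_int)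
  thus ?thesis unfolding crit_sound_def
    by (auto dest: order_trans[OF add_left_mono[OF sum_nonneg]] simp: real_cost_nonneg)
       (smt (verit) real_cost_nonneg sum_nonneg)
qed

text \<open>On the whole interval \<open>sqrt p\<close> lies between \<open>s\<close> and
  \<open>s'\<close>, and \<open>sqrt M\<close> is at least \<open>m\<close>. Hence \<open>e\<close>,
  \<open>f\<close> and \<open>h\<close> bound the three error quantities of the criterion uniformly
  in \<open>p\<close>.\<close>

lemma crit_sound_interval:
  assumes iv: "interval_ok A B \<kappa> s s' m e f h" and p: "prime p" and A: "2 \<le> A" "A < int p" "int p \<le> B"
    and c: "crit_ok e f h K \<theta> (a, b, d)" and K: "K = 2 ^ card E" and \<theta>: "\<theta> = theta E" "0 < \<theta>"
  shows "crit_sound p E (crit_of (a, b, d))"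
proof (cases "d \<le> 1")
  case True
  hence "d = 1" using c by (simp add: crit_ok_def)
  thus ?thesis using crit_sound_trivial by blast
next
  case False
  have abd: "0 < a" "0 < b" "0 < d" and a: "100 * (1 - (2 * K - 1) * f) \<le> real_of_int a"
    and b: "10000000 * (K * f) \<le> real_of_int b"
    and d: "real_of_int d \<le> 10000000 * (1 - f * (K - 1)
       - (1 / 18 + 1 / 50 + 1 / 98 + 1 / 27 + 3 / 2 * e + 2 / 3 * h) / \<theta>)"
    using c False by (simp_all add: crit_ok_def)
  have \<kappa>: "1 \<le> \<kappa>" "real_of_int B \<le> \<kappa> ^ 25" and s: "0 < s" "s\<^sup>2 \<le> real_of_int A" "0 < s / (4 * \<kappa>) - 1 / s"
    "1 / (s / (4 * \<kappa>) - 1 / s) \<le> e" and s': "0 < s'" "real_of_int B \<le> s'\<^sup>2" "e - 1 / s' \<le> f" and f0: "0 \<le> f"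
    and m: "0 < m" "m\<^sup>2 \<le> real_of_int A / (4 * \<kappa>) - 1" "1 / m \<le> h" and A8: "8 \<le> real_of_int A / (4 * \<kappa>)"
    using iv by (simp_all add: interval_ok_def)
  define x where "x = real p"
  have xA: "real_of_int A < x" and xB: "x \<le> real_of_int B" using A unfolding x_def by linarith+
  have x2: "x > 2" using A xA by linarith
  define M where "M = nat \<lfloor>x / (4 * \<kappa>)\<rfloor>"
  have q_ge: "real_of_int A / (4 * \<kappa>) \<le> x / (4 * \<kappa>)" using xA \<kappa> by (intro divide_right_mono) auto
  have M_le: "real M \<le> x / (4 * \<kappa>)" unfolding M_def using x2 \<kappa> by (intro of_nat_floor) auto
  have M_gt: "real M > x / (4 * \<kappa>) - 1" unfolding M_def using q_ge A8 by linarith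
  have M7: "M \<ge> 7" using M_gt q_ge A8 by linarith
  have bound: "4 * real M \<le> real p powr 0.96"
  proof -
    have "x powr 0.04 \<le> (\<kappa> ^ 25) powr 0.04" using xB \<kappa> x2 by (intro powr_mono2) auto
    also have "(\<kappa> ^ 25) powr 0.04 = (\<kappa> powr real 25) powr 0.04"
      by (subst powr_realpow) (use \<kappa> in auto)
    also have "\<dots> = \<kappa> powr (real 25 * 0.04)" by (rule powr_powr)
    also have "\<dots> = \<kappa>" using \<kappa> by simp
    finally have "x powr 0.04 \<le> \<kappa>" .
    hence "x / \<kappa> \<le> x / x powr 0.04" using x2 \<kappa> by (intro divide_left_mono mult_pos_pos) auto
    also have "\<dots> = x powr 0.96"
    proof -
      have "x powr (1 - 0.04) = x powr 1 / x powr 0.04" by (rule powr_diff)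
      thus ?thesis using x2 by simp
    qed
    finally have "x / \<kappa> \<le> x powr 0.96" .
    moreover have "4 * real M \<le> x / \<kappa>" using M_le \<kappa> by (simp add: field_simps)
    ultimately show ?thesis by (simp add: x_def)
  qed
  have sx: "s \<le> sqrt x" using s xA by (intro real_le_rsqrt) linarith
  have e_ge: "sqrt p / M \<le> e"
  proof -
    have mid: "s / (4 * \<kappa>) - 1 / s \<le> sqrt x / (4 * \<kappa>) - 1 / sqrt x"
      using sx s(1) \<kappa> x2 by (intro diff_mono divide_right_mono divide_left_mono mult_pos_pos) auto
    have "sqrt x / M = 1 / (M / sqrt x)" by simp
    also have "\<dots> \<le> 1 / (s / (4 * \<kappa>) - 1 / s)"
    proof (intro divide_left_mono mult_pos_pos)
      have "sqrt x / (4 * \<kappa>) - 1 / sqrt x = (x / (4 * \<kappa>) - 1) / sqrt x"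
      proof -
        have "x / (4 * \<kappa>) / sqrt x = (x / sqrt x) / (4 * \<kappa>)" by simp
        also have "x / sqrt x = sqrt x" using x2 by (intro real_div_sqrt) simp
        finally show ?thesis by (simp only: diff_divide_distrib)
      qed
      also have "\<dots> \<le> M / sqrt x" using M_gt x2 by (intro divide_right_mono) auto
      finally show "s / (4 * \<kappa>) - 1 / s \<le> M / sqrt x" using mid by linarith
    qed (use s M7 x2 in auto)
    finally show ?thesis using s(4) by (simp add: x_def)
  qed
  have f_ge: "sqrt p / M - 1 / sqrt p \<le> f"
  proof -
    have "sqrt x \<le> s'" using s' xB by (intro real_le_lsqrt) auto
    hence "1 / s' \<le> 1 / sqrt x" using x2 s' by (intro divide_left_mono mult_pos_pos) auto
    thus ?thesis using e_ge s'(3) by (simp add: x_def)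
  qed
  have h_ge: "1 / sqrt M \<le> h"
  proof -
    have "m \<le> sqrt M" using m(2) M_gt q_ge by (intro real_le_rsqrt) linarith
    hence "1 / sqrt M \<le> 1 / m" using m(1) M7 by (intro divide_left_mono mult_pos_pos) auto
    thus ?thesis using m(3) by linarith
  qed
  have p2: "p > 2" using x2 by (simp add: x_def)
  show ?thesis unfolding crit_sound_def
  proof (intro allI impI)
    fix R assume Q: "prime_factors (p - 1) = E \<union> R" "E \<inter> R = {}"
      and sum: "2 + (\<Sum>r\<in>R. real_cost (crit_of (a, b, d)) r) \<le> real (nat_of_num (bound (crit_of (a, b, d))))"
    define G where "G r = 1 / real r + f * (1 / r + K * (1 - 2 / r))" for r :: nat
    have "10000000 * G r \<le> real_cost (crit_of (a, b, d)) r" if "r \<in> R" for r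
    proof -
      have "10000000 * G r = 100000 / real r * (100 * (1 - (2 * K - 1) * f)) + 10000000 * (K * f)"
      proof -
        have "10000000 * (y + f * (y + K * (1 - 2 * y)))
            = 100000 * y * (100 * (1 - (2 * K - 1) * f)) + 10000000 * (K * f)" for y
          by (simp add: algebra_simps)
        from this[of "1 / real r"] show ?thesis by (simp add: G_def)
      qed
      also have "\<dots> \<le> 100000 / real r * real_of_int a + real_of_int b"
        using a b by (intro add_mono mult_left_mono) auto
      finally show ?thesis using abd by (simp add: real_cost_def nat_of_num_of_int)
    qed
    hence "(\<Sum>r\<in>R. 10000000 * G r) \<le> (\<Sum>r\<in>R. real_cost (crit_of (a, b, d)) r)" by (rule sum_mono)
    moreover have "real (nat_of_num (bound (crit_of (a, b, d)))) = real_of_int d"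
      using abd by (simp add: nat_of_num_of_int)
    ultimately have "2 + 10000000 * (\<Sum>r\<in>R. G r) \<le> real_of_int d"
      using sum by (simp add: sum_distrib_left)
    hence "(1 / 18 + 1 / 50 + 1 / 98 + 1 / 27 + 3 / 2 * e + 2 / 3 * h) / \<theta>
        < 1 - f * (K - 1) - (\<Sum>r\<in>R. G r)" using d by argo
    hence main: "1 / 18 + 1 / 50 + 1 / 98 + 1 / 27 + 3 / 2 * e + 2 / 3 * h
        < theta E * (1 - f * (2 ^ card E - 1) - (\<Sum>r\<in>R. 1 / r + f * (1 / r + 2 ^ card E * (1 - 2 / r))))"
      using \<theta>(2) unfolding G_def K \<theta>(1) by (simp only: pos_divide_less_eq mult.commute)
    show "small_primroot p"
      by (rule small_primroot_criterion[OF p p2 bound M7 Q e_ge f_ge h_ge main])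
  qed
qed

lemma theta_2: "theta {2} = 1 / 2" and theta_23: "theta {2, 3} = 1 / 3"
  and theta_235: "theta {2, 3, 5} = 4 / 15"
  by (simp_all add: theta_def)

section \<open>Joining the intervals of the search\<close>

lemma search_interval:
  assumes "interval_ok A B \<kappa> s s' m e f h"
    and "crit_ok e f h 2 (1 / 2) c1" "crit_ok e f h 4 (1 / 3) c2" "crit_ok e f h 8 (4 / 15) c3"
    and "run_search A B c1 c2 c3 hs" and "prime p" "2 \<le> A" "A < int p" "int p \<le> B"
  shows "small_primroot p"
proof -
  obtain a1 b1 d1 a2 b2 d2 a3 b3 d3 where c: "c1 = (a1, b1, d1)" "c2 = (a2, b2, d2)" "c3 = (a3, b3, d3)"
    by (metis prod_cases3)
  show ?thesis
    by (rule run_search_sound[OF assms(5-9)]; unfold c;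
        rule crit_sound_interval[OF assms(1,6-9)])
       (use assms(2-4) c in \<open>auto simp: theta_2 theta_23 theta_235\<close>)
qed

definition small_primroots_upto :: "int \<Rightarrow> bool" where
  "small_primroots_upto B \<longleftrightarrow> (\<forall>p. prime p \<longrightarrow> int p \<le> B \<longrightarrow> small_primroot p)"

text \<open>This prime stands apart because the search takes 2 to be a factor of
  \<open>p - 1\<close>.\<close>

lemma small_primroot_2: "small_primroot 2"
proof -
  have "residue_primroot 2 1" by (simp add: residue_primroot_1_iff)
  moreover have "(1::real) < 2 powr 0.96" using powr_less_mono[of 0 "0.96" "2::real"] by simp
  ultimately show ?thesis unfolding small_primroot_def by (intro exI[of _ 1]) simp
qed

text \<open>With all criteria disabled the search must certify every even \<open>p - 1\<close> in
  range. This starts the chain where \<open>p\<close> is too small for the analytic estimates, which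
  need \<open>M \<ge> 7\<close>.\<close>

lemma search_exhaustive:
  assumes "run_search 2 B (1, 1, 1) (1, 1, 1) (1, 1, 1) hs"
  shows "small_primroots_upto B"
  unfolding small_primroots_upto_def
proof (intro allI impI)
  fix p assume p: "prime p" "int p \<le> B"
  show "small_primroot p"
  proof (cases "p = 2")
    case False
    hence "2 < int p" using prime_ge_2_nat[OF p(1)] by simp
    from run_search_sound[OF assms p(1) order_refl this p(2) crit_sound_trivial crit_sound_trivial crit_sound_trivial]
    show ?thesis .
  qed (simp add: small_primroot_2)
qed

text \<open>The error constants are uniform on an interval, so its ends must be close while the
  errors are large; later a ratio of about 4 does no harm.\<close>

lemma search_extend:
  assumes prev: "small_primroots_upto A" and "2 \<le> A" and "interval_ok A B \<kappa> s s' m e f h"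
    and "crit_ok e f h 2 (1 / 2) c1" "crit_ok e f h 4 (1 / 3) c2" "crit_ok e f h 8 (4 / 15) c3"
    and "run_search A B c1 c2 c3 hs"
  shows "small_primroots_upto B"
  unfolding small_primroots_upto_def
proof (intro allI impI)
  fix p assume p: "prime p" "int p \<le> B"
  show "small_primroot p"
  proof (cases "int p \<le> A")
    case False
    hence "A < int p" by simp
    from search_interval[OF assms(3-7) p(1) assms(2) this p(2)] show ?thesis .
  qed (use prev p in \<open>simp add: small_primroots_upto_def\<close>)
qed

section \<open>Primes up to 4000000000000\<close>

text \<open>The hints follow the order of the search, which begins with the set {2, 5, 7}:
  \<open>7\<close> is a primitive root modulo 71, \<open>-3\<close> records that 3 divides 141, and
  \<open>3\<close> is a primitive root modulo 281.\<close>

lemma search_2_500: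
  "run_search 2 500 (1, 1, 1) (1, 1, 1) (1, 1, 1)
    [7, -3, 3, -3, 2, -3, -13, -3, 2, -3, -3, -11, 19, -3, -3, 2, -3, 17, -7, -3, 7, -3, 2, -3, 7, -3, -7,
    -3, -3, 2, -3, 3, 11, -5, -3, -3, -5, 7, -3, -3, -17, -11, -3, -3, 2, -3, 3, -3, 3, -3, 2, -3, -7, -3,
    2, 5, -3, 3, -3, 3, -3, -5, 2, -3, -3, 2, -3, -11, -3, -3, -5, -3, 3, -3, -3, -7, -3, -5, 5, -3, -5, -3,
    2, -3, 3, -3, -3, -5, -3, -7, -3, 2, -3, 2, -3, -7, -3, 2, -3, -5, -3, -13, 2, -3, -5, -7, -3, -11, -3,
    -5, -3, -3, 2, -11, -3, -3, 2, -3, 2, 5, -3, 2, -3, -3, 2, -7, -3, -3, -7, -5, -3, -3, -19, 2, -3, -3,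
    5, -5, -3, -13, -3, -3, -3, -5, 2, 7, -3, 5, -3, -5, -3, -3, -3, -5, -3, 2, 13, -3, 2, 2, -3, 3, -3, -5,
    -3, 3, 3, 3, -5, -13, 19, 3, -11, 2, -5, 2, -7, -5, 3, 5, 3, 5, 17, -5, -7, 5, -5, 29, 5, -5, 7, 13, -7,
    2, 5, -5, -5, 2, -11, 2, 3, -5, -13, -17, -7, 3, -11, -5, 11, -13, -7, 17, -5, 7, 3, 2, -5, -7, 5, 5,
    -5, 2, 2, 5, -5, -17, -5, 11, -7, 5, 2, -5, 3, 2, 2, 3, -17, 3, 2, -11, 7, -13, -7, 2, -19, 43, 7, -7,
    -11]"
  by code_simp

lemma small_primroots_upto_500: "small_primroots_upto 500"
  by (rule search_exhaustive[OF search_2_500])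

text \<open>All budgets are still 1 here. A budget above 1 appears for {2} from 1300 on, for {2, 3}
  from 5200 on and for {2, 3, 5} from 28000 on.\<close>

lemma search_500_700:
  "run_search 500 700 (41, 3944400, 1) (1, 7888800, 1) (1, 15777600, 1)
    [-3, -19, 3, -3, -3, -7, -3, -3, -3, -13, -11, 3, -3, 3, -13, -3, -3, -5, -3, 2, -3, -3, -3, -3, 5, 7,
    2, 5, -5, -3, -3, 3, -3, -13, -3, 3, -3, -3, -5, 2, -3, -3, 2, -3, -5, -17, 2, -3, -3, 5, -5, -17, -7,
    -3, -3, 2, -3, 2, -3, -7, -3, -5, -3, -3, -5, -3, -3, 2, 5, -5, -19, -23, -5, -5, 2, -5, -7, -17, 2,
    -13, -23, -11, -5, -7, -5, -11, 3, 2, 11, -5, -7, 5, -11, 3, 2, -7, 3, 3, 2, 7]"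
  by code_simp

text \<open>The constants round the true values to the safe side: 1.3^25 is about 705,
  \<open>559 / 25\<close> lies just below the root of 500 and \<open>1323 / 50\<close> just above
  the root of 700. The later intervals follow the same pattern.\<close>

lemma small_primroots_upto_700: "small_primroots_upto 700"
  by (rule search_extend[OF small_primroots_upto_500, where \<kappa> = "13 / 10" and s = "559 / 25" and s' = "1323 / 50" and m = "97 / 10"
      and e = "23501 / 100000" and f = "9861 / 50000" and h = "1031 / 10000", OF _ _ _ _ _ search_500_700])
    (simp_all add: interval_ok_def crit_ok_def power_divide)

lemma search_700_979:
  "run_search 700 979 (50, 3377800, 1) (1, 6755600, 1) (1, 13511200, 1)
    [-3, 17, 2, 3, -23, 7, -3, -3, -3, 2, -3, 2, -3, -17, -7, -3, -3, 11, -3, -3, 3, -3, -11, 5, 2, -3, -3,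
    -3, -5, -7, -3, -5, -3, 2, -3, -3, -3, -5, -3, -3, -7, -3, -5, -3, -11, 3, -3, -3, -3, 3, -23, -3, 3,
    -3, 3, -3, -5, -3, -5, -3, 2, -3, 2, -5, -19, -3, -7, -3, -3, -5, -7, 11, -3, -3, -3, -13, -19, -3, -11,
    -3, 11, -3, 5, -3, -3, 5, -29, -3, -13, -3, -5, -7, -3, -5, -5, -17, 5, 2, 2, 2, -13, 5, 5, -19, -19, 7,
    -11, 2, -5, -7, 3, -5, -7, -5, 2, 7, -5, 2, 2, -13, -7, 2, 3, -5, -5, 2, -23, -11, 11, -5, -7, -29, -11,
    -13, -7, -31, -7, 3, -17, 3]"
  by code_simp

lemma small_primroots_upto_979: "small_primroots_upto 979"
  by (rule search_extend[OF small_primroots_upto_700, where \<kappa> = "659 / 500" and s = "529 / 20" and s' = "3129 / 100" and m = "57 / 5"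
      and e = "5021 / 25000" and f = "16889 / 100000" and h = "2193 / 25000", OF _ _ _ _ _ search_700_979])
    (simp_all add: interval_ok_def crit_ok_def power_divide)

lemma search_979_1300:
  "run_search 979 1300 (57, 2873400, 1) (1, 5746800, 1) (1, 11493600, 1)
    [-3, -19, -3, -3, -7, -3, 17, -3, -17, 2, 7, -3, -3, 37, -3, 2, -3, -31, -3, -7, -3, -3, -13, -3, -3,
    11, -17, -3, -5, -5, -3, -3, 5, -29, -5, 3, 2, -3, -3, -3, -23, -3, -11, -3, 5, -3, -3, -5, 2, -3, -13,
    5, -3, 3, -3, -3, -3, -29, -3, -7, -5, -3, 3, 3, -3, 3, -3, -3, -3, -3, -3, -3, -5, 2, -3, -11, -3, 2,
    -3, -7, -3, 5, -3, -19, 2, -7, -3, -3, -3, -5, -7, -17, -3, -3, -5, 2, -11, -3, -3, -3, -5, -3, -3, 2,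
    -3, -5, -5, 5, -23, 11, -5, -11, 2, -5, -7, -29, 7, -5, -5, -13, -5, -11, -5, 2, -5, 5, 11, -19, 3, -7,
    -17, 3, 7, 7, -5, 2, 2, -5, -17, 3, -5, 3, -31, -19, -7, -5, -7, 5, 17, -13, 7, 7, 2, 31, -7, -11, 3, 2,
    -23, 11]"
  by code_simp

lemma small_primroots_upto_1300: "small_primroots_upto 1300"
  by (rule search_extend[OF small_primroots_upto_979, where \<kappa> = "1333 / 1000" and s = "782 / 25" and s' = "1803 / 50" and m = "67 / 5"
      and e = "857 / 5000" and f = "14367 / 100000" and h = "7463 / 100000", OF _ _ _ _ _ search_979_1300])
    (simp_all add: interval_ok_def crit_ok_def power_divide)

lemma search_1300_1900:
  "run_search 1300 1900 (62, 2556400, 877199) (11, 5112800, 1) (1, 10225600, 1)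
    [-23, -3, -11, -3, -3, -17, -3, 19, -3, 2, -19, 3, -3, -3, -7, 2, -3, 3, -3, -3, 3, -3, -3, -7, -3, -3,
    -11, -13, -3, -3, -13, -3, 11, 2, -7, -3, -3, -3, 41, 3, -3, -31, 2, -3, -5, -3, -3, -3, -3, 3, 2, -3,
    -5, -3, 2, -3, 5, -3, -5, -11, -3, 2, -3, -7, -3, -3, -5, -3, -17, -5, -3, 5, -37, -3, 3, -29, -3, 3,
    -7, -5, -3, -3, 5, -3, -3, -3, -5, -3, -7, -3, -3, -3, -3, 19, -3, 2, -5, -3, 2, -13, -3, -3, -7, -3,
    -3, -13, -3, -5, 3, 3, -3, -3, 3, -3, -17, -3, -5, -3, -3, -7, -5, 3, -3, -11, -3, -19, -3, -3, -3, -23,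
    -3, -5, -5, -19, -3, -11, -3, -3, -13, 2, -37, -3, -3, -7, -3, 2, -3, -5, -3, 2, -7, -3, -3, -31, -3,
    -17, -3, 2, 13, -3, -3, -5, 5, -3, -23, -3, 7, -3, -3, -3, 5, -3, -3, 2, -3, -7, -3, -5, 2, -3, -31, -3,
    -5, -3, -23, -3, -5, -3, -11, -3, -41, -3, -5, -3, 5, -3, -11, -3, -7, -5, -43, -19, -11, 11, 11, 7, -5,
    3, -13, -5, -17, -5, -17, -7, -5, 11, 2, 3, 2, -5, 37, -5, -23, -11, -5, -5, -37, 11, -7, 3, 29, -5, 5,
    -31, -7, 2, 2, -13, -5, 7, -5, 7, -5, -7, 3, -5, -7, 2, -17, -5, -7, -23, -5, -11, -5, 2, 19, -7, -5,
    -13, -29, -5, 13, -5, 3, -11, 5, 3, -5, 3, 3, -7, 3, 7, -19, 2, 11, -29, -7, 3, -41, -31, 7, 13, -13,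
    -7, 2, -29, 2, 2, 2, -17, -37, -7, 3, -11, 2, 11, -7, -19]"
  by code_simp

lemma small_primroots_upto_1900: "small_primroots_upto 1900"
  by (rule search_extend[OF small_primroots_upto_1300, where \<kappa> = "1353 / 1000" and s = "721 / 20" and s' = "4359 / 100" and m = "77 / 5"
      and e = "3769 / 25000" and f = "6391 / 50000" and h = "3247 / 50000", OF _ _ _ _ _ search_1300_1900])
    (simp_all add: interval_ok_def crit_ok_def power_divide)

lemma search_1900_2600:
  "run_search 1900 2600 (69, 2130200, 1974866) (26, 4260400, 1) (1, 8520800, 1)
    [3, -3, -13, 7, -3, -37, -3, -3, 2, -31, -3, -3, -7, 3, 2, -3, -11, -3, -7, -3, 13, -3, -3, 11, -3, -43,
    -3, 2, -3, -7, -3, -3, 2, -3, -11, 7, -23, -3, -29, -3, -3, 17, -3, -3, -13, -3, -41, 5, -5, -3, 2, -3,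
    -3, 3, -3, -5, -3, 5, -3, -3, -5, 2, -3, -3, -19, -3, 5, -3, -3, -3, 2, 5, -23, -3, -3, -3, -3, 2, 2,
    -7, -3, -5, -3, 2, -3, 11, -3, -13, -3, 3, -5, -3, 2, -3, -3, -17, -5, -3, -5, 2, -3, -3, -3, -5, -43,
    -3, -13, -7, -3, -3, 2, -5, 2, -3, -3, -3, 2, -3, -3, -29, -19, -3, -5, -3, 5, -5, -3, -23, -3, -3, 3,
    -3, -3, -19, -3, -3, -5, -3, 3, -7, 3, -3, -7, -11, -5, 3, -3, -3, -13, -3, -5, -3, -19, -3, -43, -3, 2,
    -3, 2, -3, -3, -3, -7, -5, -11, -3, -3, -3, -5, 2, -3, -3, -3, -5, -7, -11, -3, 2, -5, -3, -31, -3, 2,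
    -3, -29, -5, -7, -3, -3, -3, 2, 7, -3, 5, -3, -3, 2, -3, -11, -3, -3, -3, -37, -3, -5, 5, -7, -3, -3,
    -3, -7, -3, -13, -3, -17, -5, -7, -3, -3, -5, 5, 2, -3, -3, -3, -11, -5, -3, -17, 2, -3, -3, -5, 3, -5,
    5, 2, -5, -17, -37, -11, 5, 2, -13, -29, -5, -5, -13, -5, -23, -7, 5, 5, 7, -31, -41, -11, -7, 2, -7, 3,
    -31, 2, -11, -47, -5, 7, -7, 3, -11, -5, -5, -23, -37, 2, -5, -23, -5, -13, -19, 2, 5, 23, -17, -5, 5,
    -7, -41, -13, -5, 19, -7, 2, 3, -19, -5, -31, -7, -41, 2, -7, -5, 2, -17, -11, 2, -7, 2, -5, -13, -5, 5,
    3, -5, -11, -5, 5, -29, -5, -5, -7, -13, -23, -5, 7, -5, 3, 17, -11, -7, 7, 3, -13, 19, 7, -19, 2, -23,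
    -29, 3, 2, -7, 2, -47, -17, 23, -11, -7, 7]"
  by code_simp

lemma small_primroots_upto_2600: "small_primroots_upto 2600"
  by (rule search_extend[OF small_primroots_upto_1900, where \<kappa> = "137 / 100" and s = "2179 / 50" and s' = "51" and m = "37 / 2"
      and e = "12611 / 100000" and f = "10651 / 100000" and h = "2703 / 50000", OF _ _ _ _ _ search_1900_2600])
    (simp_all add: interval_ok_def crit_ok_def power_divide)

lemma search_2600_3700:
  "run_search 2600 3700 (73, 1857000, 2716899) (36, 3714000, 1) (1, 7428000, 1)
    [-3, -11, -3, 19, -3, 2, -3, 3, -3, -47, 2, 11, -3, -7, -3, -3, -3, 23, -3, -3, -3, -19, -7, 3, -23, -3,
    -3, -7, -3, -17, -3, -11, -13, -3, -7, -3, -3, -53, -23, -3, -29, -3, -3, 2, 2, -3, -11, -3, -3, -3,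
    -13, 2, 2, -3, -3, -3, 7, -17, -3, -19, -3, -37, -3, -31, -3, -7, 2, -3, 2, -3, -3, 13, -3, -3, 5, -3,
    3, -5, -3, -3, -3, -3, 2, -23, -3, -3, 3, 3, -5, -3, -11, -3, -5, -3, -43, -3, 2, -3, -5, -3, -31, -3,
    -3, -3, -11, -3, -13, 2, -3, -5, -59, -29, -3, 3, -3, -3, -41, -3, 3, 3, -3, -3, -3, -5, -3, -3, -13,
    -5, -3, -3, -7, -3, 2, -5, -17, -3, -3, -7, -3, -3, -3, -19, -5, -3, -37, -3, -11, -3, 2, -3, 5, -7, -3,
    -3, 2, -3, -23, -5, 5, -3, -3, 2, -3, -31, -3, -13, -29, -3, -7, -3, 2, -3, -3, -5, -17, -3, -17, -3,
    -3, -3, -7, 2, -3, 11, -5, -3, -3, -3, -3, 2, -3, -5, -19, 2, -5, -3, -7, 5, 5, -47, -5, -29, 11, -31,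
    -13, -5, -5, 11, -5, 2, -5, -19, 2, 31, -11, 19, -5, -41, 17, 3, 5, -7, 2, 2, -17, -29, 2, 7, -5, -5,
    -7, -5, -37, 5, -7, -5, -19, -53, -17, -11, 3, -5, 5, -5, 2, -43, 2, -5, -41, -7, 13, 11, -5, -5, -13,
    -13, -17, -11, -5, 13, -19, -5, -7, 5, 2, -29, -5, 5, -7, -7, -5, -11, -5, -7, -5, -7, 2, 5, 5, 11, -5,
    -11, -47, -7, 2, -5, 3, -11, -5, -31, -5, -11, 3, -19, -5, 2, 3, 2, -5, 13, 2, -19, -11, -23, -5, -7,
    11, 2, -5, 5, -43, 2, -5, -5, 2, -5, -13, 3, -7, 2, -5, -37, -7, -5, 2, -5, -53, -43, -17, -7, 5, -31,
    -5, -23, 3, -13, 3, -5, 5, 2, -13, -7, 7, 5, 3, 2, 31, -23, -17, -19, 11, 17, 31, 7, 7, 13, -11, 2, -11,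
    -7, -59, -7, 53, 3, 2, -7, 7, 7, -7, 7, -41, -7, -11, -13, 3, 3, -43, -7, -13, -37, 23]"
  by code_simp

lemma small_primroots_upto_3700: "small_primroots_upto 3700"
  by (rule search_extend[OF small_primroots_upto_2600, where \<kappa> = "139 / 100" and s = "5099 / 100" and s' = "6083 / 100" and m = "43 / 2"
      and e = "683 / 6250" and f = "1857 / 20000" and h = "1163 / 25000", OF _ _ _ _ _ search_2600_3700])
    (simp_all add: interval_ok_def crit_ok_def power_divide)

lemma search_3700_5200:
  "run_search 3700 5200 (77, 1579000, 3447333) (45, 3158000, 1) (1, 6316000, 1)
    [2, -3, -3, -31, -3, -3, -3, -3, 7, 2, -3, -19, 3, -3, -13, -3, -37, -3, -3, -13, -3, 2, -3, -47, 3, -3,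
    -3, -29, -17, -3, 13, 11, -3, -3, -3, 19, -43, -3, -11, 2, -3, -11, 3, -3, 3, 7, -3, -3, -7, 2, 13, -3,
    -3, 2, -13, -3, -3, -7, -3, 3, 3, -3, -7, -3, -3, -3, -19, -3, -59, -7, -3, 3, -53, -7, -17, -3, -3,
    -11, -3, 2, -3, 7, -3, -61, 17, -3, -3, -7, -3, -11, -3, -3, 11, -3, -7, -3, -3, -3, -3, -5, -3, -19,
    -53, -3, 5, 5, -13, -3, -3, -5, -3, 5, -3, -5, -3, 2, 3, -3, -17, -5, -3, -41, -3, -3, 3, -5, -3, -17,
    -3, 2, 2, -5, -3, -3, -3, -37, 5, -3, -3, -5, -3, -11, -3, -5, -3, -23, -3, -3, -43, -3, 7, -11, -3, -3,
    -23, 7, -5, -3, 3, -5, -5, -3, -3, -3, 2, -3, -5, -3, -17, -3, 2, -3, -3, -7, -3, -31, -3, -29, 5, -7,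
    -3, 11, -3, -59, -3, -3, -5, -3, 3, 2, -7, -3, -3, -5, -5, -3, -3, -3, -43, -11, -5, -3, 5, -3, -47, -3,
    -3, -3, 3, -7, 2, -3, -3, -11, -3, -11, -3, -7, -3, -3, -29, -3, -5, 3, -3, -3, -3, 2, -11, -11, -3, -7,
    -3, -5, -3, -13, -7, -3, -5, 2, -3, -3, 5, -3, -7, -3, -5, -3, -3, -67, -3, -13, -3, -5, 5, -3, -3, -13,
    -3, -3, -3, -7, -3, -3, 2, 2, -11, -3, -3, -3, -3, -3, 2, -13, -47, -5, -3, 3, -13, -17, -5, 3, -5, 3,
    2, -5, -11, 2, 3, 13, -11, -61, 2, -5, 7, -5, 2, 3, -5, -19, -47, -37, -13, -5, -23, -19, -67, -29, -53,
    -5, -7, 2, -5, -5, 3, 3, -43, -61, -5, -7, 2, -23, 3, -5, -7, -5, 2, 3, 5, -5, -11, 5, 2, -13, -5, -47,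
    -41, -5, -59, 2, -5, 3, -5, -7, 2, -11, 2, -7, 11, 3, 5, -37, -7, -5, 3, -7, -31, -43, 13, -5, 7, 2, -7,
    -11, -7, -23, -5, 19, -5, 3, 5, -17, -5, 2, 5, -11, 23, -13, -5, 2, -11, 2, -5, -13, -17, -53, 2, -5, 7,
    -7, -19, 5, 5, -5, -5, -41, 17, -17, -5, -29, -5, -61, -7, -5, -13, 11, 3, -7, -5, -29, -7, 2, 2, -5, 2,
    -13, -5, -29, -5, -5, -59, -19, -31, -5, -11, 7, 5, -7, -5, 2, 13, -47, -31, -7, 7, -7, -5, -7, 5, -17,
    -11, 3, -5, 13, -7, -17, 2, -11, -7, -5, -5, 2, -53, -5, -7, 2, -7, 3, -5, 3, 2, 11, -5, -31, -13, -11,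
    -7, -5, -5, 3, -37, -5, 2, -11, -5, 11, -5, 2, -13, 3, -71, -19, 11, -11, -7, -17, 7, -31, -47, -11, -7,
    11, 11, 11, -7, -41, -19, -61, 3, 43, -7, -13, -7, 3, -13, 2, 2, -13, -11, -17, -37, 2, 17, -43, -17,
    -23, -7, -67, 2, -29, -23, -29, 11, 7, 17, -7, -11]"
  by code_simp

lemma small_primroots_upto_5200: "small_primroots_upto 5200"
  by (rule search_extend[OF small_primroots_upto_3700, where \<kappa> = "1409 / 1000" and s = "3041 / 50" and s' = "1803 / 25" and m = "51 / 2"
      and e = "9281 / 100000" and f = "1579 / 20000" and h = "1961 / 50000", OF _ _ _ _ _ search_3700_5200])
    (simp_all add: interval_ok_def crit_ok_def power_divide)

lemma search_5200_7300:
  "run_search 5200 7300 (80, 1352000, 4045999) (53, 2704000, 54999) (1, 5408000, 1)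
    [-61, -3, -3, -23, -11, -17, -3, -3, 2, -3, 29, 13, -3, -3, 7, -3, 2, -3, 3, -3, -3, 7, -3, -19, -7, 2,
    -3, -3, 2, -3, 3, -3, 11, -3, -3, -7, -3, 3, -7, -3, -3, 2, 3, -3, -3, -3, -43, -79, -3, -3, -7, -3, -3,
    -11, 3, -3, -3, -31, -3, -7, -3, -3, 2, -3, 2, -13, -3, -3, -3, -29, 3, 11, -3, 2, -3, -3, 17, -3, -13,
    -67, -3, -3, -7, -11, 13, -3, -3, -3, -13, 2, 3, -3, -3, -7, -3, 3, -3, 3, -3, -17, -3, -3, -11, -3,
    -23, -43, -3, 7, -7, 7, -3, -3, -3, 19, -29, -3, -3, -3, 2, -13, 2, -3, -41, 7, -3, -59, -3, -3, -3,
    -11, -53, -3, -3, 7, -3, -7, -3, -11, 3, -3, -5, -41, -3, -37, -3, -3, -3, 2, 7, -3, -3, -5, -3, -3, -5,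
    -29, -73, -3, -3, -59, 2, -5, -3, -7, -3, 3, -5, 2, 11, -31, -29, 3, -5, -11, -37, -11, 2, 17, 5, -83,
    -5, 3, 2, 7, -13, -5, 5, 2, -19, -5, 3, -5, 11, -11, 3, -5, -41, -5, -13, -19, -23, -5, 5, -67, -5, -5,
    2, 19, 11, -7, 5, -7, -5, 5, -5, 3, -5, -19, -59, -13, -7, -5, 19, 7, 3, -37, -5, -5, -7, 17, -7, -11,
    -5, -23, 2, 2, 2, -29, -5, 3, -5, -53, -41, -71, -5, -5, 3, -61, -5, 3, -13, -7, -5, 2, 7, -7, -7, -11,
    -5, -17, 2, -23, 5, -7, -5, 5, -13, -47, -67, 2, -5, -13, -5, -7, -5, -47, -5, 13, -5, 2, 7, -37, -73,
    -5, -73, -5, -5, -7, -11, 5, -7, -5, -5, 2, 7, -11, -7, 2, -17, -43, -7, 11, -43, -13, -5, -13, -7, -5,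
    2, 2, 13, -7, -5, -17, -7, -19, -19, -5, 5, 5, -23, -5, -11, 5, 5, 2, -7, 2, -5, -7, -13, 2, -41, -5,
    -53, 7, -23, -7, 5, -5, -5, -31, -59, -11, -5, -61, -5, 11, -13, -5, 5, -11, -5, -13, -59, 2, 5, -61,
    -5, -23, 3, -5, 3, -5, -47, -7, 2, -11, -13, -17, -5, -11, 2, -5, 2, -5, -71, -53, 5, -41, -13, 2, -43,
    -5, -5, -29, 2, -7, -5, -5, -11, -7, 5, -5, -19, -17, -7, 5, 2, -7, -5, -5, 5, 3, 2, -7, -7, 2, -11,
    -17, -19, -31, -5, 17, -5, -11, -23, 3, -5, -5, -7, 3, 2, -5, -11, 2, -7, -29, 2, -5, 5, -23, -5, 2,
    -11, -7, 2, -19, -17, 3, 3, -29, -29, -43, -37, 7, -17, -11, -53, 17, -59, 31, -31, 11, 7, -13, -7, -53,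
    -19, -79, -7, 2, 7, 31, 2, 11, 2, -67, 13, -23, 19, 11, -7, 3, 3, 53, -11, 19, -73, -47, -17, -37, -7,
    3, -13, -7, 17, -11, -7, 17, -31, 2, -41, 3, -11, 7, -23, -7, -13, 2, -7, 3, 31, -71, -7, -7, 7, -23,
    -19, -11, -17, -43]"
  by code_simp

lemma small_primroots_upto_7300: "small_primroots_upto 7300"
  by (rule search_extend[OF small_primroots_upto_5200, where \<kappa> = "357 / 250" and s = "7211 / 100" and s' = "1709 / 20" and m = "301 / 10"
      and e = "793 / 10000" and f = "169 / 2500" and h = "3323 / 100000", OF _ _ _ _ _ search_5200_7300])
    (simp_all add: interval_ok_def crit_ok_def power_divide)

lemma search_7300_10000:
  "run_search 7300 10000 (83, 1155400, 4557966) (60, 2310800, 970399) (14, 4621600, 1)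
    [-3, -43, -19, 3, -3, 7, -83, -3, 29, -41, -11, -3, -3, 2, -3, -13, -3, -17, -3, -3, -37, -3, -3, 13,
    -3, 7, -3, -3, -7, -3, 3, -3, -73, -3, -3, -23, 11, -13, -3, -3, -41, 2, -3, -3, -3, -7, -31, -3, 2,
    -53, -3, -3, -3, -3, -61, 2, 2, -3, 2, -3, -3, 7, -3, -3, 3, 2, -3, -3, -3, -5, -3, -17, -3, -5, -11,
    -3, -47, 5, -3, -5, -3, -3, -3, -67, -5, -3, 2, -7, -3, -37, -5, 11, 5, 19, -31, 2, 5, 11, -5, -11, -13,
    -61, -59, -5, -5, 19, 5, -13, -5, -5, -53, -5, -23, -5, 11, 2, -23, 3, -5, 2, -29, -5, -17, -89, 19,
    -11, -73, 2, -71, -11, -5, -13, 3, -17, -5, 2, 3, -5, -43, -97, -17, 37, 3, 23, -47, -5, 17, -13, -5,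
    13, -17, -23, -5, -41, 2, 2, -5, -7, -23, 2, -83, 3, 3, -5, -5, 3, -7, -5, 5, -7, -73, 5, 7, -17, -7,
    -5, 19, 2, -5, -31, -7, 3, -5, -17, -11, -5, 2, -5, 7, -5, -7, 3, 31, -5, -5, -53, 2, -5, -31, -43, -11,
    3, 2, -7, -5, -7, -5, 3, 3, -7, -11, 2, -5, 7, -5, -7, 3, 3, 7, -5, -5, -5, -43, -5, -17, 3, -7, -41,
    -11, -19, -29, -89, -7, 2, -23, 5, 2, -29, -19, -7, 2, 11, 23, 2, 5, -5, 5, -17, -23, -7, -5, -5, -17,
    -31, -29, -11, -5, 2, 7, 2, -5, -5, -7, -13, -5, -5, 2, -67, 11, -11, 5, -5, -47, -79, -5, 5, -5, -7, 2,
    -13, -5, 7, -61, -5, 2, 5, -29, -5, 5, -13, -7, 13, -5, -53, -5, -7, -41, -71, -7, -11, -5, 19, -5, 2,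
    -7, -19, -17, -5, -11, 11, 7, -5, -11, -7, -5, 17, 7, 5, -37, -7, -23, -7, -11, -29, 5, -13, -5, 5, -37,
    -19, -11, 3, -5, -7, -5, -59, -19, -43, -5, -7, 3, -11, 3, -13, -5, -7, -83, -5, 3, -43, -7, -5, -17, 2,
    -7, 2, -5, -17, -11, 2, -41, -5, -7, 2, -47, -67, 17, -5, -19, -7, -37, 5, -5, 7, -11, 5, -5, -5, -7, 2,
    -59, -7, -5, 2, -67, -41, -5, -83, -13, -5, -5, -79, -5, 3, -5, -61, -43, -37, -7, -11, -5, 3, 5, 3,
    -13, -7, 3, -5, -5, 2, 2, -5, 3, -5, -19, 5, 3, -5, -7, 3, -11, 2, -5, -17, -5, 3, -13, 3, -47, -5, 3,
    -5, 3, -11, -5, -7, -7, -13, 2, -5, 3, -5, -71, -13, -11, -61, -17, 13, 17, -23, 2, -19, -79, -11, 3,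
    13, -31, -13, 2, 7, 7, 37, -17, -89, -7, 2, -37, 2, 2, -11, -29, -7, -11, 7, 2, -7, -13, -7, -17, -7,
    -41, -7, -7, -11, -71, -83, -97, -13, -11, 7, 23, -7, 13, -53, 7, 3, -11, 13, 23, -19, -7, -31, 43, 2,
    3, -73, 3, 3, 2, -7, 2, -19, 23, -13, 2, 19, -17, -11, -13, -7, -47, 3, 3, -7, -59, -61, -7, 3, 3, 23,
    17, 17, 7, 13, 29, 7, -13]"
  by code_simp

lemma small_primroots_upto_10000: "small_primroots_upto 10000"
  by (rule search_extend[OF small_primroots_upto_7300, where \<kappa> = "723 / 500" and s = "2136 / 25" and s' = "10001 / 100" and m = "71 / 2"
      and e = "847 / 12500" and f = "5777 / 100000" and h = "2817 / 100000", OF _ _ _ _ _ search_7300_10000])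
    (simp_all add: interval_ok_def crit_ok_def power_divide)

lemma search_10000_14000:
  "run_search 10000 14000 (85, 1004600, 4957633) (65, 2009200, 1682999) (25, 4018400, 1)
    [-3, -13, -3, 17, -3, 7, -3, -3, -47, -11, -3, 7, -3, -13, -3, -3, 3, -3, -3, -3, 2, -17, -3, -3, -11,
    -29, 7, -3, -3, -3, 29, -3, -59, -3, 2, -17, -7, -29, -3, -7, -3, -3, -3, -3, 13, -3, -41, -3, -79, -3,
    -31, -3, -43, -3, -3, -7, -3, -11, 7, 7, -3, -3, 2, -3, -7, -3, -3, -83, -23, -3, -7, -3, -3, 11, -3,
    -3, -103, -3, -3, -3, -67, -29, -3, -11, -3, -19, -73, -41, -3, -11, -3, -43, 11, -3, 2, -3, -5, -3,
    -73, -3, -17, -3, 5, -23, -3, -3, 11, -3, -3, -5, 2, 7, -3, -3, 2, -3, 2, -5, -3, -41, 5, 3, -13, -5,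
    -17, -5, -5, -19, -5, 5, 3, -5, 5, -61, -113, 5, 5, -5, -19, -11, 23, 13, -71, -11, -23, 5, -5, 2, -47,
    -5, -13, -19, -37, 17, -79, -5, -13, -5, 2, -5, -17, -11, 2, -97, -5, -47, -5, -17, 2, 11, -5, -11, 19,
    3, -53, -13, -5, 3, 3, 5, -5, -11, 3, -31, -5, 5, 2, -5, 3, 11, 5, -31, -59, -5, -53, 23, -7, -5, -5, 2,
    7, -79, 3, -5, -5, -13, -5, 2, -5, 7, 7, -7, -5, -7, -47, 3, 7, 5, -31, -5, -67, 5, -43, -7, -73, -19,
    -5, -13, -7, 2, 5, -5, -19, -19, -17, 13, -7, -103, -5, -71, 2, -5, -7, -5, -11, 5, -29, -17, -79, 5, 5,
    -11, -7, -5, -23, -5, -11, 5, -7, -59, 2, -37, -5, -7, -5, 3, -47, 2, -43, 3, -29, 5, -7, -13, 2, 3,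
    -11, 5, -5, 7, 3, -7, -5, 3, 5, -5, -7, -5, -11, -23, 5, -5, -17, -5, -23, -5, -7, -5, -11, -7, -73, 11,
    -5, 3, -11, -17, -13, -5, -7, -41, 13, -5, -7, 2, -11, 37, -5, 3, -5, -71, -11, -53, 7, -7, 7, 2, -79,
    2, -5, -89, -5, 3, -59, -7, -11, 2, -5, -5, -7, -11, -47, -37, -5, -59, -5, -19, -5, -7, 3, -29, 7, -19,
    -71, -31, -13, -7, -5, -7, -67, -5, -5, 2, -5, 7, -11, -5, 7, -107, 7, -5, -13, 5, -5, -5, 5, -5, 3, 7,
    2, -83, 7, -67, -11, 3, 79, -13, -29, 2, 29, -23, 11, -17, -11, 11, 2, -19, -101, -41, -61, -7, 37, -13,
    2, -7, -59, -109, -43, 2, -89, 3, -107, -7, 3, 23, 2, 3, 7, -47, -101, -41, -7, 23, -31, -13, 7, -61, 7,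
    -37, -11, 7, -53, -31, 7, -7, -7, -17, 3, 2, 7, -17, -7, -29, -7, 13, -13, -79, -7, -19, 2, 7, -17, -47,
    -7, 3, -11, -13, -7, -17, -47, 43, -103, -71, -7, -7, -13, -11, 3, 2, 3, -11, -7, -23, 2, -73, -37, 2,
    11, -11, 29, -53, -7, -11, 31, -29, -37, -7, 3, -7, -19, -83, 3, -11, -43, -53, -7, -13, -17, -67, -11,
    11, 2, -19, 11, 29, -29, -41, -13, -7, -29, -11, -23, 13]"
  by code_simp

lemma small_primroots_upto_14000: "small_primroots_upto 14000"
  by (rule search_extend[OF small_primroots_upto_10000, where \<kappa> = "733 / 500" and s = "100" and s' = "11833 / 100" and m = "206 / 5"
      and e = "1467 / 25000" and f = "5023 / 100000" and h = "607 / 25000", OF _ _ _ _ _ search_10000_14000])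
    (simp_all add: interval_ok_def crit_ok_def power_divide)

lemma search_14000_20000:
  "run_search 14000 20000 (88, 864600, 5327166) (70, 1729200, 2342299) (36, 3458400, 1)
    [-3, -89, 23, -3, -3, -3, 7, 11, -3, -3, 11, -3, -3, -109, -3, -3, -11, 7, -113, -3, 7, -3, -13, -3,
    -19, -73, -3, -79, -3, -71, -3, -13, -3, 3, 2, -3, 2, -67, -3, -17, -3, -3, 17, -3, -3, -3, -3, -61, 11,
    -3, -11, -3, 2, -3, -3, 2, -23, -3, -17, -3, 3, -3, 3, -3, 19, -3, -7, -31, -3, -5, -37, -23, -97, 5,
    -5, -19, 2, -5, 19, -5, -79, -5, -5, 7, -101, -11, -23, 11, 11, -11, 5, -13, 29, -5, -5, -107, -5, 3,
    -59, -13, 2, 19, -47, 2, -5, 2, -17, -11, 31, -5, -17, -109, -11, 5, -5, 2, -11, 2, -5, -5, 7, -29, 13,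
    -43, -19, -43, -71, -5, 5, 29, -5, -29, -13, -17, -61, -5, -5, -53, -73, 13, 2, -11, -5, -5, -31, -13,
    -73, -5, -11, 2, 2, -23, -5, -5, -107, 2, -17, -5, 2, 7, 5, 2, -5, 2, -41, 19, 5, -43, -13, 3, -23, 2,
    -5, -17, 3, -5, -127, -5, -31, -11, 5, -5, 3, 19, -29, -7, -5, -5, -43, -13, -5, -101, 7, 3, 5, -7, 7,
    -5, -7, 2, -13, 17, -7, -37, -5, -7, -5, -17, 5, -5, 5, -5, 3, 5, -7, -5, 2, -7, -5, 7, -5, -59, -13,
    -31, -41, 3, -5, -7, -5, 2, 3, 2, 3, -5, -31, -47, -17, 11, -83, -61, 23, -53, -43, -5, 2, 7, 5, 19, -5,
    3, -31, -67, 5, -5, -11, 2, -31, -5, -23, -41, -7, -5, 11, -5, -11, -7, 3, -37, -7, 2, 2, -5, -17, 2,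
    -7, -47, -5, -11, -19, -109, -5, 3, 37, -5, -103, -11, -7, -5, 2, -137, -7, 2, 2, -31, 13, -5, -127,
    -19, -7, -5, -11, -5, -53, -71, -7, -67, -7, -11, 7, -73, -5, -13, -5, -7, -19, -37, 2, 5, 29, -83, -67,
    -47, -7, -37, 13, -7, -5, 3, 7, 2, -5, 2, -5, 3, -5, 7, -13, 3, -5, -7, 3, -79, -11, -7, -109, 3, -5,
    -19, -11, 2, -5, -113, 2, 2, -5, 3, -7, -5, -17, -101, -7, 3, 3, -5, -19, -5, -11, -5, -11, -17, 3, -5,
    2, -43, -13, -7, -7, -17, -5, 2, -5, 3, -5, 2, 2, -7, -13, -5, -61, -5, -11, -19, 3, 2, 3, -5, -43, -53,
    3, 7, -5, -13, 2, -59, -7, -5, 2, -7, 2, -5, -29, -19, 13, -103, 2, -29, 19, 2, -11, -71, -139, -43,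
    -11, 13, 17, -17, 11, -19, 7, -13, 2, -47, 3, 3, 11, 2, -53, -41, -19, -13, -61, -131, 11, -13, -17, 2,
    -23, 3, 3, 11, -7, -71, 13, 2, -29, -13, -7, 2, 2, -7, 3, 23, -31, -23, -97, -19, 23, 3, 2, -7, 7, -7,
    -97, -113, -19, -7, -11, 19, -61, -41, -17, 17, -7, 3, 7, -31, -13, -59, 2, 11, -23, 11, -11, 19, -13,
    2, 11, -29, 3, -113, -37, 17, -59, 17, -11, 11, -7, -89, -31, -11, -7, 11, -13, -79, 7, -19, -7, -23,
    -67, 2, -11, -67, -37, -19, 3, 2, -109, 29, 3, -11, -7, -7, -83, -11, 11, 2, -79, -43, -41, -7, 7, 23,
    -83, -13, -31, -17, 3, -23, 7, -11, 3, -29, -7, 3, -7, 2, 2, 2, -7, -43, 7, -7, -11, -13, 2, 13, -13,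
    13, -7, -23, 11, 2, -7, -19, 37, -11, 2, 11, -7, -13, 3, 3, -17, -7, -43, -37, -7, -11, 3, 3, -13, 7,
    -53, -107, -7, -11, 11, -101, -7, -11, -17, -7, 7, -11, 13, -7, -7, 11, -17, -47, -7, -17]"
  by code_simp

lemma small_primroots_upto_20000: "small_primroots_upto 20000"
  by (rule search_extend[OF small_primroots_upto_14000, where \<kappa> = "1487 / 1000" and s = "2958 / 25" and s' = "14143 / 100" and m = "242 / 5"
      and e = "503 / 10000" and f = "4323 / 100000" and h = "2067 / 100000", OF _ _ _ _ _ search_14000_20000])
    (simp_all add: interval_ok_def crit_ok_def power_divide)

lemma search_20000_28000:
  "run_search 20000 28000 (89, 733400, 5666166) (75, 1466800, 2949199) (45, 2933600, 1)
    [3, -3, -137, -3, -41, -3, 7, -3, -3, 29, -83, -3, -3, -101, 3, 29, -13, -3, -37, -7, -3, -5, 2, -5,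
    -53, -127, -5, -47, 2, -67, -61, 43, 13, -29, 31, 2, 5, -89, -61, -53, -11, 11, -17, -5, -5, -43, 5, -5,
    -29, -73, -5, -11, 5, -11, 11, -29, -5, -5, 7, -11, 5, -17, -5, 2, -83, -23, -37, -5, -11, 5, -59, -5,
    2, 19, -5, 11, -29, 23, -5, 7, -103, 3, -47, -19, 5, 3, -5, -19, -5, -13, -5, 3, -167, -13, -23, -11,
    -137, -5, 2, -101, -5, -13, -19, -13, 5, -11, 5, -23, -13, -5, -19, -11, 7, -5, 3, -41, -83, -103, -5,
    -11, -17, -5, -5, 2, 17, -59, -5, 53, -5, 5, -151, -17, -5, 13, -31, -5, -11, -5, -41, 7, -37, 2, -79,
    -11, -31, -5, -5, -13, 2, -29, -5, -5, 2, -139, 2, -5, 2, -5, 7, -17, -13, -113, -5, 5, -89, 3, -149,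
    -67, 7, 5, 3, -7, 19, -131, -7, -19, -5, -5, 7, -47, 2, -107, -5, -103, -5, -43, -71, -31, 5, 19, -5,
    -5, -7, -13, 3, -5, -139, -5, -7, -13, 13, -17, 5, 7, -5, -71, -5, 2, -113, -5, 2, 3, 3, -17, -5, 5, -5,
    -41, 2, 5, -19, -73, -5, -109, -7, -23, -13, -73, -7, -7, -13, -37, -5, -23, -5, 3, -7, -5, -17, -5, 3,
    -7, -5, -5, -37, -5, -7, 2, 3, -23, -7, 11, -83, -5, 11, -7, -11, -5, -5, 5, -5, 7, -5, -53, -5, 5, 7,
    -157, -19, -7, -59, 37, -5, 5, -7, -23, -31, -107, -11, -5, -5, 5, -7, -59, 2, -137, -5, 3, -5, 3, 2,
    -17, -23, -5, -5, -7, -17, -5, -79, 3, -97, 2, -7, -5, -13, -5, -5, -79, -41, -5, -23, 13, -5, -7, 11,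
    5, -7, 3, -89, -5, -11, -5, -5, 2, -83, -37, 2, -13, -5, -19, -5, -53, 2, -23, -5, -7, 3, 2, -13, 2, -5,
    -139, -23, -7, -11, 3, 7, -5, 13, 5, 11, -5, -17, 5, -31, -5, -7, 3, -41, -7, -17, 2, -5, -31, -29, -5,
    5, -5, -5, 2, -37, -7, -5, 3, -7, 2, -101, -11, -5, -11, -7, -5, -13, -7, -5, 5, -13, -5, 3, 2, -5, 5,
    -7, -17, 3, 7, -11, -137, -19, -17, -13, 7, 11, 7, -23, -31, -67, -89, -17, 7, -17, 13, 3, -13, 2, -113,
    2, 11, -13, 2, -97, -23, -11, -19, -149, -11, 11, 13, -37, -11, 11, 2, -43, -47, 3, -11, 19, -19, 47,
    -7, -7, -7, 7, 2, -41, 13, 3, 7, -29, -7, 19, 7, 3, -17, -53, -23, -11, -11, -17, 2, 17, -7, 7, -37, -7,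
    3, -109, 7, -7, -17, -101, -29, -11, -7, 31, 11, 11, 19, -23, -59, -7, -19, -13, -7, 2, -127, -73, 7,
    11, -151, -113, 2, 23, 19, -11, -71, 29, -7, -127, -7, -11, -7, -13, -43, 3, -23, -13, 3, 2, 2, 7, -149,
    3, -7, -73, 7, -11, 7, -7, -17, -13, -13, -17, -11, -7, 17, -97, 13, 19, 11, -7, -41, -11, -83, -137,
    -73, -37, -41, -7, 29, -31, -11, -7, 17, -59, -7, -61, 13, -37, 2, 2, 7, -7, 3, -131, -29, 2, -7, -7, 3,
    -11, -7, -7, -13, -13, 3, 13, -11, -7, -19, 7, -19, -47, -11, 19, -7, 3, 17, 3, 7, 2, 13, -67, -7, -109,
    -19, 3, 3, -11, 3, -107, -7, 31, 3, 7, -23, -73, -47, -43, -59, -13, -19, 19, 7, -7, -17, -7, 13, -11,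
    -31, 7, -11, 11, -7, -19, -29, -17, -139, -13, -61, -19, -31, 2, 19, -89, -11, -17, 3, 2, 3, 2, -13,
    -17, 3, -7, -7, 73, -13, -29, 3, 2, -43, -7, 3, -157, -7, 2, -17, -83, 3, -59, -13, 17, -151, -79, -47,
    11, -7, 31, 7, -19, 43, -13, -7, 2]"
  by code_simp

lemma small_primroots_upto_28000: "small_primroots_upto 28000"
  by (rule search_extend[OF small_primroots_upto_20000, where \<kappa> = "1507 / 1000" and s = "7071 / 50" and s' = "8367 / 50" and m = "115 / 2"
      and e = "533 / 12500" and f = "3667 / 100000" and h = "87 / 5000", OF _ _ _ _ _ search_20000_28000])
    (simp_all add: interval_ok_def crit_ok_def power_divide)

lemma search_28000_39000:
  "run_search 28000 39000 (91, 629200, 5936533) (78, 1258400, 3432899) (53, 2516800, 768674)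
    [-29, -3, -3, -131, -3, 7, 2, -3, 2, -11, -3, 7, -3, -3, -3, -31, 11, 2, -89, -13, -71, -5, -179, -5, 3,
    -5, 5, -29, -17, -31, 17, -5, 11, -197, -13, 13, -5, -107, 3, -5, -11, -97, -43, -5, -19, 7, 5, -5, -5,
    5, -41, 23, -5, -5, 3, -37, -13, 5, 2, 2, -59, -5, 2, 3, 3, -5, 17, -5, 37, -11, -5, -5, 3, -31, -19,
    -83, -61, 5, -23, 3, -5, 3, 23, -5, 5, -13, -5, -139, -29, -11, -19, -17, -5, 2, 11, -5, -131, 37, -5,
    13, 11, -5, 17, 13, -5, -5, -17, -11, -37, -19, 5, -73, -5, -53, -5, -11, -157, -163, -5, -73, -43, 2,
    11, -5, 3, 5, -5, -5, -23, 2, 5, 5, -5, -17, -47, 13, -5, -23, -67, 13, -5, 2, -11, 2, -79, -5, -11, -5,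
    5, 3, -13, -31, -5, 3, -11, 7, -13, 3, -101, 2, -103, -19, -13, -53, 2, 5, -13, 5, -41, 2, -5, -17, -61,
    -5, -5, 2, 2, -11, 5, -13, -5, -19, -23, -5, 19, 3, 2, -97, -13, -5, -17, 7, -11, 3, -5, 2, 31, 2, -5,
    -5, -11, -23, 2, -13, -5, 2, -131, -11, -5, -109, -67, -5, 2, 3, -5, -5, -83, -11, 2, -5, -53, -127, -5,
    -17, -19, -5, -109, -13, -7, -5, -5, -61, 23, 2, -41, -5, 31, -7, 5, -7, -5, -5, -131, -19, -13, -5, -7,
    -5, -5, 37, -23, -89, 11, -11, -29, -5, -43, -59, -23, 2, 2, -181, -37, 7, -13, -11, -19, -137, 61, -17,
    -73, 23, 31, -37, -43, 13, 3, -11, -41, 3, 13, 3, 7, -107, -11, 2, 13, -71, -29, 2, 7, -13, -19, 11, 13,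
    -17, -47, 7, 2, 11, -13, 29, -103, 13, -17, 23, 13, -11, 3, -7, 3, -41, 2, -17, -107, -97, 3, 31, 3,
    -47, -7, -101, -67, 2, -7, -23, -7, 3, -19, 11, -13, -89, -13, -29, -7, -61, -113, -37, -31, 3, 7, -7,
    -53, 2, -19, -7, 23, -17, -61, -71, -11, 2, -103, 3, 17, 19, -7, -41, -11, 2, -29, -83, -7, -13, 37,
    -103, -11, 29, -53, 2, -7, -31, -7, 37, -71, -29, -79, -7, -59, 2, -13, -11, -181, -191, 2, -23, -11, 2,
    -19, 17, -7, 2, -11, -7, 11, 7, 7, 17, 3, -11, 7, -13, -13, -17, 17, -7, 7, -11, 7, -17, 2, -53, 2, 2,
    -7, -7, -61, -13, 3, -43, -11, 11, 3, -31, 13, -7, -127, -151, 13, -7, 2, -17, -29, -97, -11, -173, -23,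
    -89, -67, -7, -13, -7, -73, 7, -41, -179, -47, 2, -13, -157, -11, -13, -7, -167, -47, -19, -53, -13, -7,
    -11, -53, -7, -23, -7, -131, -71, -73, -13, -11, 19, -7, -59, -13, -23, -11, -7, -31, 17, -7, -7, -13,
    7, -29, -113, 2, -19, -31, -11, -17, 3, -7, -23, 2, 11, 3, -7, -23, 7, -19, -37, -19, -17, -13, 11, 13,
    -7, -7, 23, 11, -11, -109, -103, -31, -7, 7, -101, 107, -79, -17, -59, -7, 13, -157, 2, -11, -131, -43,
    -7, 11, 2, -7, -41, 2, -17, -79, 2, -7, -43, -7, -11, -23, -19, -11, 2, 2, -89, 11, -7, -127, 2, -7, 2,
    7, -13, 2, 13, -41, 2, 3, -7, 2, 3, -67, 2, 3, -7, -13, -7, 3, 3, -19, 3, 2, -17, -7, -11, 2, -139, 2,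
    -13, 3, -71, -11, 3, 3, -7, -23, -7, 17, -7, 3, -23, -19, -11, -149, -7, -137, -151, -29, 2, 37, 2, -17,
    -7, -107, -7, 43, -61, 31, -7, -167]"
  by code_simp

lemma small_primroots_upto_39000: "small_primroots_upto 39000"
  by (rule search_extend[OF small_primroots_upto_28000, where \<kappa> = "1527 / 1000" and s = "16733 / 100" and s' = "19749 / 100" and m = "338 / 5"
      and e = "913 / 25000" and f = "1573 / 50000" and h = "37 / 2500", OF _ _ _ _ _ search_28000_39000])
    (simp_all add: interval_ok_def crit_ok_def power_divide)

lemma search_39000_55000:
  "run_search 39000 55000 (92, 542200, 6163599) (82, 1084400, 3838749) (60, 2168800, 1417362)
    [-3, 2, 37, -3, 3, -37, -181, -3, -3, -23, -41, -47, -109, -3, -3, -3, -11, -3, 17, -5, 5, -5, 3, -31,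
    -5, 5, -5, 3, 2, 2, -137, 5, 5, -13, -5, 5, -23, -5, 3, -17, -17, -41, -5, -19, -109, -53, -17, -191,
    -67, -17, -5, 5, 5, -5, -23, -5, 3, -5, 3, -23, 19, -47, -5, -73, 2, -11, -5, 2, -19, 13, 2, 2, -103,
    -5, -11, -5, -47, -5, 11, -5, -197, 3, -127, 3, 3, 3, 13, -11, 7, -5, -5, -11, 3, 2, -29, -5, 2, -7, -5,
    -23, -7, -7, 2, -5, -179, 3, -5, 3, -5, 5, -7, 2, -41, -11, -7, 5, 3, 7, -5, 2, -5, -173, 3, -13, -43,
    -47, -139, 2, 3, 7, -11, -157, 41, -31, 23, 3, -151, 29, 2, -29, -11, -83, -59, -89, 17, -11, -199, -23,
    -109, -19, 2, 2, -163, -13, -17, -211, -29, 17, -13, -41, -11, -71, 7, -131, -59, 2, -13, -17, -31, -41,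
    3, 2, -11, -23, -73, 3, -13, 7, -167, -53, -11, 23, -31, -37, -61, 11, 3, -13, -97, 19, 17, 29, -11,
    -19, 13, 31, -23, 17, 7, -41, -37, -7, -103, 13, -109, -151, 3, -13, 13, 13, 2, -19, -137, -13, 2, 73,
    -7, -23, -29, 3, -17, -29, -7, 2, 13, -197, 17, -53, 17, -193, -7, -199, -13, -59, -7, -7, -17, -73,
    -29, -7, -173, -107, 17, -7, -137, 3, -7, 3, -127, 2, 2, 2, -11, -11, -17, -29, -7, 3, 11, -19, -7, -23,
    23, -73, -17, -37, -43, 3, -47, 29, -7, -13, -7, 2, 13, -13, -23, -191, -7, -43, 3, -19, -61, 11, -131,
    -11, -11, -109, 13, -197, 7, 2, -7, -229, -37, -101, -7, 11, -43, -7, -11, 3, 2, -7, -11, -97, 11, -7,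
    3, -31, -29, 7, 13, 11, -31, -179, 2, -11, -7, -83, 13, -17, -19, -13, 17, -19, -7, -47, -17, -103, -13,
    -7, -73, 19, -11, 17, -7, -41, 7, -7, 13, -11, -37, 19, 13, 31, -7, -71, -59, -7, 11, -89, -7, -11, -67,
    -227, -7, 7, 7, -29, 17, 7, -11, 7, -23, -7, -17, -7, 2, -127, -23, 7, 2, -17, -167, 2, -7, 3, -19, -7,
    -7, -31, -7, -13, -11, 7, -79, 31, 31, -37, -107, 31, -7, 13, -7, -13, 7, -11, -101, -7, 2, 17, 2, -7,
    -7, 3, 37, -179, 17, 7, -181, -11, -17, -211, -13, 17, 7, -31, -23, -163, -11, -7, 3, 2, 7, 17, -89, 17,
    -19, -19, -11, -79, -149, -67, 2, 31, -7, -17, 11, -17, -83, 11, 3, -13, 7, -13, -11, -31, -13, -43, -7,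
    17, -89, -13, -137, -7, -29, -17, 2, 2, -11, -13, 2, 2, -7, 2, -41, 3, 37, -13]"
  by code_simp

lemma small_primroots_upto_55000: "small_primroots_upto 55000"
  by (rule search_extend[OF small_primroots_upto_39000, where \<kappa> = "387 / 250" and s = "4937 / 25" and s' = "23453 / 100" and m = "793 / 10"
      and e = "3137 / 100000" and f = "2711 / 100000" and h = "631 / 50000", OF _ _ _ _ _ search_39000_55000])
    (simp_all add: interval_ok_def crit_ok_def power_divide)

lemma search_55000_77000:
  "run_search 55000 77000 (94, 463400, 6366733) (84, 926800, 4202549) (66, 1853600, 2000162)
    [-3, -3, -3, -13, 5, 3, -19, 5, -5, -43, -103, 5, -59, -101, -17, 2, -107, -13, 2, -5, 37, -5, 2, 2,
    -271, -5, -29, -5, -149, -23, 2, -5, 3, 5, -11, -5, -5, -101, -151, 5, -5, 3, -239, -5, -167, -31, -19,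
    -29, -5, 5, 3, -37, -5, -11, -17, 3, -19, -5, -13, 7, 2, 2, -5, -41, -5, -13, 3, -11, 2, -5, -251, -19,
    13, -17, 2, -5, 31, 13, -11, 2, 2, -5, -23, -5, 17, -43, -101, -5, -5, -11, -59, -107, -97, -5, -13,
    -19, -5, -11, -191, 2, -5, -151, 7, -5, -19, 3, 3, -5, -61, -73, -17, 2, -7, -113, 17, 3, -5, 3, -5, -7,
    -5, -59, -5, -5, 2, 5, -181, -7, -7, -17, -31, -19, -29, 59, -97, -37, 7, -71, 11, 3, 17, -11, -131, 11,
    2, 31, -29, -239, -179, -11, -13, -137, 17, 2, -11, -13, -47, -149, -53, -19, -107, 2, -13, 2, -11, 3,
    53, 3, -13, 7, 2, -11, -11, -19, -17, -41, -101, -13, -23, 7, -19, 11, -13, 3, 17, -113, 19, -47, -23,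
    -17, 23, 2, -43, 3, 11, -11, -79, 2, 2, -23, -223, 13, 11, 2, -11, -11, -17, 3, 2, 2, -103, -37, -11,
    -241, 37, 7, -13, -17, 13, 3, 2, 3, -31, 23, -17, -19, 2, -251, -41, -127, -83, -31, -29, 3, 47, -83,
    -7, -43, -23, 7, -13, -67, 3, 2, -7, -41, 23, -7, 17, -7, 7, -61, 3, 11, -31, 11, -7, -43, 2, -131,
    -113, -13, 3, 2, -73, -7, -157, 13, 2, -13, -7, -37, -19, -7, 3, 47, 2, -17, -179, -7, -23, 2, -17, 37,
    -7, -191, -13, -41, -241, -19, -79, 29, 23, 7, -17, 2, 97, -79, -11, -7, -61, -197, -23, -167, -7, -17,
    2, 3, -149, 11, 2, -7, -101, -11, -29, 17, -7, 7, -151, -11, -109, -7, -73, -163, -7, 29, -53, 29, -89,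
    -67, 3, 7, -7, 29, 11, -11, -7, -11, -43, -7, 11, -19, -23, -7, -7, -71, -107, 3, 11, 13, -11, -13, -13,
    13, -23, -23, 2, -197, -17, 11, 13, 7, -7, 2, -41, -11, -89, -173, 7, -191, -7, 17, -37, 7, 3, -7, 3, 2,
    -7, -17, 2, 2, 11, 11, -71, -223, -7, -13, 2, 17, 2, 2, 7, -7, 3, 3, 11, -79, -7, -11, -13, -7, -31,
    -11, 43, 7, -7, 2]"
  by code_simp

lemma small_primroots_upto_77000: "small_primroots_upto 77000"
  by (rule search_extend[OF small_primroots_upto_55000, where \<kappa> = "1569 / 1000" and s = "5863 / 25" and s' = "27749 / 100" and m = "468 / 5"
      and e = "2677 / 100000" and f = "2317 / 100000" and h = "1069 / 100000", OF _ _ _ _ _ search_55000_77000])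
    (simp_all add: interval_ok_def crit_ok_def power_divide)

lemma search_77000_100000:
  "run_search 77000 100000 (95, 394000, 6540066) (87, 788000, 4514599) (71, 1576000, 2502999)
    [5, -5, 41, -307, -5, -199, -223, 13, -5, -19, 7, 5, -5, 29, -5, -5, -59, 7, 7, -139, -149, -73, -17,
    -5, -23, -11, -23, 2, -41, -127, -53, -17, -13, 41, 2, -233, 47, -41, 17, -199, -29, 2, -19, -157, -47,
    -41, -149, 31, 2, -17, 23, -23, 3, -109, -227, 11, 37, -13, -11, 11, 2, 11, 13, -13, 3, -29, -67, -73,
    -281, -211, -89, 29, -17, -11, -43, 31, 2, 7, -137, -59, -13, -11, 3, -113, -17, -37, -31, -11, -19,
    -23, -29, 3, 3, -11, 3, 7, 19, 2, -103, -97, -19, -13, -229, -67, 11, 2, -37, -11, -19, -13, -151, -263,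
    3, -13, 47, 2, 3, 11, -11, -31, 2, 3, -11, 7, -101, -11, -257, -17, -167, -11, -61, -13, -163, -193,
    -191, -37, -37, -79, -31, -239, -7, -7, -19, -283, -163, 17, -29, 2, 2, -223, -7, -23, 23, -7, -29, 13,
    -7, -19, -67, -7, -59, -17, -173, -7, 2, -17, -13, 11, -109, 2, -19, -13, -43, 2, -13, 2, -7, 3, -229,
    11, 11, 2, -47, -61, -7, 7, -11, -7, -7, 11, -7, -271, 17, -311, -11, -37, -17, -71, -7, -89, 7, -11,
    -277, 23, 2, 41, -7, 29, 2, -7, 7, -19, -23, 2, -11, -29, -223, -31, -11, -17, -193, -53, 7, 13, -7,
    -11, 2, -13, -7, 3, 7, 11, 13, -83, 3, -7, -61, -31, -23, -163, -11, 3, -59, -53, -11, 2, 7, -29, -257,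
    -11, 7, 2, -53, -29, 107, 13, -179, 3, -7, 7, -113, 2, -13, 3, -7, -17, 2, -7, 13, -31, -13, -7, 3, -13,
    -17, 11, 2, 2, -13, -103, 13, -7, 13, 3, 3, -269, -7, 7, -11, 17, -7, -7, 2]"
  by code_simp

lemma small_primroots_upto_100000: "small_primroots_upto 100000"
  by (rule search_extend[OF small_primroots_upto_77000, where \<kappa> = "317 / 200" and s = "6937 / 25" and s' = "31623 / 100" and m = "1101 / 10"
      and e = "1143 / 50000" and f = "197 / 10000" and h = "909 / 100000", OF _ _ _ _ _ search_77000_100000])
    (simp_all add: interval_ok_def crit_ok_def power_divide)

lemma search_100000_150000:
  "run_search 100000 150000 (95, 356000, 6647466) (88, 712000, 4704199) (74, 1424000, 2801749)
    [5, -5, 19, -5, 2, 5, -229, -13, -5, -109, -31, 7, 29, 2, 3, 2, 31, -13, 3, -191, -73, -29, -163, 83,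
    -79, -17, 29, -19, 53, 7, -13, 13, 2, -37, -11, -31, -83, -173, -89, 7, -257, 17, -19, 17, -43, 2, 2,
    -11, 31, -17, 13, -19, -11, -31, -197, -23, 23, -61, 13, -11, 3, -13, -251, -37, -11, 13, -379, -13, 2,
    17, -359, 59, 19, -13, 2, -47, -17, 17, -11, 2, 19, 11, -349, -17, 19, -17, 13, 11, -17, 11, -29, -181,
    -13, -277, -11, -149, 11, -11, -19, 29, -83, -23, 2, -23, -109, 31, -13, -19, -23, 13, -11, -53, -31,
    13, -11, -101, 3, 11, -29, -29, -281, -239, 37, -17, 2, -19, -23, 2, 17, -127, -41, -11, -179, 3, 2,
    -11, 3, -233, -37, -29, -283, 43, 7, 2, -13, 23, 3, -17, -67, -157, -97, -59, -13, -47, -11, -43, -269,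
    -103, 29, 2, -11, 7, 2, 11, 2, 3, -13, 7, -307, -13, -11, 37, -181, -37, 17, -47, 13, -13, -11, -43, 37,
    -107, 11, -109, 2, 2, -11, -211, 2, -59, -17, 2, -173, 23, -13, -97, -43, -73, -139, -23, 3, -17, -313,
    -53, -137, -19, -11, 7, -131, -11, 7, 2, -19, -23, -13, -61, 3, -227, -13, -83, 3, -11, -127, -79, -17,
    -19, -31, 3, 2, 2, -7, -17, -107, -19, 41, -179, 3, -67, -71, 3, -7, -13, 7, -29, -139, -83, -17, -13,
    -7, -89, 2, 2, 7, 2, -257, -41, 3, -23, 13, 7, -43, 23, 2, -7, -19, -7, -13, 23, -31, -61, 11, -41,
    -167, 3, 7, -17, -197, -269, -251, 23, -7, -7, -193, 2, -23, 29, -13, -331, 3, -7, -19, -19, 31, -7,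
    -107, 19, -7, 7, -31, 17, 7, 11, -53, -23, -241, -7, 2, -7, 2, 2, -227, -31, -67, -13, -17, 2, -7, -47,
    -53, -7, -7, -29, 2, -13, -19, 7, -307, -7, 2, 3, -281, 2, -181, -97, -31, 2, 11, -71, -7, -13, 11, -7,
    -277, 3, 2, -23, -43, -131, -7, -269, -53, -83, 17, -41, -7, -7, 11, -197, -11, 7, -137, -17, 3, -59,
    -233, -11, -67, -7, -113, 7, -23, 7, 23, -11, -109, 2, -181, -7, -103, -349, -7, -127, 3, -11, -191, 7,
    -193, -41, -7, -11, -13, -7, 3, 17]"
  by code_simp

lemma small_primroots_upto_150000: "small_primroots_upto 150000"
  by (rule search_extend[OF small_primroots_upto_100000, where \<kappa> = "1611 / 1000" and s = "15811 / 50" and s' = "3873 / 10" and m = "249 / 2"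
      and e = "1019 / 50000" and f = "89 / 5000" and h = "201 / 25000", OF _ _ _ _ _ search_100000_150000])
    (simp_all add: interval_ok_def crit_ok_def power_divide)

lemma search_150000_210000:
  "run_search 150000 210000 (96, 293800, 6802933) (90, 587600, 4984049) (78, 1175200, 3252637)
    [-379, -3, -5, -5, 2, -43, -5, -31, 23, 37, 29, -23, -419, -19, 2, -199, 19, -257, -37, 7, 7, -41, -109,
    -83, -59, 7, -181, -29, -13, -61, -101, -13, 17, -17, 41, 31, -61, -113, 2, -193, 2, 11, -241, -101,
    -11, -17, 11, 11, -11, 3, -17, -293, -41, -29, -59, -97, 2, 7, -13, -11, -19, 11, 2, 13, 11, 2, -163,
    -29, -17, 11, 3, -11, -13, -409, 2, -103, 3, -31, -13, 7, -11, -11, -41, 11, -17, -71, 7, -53, 13, 37,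
    -11, -13, 7, -41, 11, -137, -19, 3, -11, -29, 19, -193, -19, -47, 2, 31, 2, -23, 3, -23, -313, -13, -79,
    -11, -307, -19, -37, 37, -73, 11, 19, -37, -89, -97, -347, -17, -19, 23, 2, 11, 3, -7, -163, -17, -7,
    -157, 2, -23, 11, 7, -61, -7, -13, 2, -109, 3, -47, -131]"
  by code_simp

lemma small_primroots_upto_210000: "small_primroots_upto 210000"
  by (rule search_extend[OF small_primroots_upto_150000, where \<kappa> = "1633 / 1000" and s = "38729 / 100" and s' = "22913 / 50" and m = "303 / 2"
      and e = "1687 / 100000" and f = "1469 / 100000" and h = "661 / 100000", OF _ _ _ _ _ search_150000_210000])
    (simp_all add: interval_ok_def crit_ok_def power_divide)

lemma search_210000_290000:
  "run_search 210000 290000 (97, 251800, 6910033) (92, 503600, 5176199) (82, 1007200, 3561074)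
    [-23, 2, -37, 7, -31, 31, -29, -13, 2, -461, -421, 17, -97, 19, -17, 11, -17, 17, 29, -31, 29, -13,
    -229, -19, 3, 11, -211, -23, -41, 17, 3, 23, 11, 2, -71, -103, 17, -23, 3, -167, -19, -109, -11, -11,
    17, -29, 17, -23, -347, 3, 3, -103, 7, -137, -251, 29, -17, 53, 23, 7, 11, -11, -73, 3, -37, -313, -389,
    -67, 13, 2, -19, -47, -13, -139, -11, -401, 2, -89, -13, -11, 3, -269, -31, -31, -17, 41, -13, -11, 3,
    -43, -23, -457, 3, -281, -17, -23, -13, -307, -11, -79, -89, -157, -331, -7, 23, -19, 11, -127, -101,
    -23, 13, 2, -67, -149, -41, -7, -139, -23, -53, -103, -7, -73, 11, -11, -7, 3, 19, 19, 7, -59, 3, -11,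
    -151]"
  by code_simp

lemma small_primroots_upto_290000: "small_primroots_upto 290000"
  by (rule search_extend[OF small_primroots_upto_210000, where \<kappa> = "827 / 500" and s = "1833 / 4" and s' = "13463 / 25" and m = "1781 / 10"
      and e = "361 / 25000" and f = "1259 / 100000" and h = "281 / 50000", OF _ _ _ _ _ search_210000_290000])
    (simp_all add: interval_ok_def crit_ok_def power_divide)

lemma search_290000_410000:
  "run_search 290000 410000 (97, 218000, 6996999) (93, 436000, 5331999) (84, 872000, 3810749)
    [-89, 2, 29, 11, 37, -13, -71, 29, -101, -79, 41, -41, -113, -17, 3, -29, -19, -83, 83, -37, -311, -23,
    23, -331, 2, -179, -13, -13, -23, 3, 2, -491, 11, -67, 41, 7, -167, 19, 3, -139, -191, -67, -11, 37, 3,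
    -17, -11, -19, -29, -47, -17, -61, -71, -359, -107, 2, -17, -337, 19, 23, -43, -11, -31, -19, 41, 3,
    -53, 3, 7, -223, -83, -11, -73, -29, -199, 2, -11, -23, 3, 3, -41, -37, -11, 11, 23, -503, -97, 13, -23,
    41, -13, 11, 3, 3, 3, -347, 19, 17, -37, -29, -19, -101, -73, -503, 11, 2, 7, 2, -13, 2, -83, -53, -11,
    -11, -229, -107, -23, 7, 29, -7, -571, -109, -7, 2, 11, -37, -523, -17, -137, 7, -131, -269, 3]"
  by code_simp

lemma small_primroots_upto_410000: "small_primroots_upto 410000"
  by (rule search_extend[OF small_primroots_upto_290000, where \<kappa> = "1677 / 1000" and s = "53851 / 100" and s' = "16008 / 25" and m = "2079 / 10"
      and e = "623 / 50000" and f = "109 / 10000" and h = "241 / 50000", OF _ _ _ _ _ search_290000_410000])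
    (simp_all add: interval_ok_def crit_ok_def power_divide)

lemma search_410000_580000:
  "run_search 410000 580000 (98, 186400, 7077566) (94, 372800, 5476549) (87, 745600, 4042787)
    [-19, -17, -47, 19, 2, 2, 19, -137, -251, 29, -43, -317, -31, 3, -17, -131, -283, 23, 2, 37, 29, 3, -23,
    -13, -31, -659, -29, -79, 13, -13, -19, 3, -17, -521, 7, -59, -37, 109, -19, -29, 59, -13, 13, -13,
    -293, -359, -397, -107, 3, -601, -23, -163, 3, -43, 3, -71, -569, -103, 31, -11, -29, -23, -197, 17, 17,
    -419, -43, -11, 11, -367, 2, -463, -67, 47, -59, -449, -11, 7, 3, -31, -17, 2, 2, -23, 37, -19, -73,
    -53, -479, -163, -233, -61, -11, -523, -41, 19, -37, 17, -11, 2, -13, 7, -31, -59, -53, -19, 3, -283,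
    -337, 2, 13, -127, 79, -41, 29, -29]"
  by code_simp

lemma small_primroots_upto_580000: "small_primroots_upto 580000"
  by (rule search_extend[OF small_primroots_upto_410000, where \<kappa> = "1701 / 1000" and s = "64031 / 100" and s' = "38079 / 50" and m = "1227 / 5"
      and e = "1063 / 100000" and f = "233 / 25000" and h = "51 / 12500", OF _ _ _ _ _ search_410000_580000])
    (simp_all add: interval_ok_def crit_ok_def power_divide)

lemma search_580000_810000:
  "run_search 580000 810000 (98, 159000, 7146766) (95, 318000, 5600899) (89, 636000, 4242749)
    [-139, -71, 37, -41, -199, 19, -23, -263, -101, -53, -167, -47, -37, -107, 17, 7, -743, -43, 3, -13,
    -53, -13, -181, 2, -43, 3, -761, 11, -67, -193, -541, -89, 7, -79, 3, 29, -11, -211, 2]"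
  by code_simp

lemma small_primroots_upto_810000: "small_primroots_upto 810000"
  by (rule search_extend[OF small_primroots_upto_580000, where \<kappa> = "431 / 250" and s = "76157 / 100" and s' = "90001 / 100" and m = "290"
      and e = "453 / 50000" and f = "159 / 20000" and h = "69 / 20000", OF _ _ _ _ _ search_580000_810000])
    (simp_all add: interval_ok_def crit_ok_def power_divide)

lemma search_810000_1100000:
  "run_search 810000 1100000 (98, 136200, 7203966) (96, 272400, 5703799) (90, 544800, 4408424)
    [-181, 11, 7, 23, -17, -29, -163, 41, 47, -443, 2, -37, -593, -823]"
  by code_simp

lemma small_primroots_upto_1100000: "small_primroots_upto 1100000"
  by (rule search_extend[OF small_primroots_upto_810000, where \<kappa> = "349 / 200" and s = "900" and s' = "104881 / 100" and m = "1703 / 5"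
      and e = "97 / 12500" and f = "681 / 100000" and h = "147 / 50000", OF _ _ _ _ _ search_810000_1100000])
    (simp_all add: interval_ok_def crit_ok_def power_divide)

lemma search_1100000_1600000:
  "run_search 1100000 1600000 (99, 119400, 7247699) (96, 238800, 5781999) (92, 477600, 4533474)
    [-43, -31, 2, -239, 3, -67, 2, -17, 23, 13, -751, 7, 3, 3, -71, -23, -613, 2, 23, -13]"
  by code_simp

lemma small_primroots_upto_1600000: "small_primroots_upto 1600000"
  by (rule search_extend[OF small_primroots_upto_1100000, where \<kappa> = "1771 / 1000" and s = "5244 / 5" and s' = "31623 / 25" and m = "394"
      and e = "169 / 25000" and f = "597 / 100000" and h = "127 / 50000", OF _ _ _ _ _ search_1100000_1600000])
    (simp_all add: interval_ok_def crit_ok_def power_divide)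

lemma search_1600000_2200000:
  "run_search 1600000 2200000 (99, 100200, 7295299) (97, 200400, 5867799) (93, 400800, 4671924)
    [-1429, -463, -31, 2, 2, 2, -47]"
  by code_simp

lemma small_primroots_upto_2200000: "small_primroots_upto 2200000"
  by (rule search_extend[OF small_primroots_upto_1600000, where \<kappa> = "897 / 500" and s = "126491 / 100" and s' = "37081 / 25" and m = "4721 / 10"
      and e = "71 / 12500" and f = "501 / 100000" and h = "53 / 25000", OF _ _ _ _ _ search_1600000_2200000])
    (simp_all add: interval_ok_def crit_ok_def power_divide)

lemma search_2200000_3100000:
  "run_search 2200000 3100000 (99, 87000, 7328999) (97, 174000, 5928249) (94, 348000, 4768937)
    [-1451, -29, 17, -23]"
  by code_simp

lemma small_primroots_upto_3100000: "small_primroots_upto 3100000"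
  by (rule search_extend[OF small_primroots_upto_2200000, where \<kappa> = "1819 / 1000" and s = "148323 / 100" and s' = "176069 / 100" and m = "2749 / 5"
      and e = "491 / 100000" and f = "87 / 20000" and h = "91 / 50000", OF _ _ _ _ _ search_2200000_3100000])
    (simp_all add: interval_ok_def crit_ok_def power_divide)

text \<open>An empty list means that every branch either satisfies a criterion or contains no number
  of the interval.\<close>

lemma search_3100000_4400000:
  "run_search 3100000 4400000 (99, 74400, 7360499) (98, 148800, 5984949) (95, 297600, 4860287)
    []"
  by code_simp

lemma small_primroots_upto_4400000: "small_primroots_upto 4400000"
  by (rule search_extend[OF small_primroots_upto_3100000, where \<kappa> = "461 / 250" and s = "44017 / 25" and s' = "104881 / 50" and m = "3241 / 5"
      and e = "419 / 100000" and f = "93 / 25000" and h = "31 / 20000", OF _ _ _ _ _ search_3100000_4400000])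
    (simp_all add: interval_ok_def crit_ok_def power_divide)

lemma search_4400000_6100000:
  "run_search 4400000 6100000 (100, 63400, 7387799) (98, 126800, 6034149) (96, 253600, 4939662)
    []"
  by code_simp

lemma small_primroots_upto_6100000: "small_primroots_upto 6100000"
  by (rule search_extend[OF small_primroots_upto_4400000, where \<kappa> = "1869 / 1000" and s = "209761 / 100" and s' = "123491 / 50" and m = "7671 / 10"
      and e = "357 / 100000" and f = "317 / 100000" and h = "131 / 100000", OF _ _ _ _ _ search_4400000_6100000])
    (simp_all add: interval_ok_def crit_ok_def power_divide)

lemma search_6100000_24000000:
  "run_search 6100000 24000000 (100, 60000, 7402866) (98, 120000, 6059299) (96, 240000, 4976624)
    [-347, -67, -3209, -31, 23, -421, 7, -991, 19, 7, -127]"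
  by code_simp

lemma small_primroots_upto_24000000: "small_primroots_upto 24000000"
  by (rule search_extend[OF small_primroots_upto_6100000, where \<kappa> = "987 / 500" and s = "246981 / 100" and s' = "244949 / 50" and m = "8789 / 10"
      and e = "2 / 625" and f = "3 / 1000" and h = "57 / 50000", OF _ _ _ _ _ search_6100000_24000000])
    (simp_all add: interval_ok_def crit_ok_def power_divide)

lemma search_24000000_98000000:
  "run_search 24000000 98000000 (100, 32200, 7468799) (99, 64400, 6179049) (98, 128800, 5171487)
    []"
  by code_simp

lemma small_primroots_upto_98000000: "small_primroots_upto 98000000"
  by (rule search_extend[OF small_primroots_upto_24000000, where \<kappa> = "261 / 125" and s = "489897 / 100" and s' = "19799 / 2" and m = "16951 / 10"
      and e = "171 / 100000" and f = "161 / 100000" and h = "59 / 100000", OF _ _ _ _ _ search_24000000_98000000])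
    (simp_all add: interval_ok_def crit_ok_def power_divide)

lemma search_98000000_390000000:
  "run_search 98000000 390000000 (100, 17000, 7504433) (100, 34000, 6243899) (99, 68000, 5277249)
    []"
  by code_simp

lemma small_primroots_upto_390000000: "small_primroots_upto 390000000"
  by (rule search_extend[OF small_primroots_upto_98000000, where \<kappa> = "2207 / 1000" and s = "989949 / 100" and s' = "987421 / 50" and m = "16659 / 5"
      and e = "9 / 10000" and f = "17 / 20000" and h = "31 / 100000", OF _ _ _ _ _ search_98000000_390000000])
    (simp_all add: interval_ok_def crit_ok_def power_divide)

lemma search_390000000_1500000000:
  "run_search 390000000 1500000000 (100, 9200, 7522933) (100, 18400, 6277499) (100, 36800, 5331924)
    []"
  by code_simp

lemma small_primroots_upto_1500000000: "small_primroots_upto 1500000000"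
  by (rule search_extend[OF small_primroots_upto_390000000, where \<kappa> = "2329 / 1000" and s = "1974841 / 100" and s' = "968246 / 25" and m = "64701 / 10"
      and e = "3 / 6250" and f = "23 / 50000" and h = "1 / 6250", OF _ _ _ _ _ search_390000000_1500000000])
    (simp_all add: interval_ok_def crit_ok_def power_divide)

lemma search_1500000000_6300000000:
  "run_search 1500000000 6300000000 (100, 5000, 7532566) (100, 10000, 6295099) (100, 20000, 5360749)
    []"
  by code_simp

lemma small_primroots_upto_6300000000: "small_primroots_upto 6300000000"
  by (rule search_extend[OF small_primroots_upto_1500000000, where \<kappa> = "1233 / 500" and s = "3872983 / 100" and s' = "3968627 / 50" and m = "24663 / 2"
      and e = "13 / 50000" and f = "1 / 4000" and h = "9 / 100000", OF _ _ _ _ _ search_1500000000_6300000000])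
    (simp_all add: interval_ok_def crit_ok_def power_divide)

lemma search_6300000000_25000000000:
  "run_search 6300000000 25000000000 (100, 2800, 7537799) (100, 5600, 6304599) (100, 11200, 5376199)
    []"
  by code_simp

lemma small_primroots_upto_25000000000: "small_primroots_upto 25000000000"
  by (rule search_extend[OF small_primroots_upto_6300000000, where \<kappa> = "1303 / 500" and s = "7937253 / 100" and s' = "15811389 / 100" and m = "24584"
      and e = "7 / 50000" and f = "7 / 50000" and h = "1 / 20000", OF _ _ _ _ _ search_6300000000_25000000000])
    (simp_all add: interval_ok_def crit_ok_def power_divide)

lemma search_25000000000_100000000000:
  "run_search 25000000000 100000000000 (100, 1400, 7540866) (100, 2800, 6310249) (100, 5600, 5385537)
    []"
  by code_simp

lemma small_primroots_upto_100000000000: "small_primroots_upto 100000000000"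
  by (rule search_extend[OF small_primroots_upto_25000000000, where \<kappa> = "551 / 200" and s = "3952847 / 25" and s' = "31622777 / 100" and m = "238149 / 5"
      and e = "7 / 100000" and f = "7 / 100000" and h = "3 / 100000", OF _ _ _ _ _ search_25000000000_100000000000])
    (simp_all add: interval_ok_def crit_ok_def power_divide)

lemma search_100000000000_400000000000:
  "run_search 100000000000 400000000000 (100, 800, 7542199) (100, 1600, 6312699) (100, 3200, 5389574)
    []"
  by code_simp

lemma small_primroots_upto_400000000000: "small_primroots_upto 400000000000"
  by (rule search_extend[OF small_primroots_upto_100000000000, where \<kappa> = "364 / 125" and s = "7905694 / 25" and s' = "31622777 / 50" and m = "926561 / 10"
      and e = "1 / 25000" and f = "1 / 25000" and h = "1 / 50000", OF _ _ _ _ _ search_100000000000_400000000000])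
    (simp_all add: interval_ok_def crit_ok_def power_divide)

lemma search_400000000000_1600000000000:
  "run_search 400000000000 1600000000000 (100, 400, 7543133) (100, 800, 6314399) (100, 1600, 5392349)
    []"
  by code_simp

lemma small_primroots_upto_1600000000000: "small_primroots_upto 1600000000000"
  by (rule search_extend[OF small_primroots_upto_400000000000, where \<kappa> = "1539 / 500" and s = "63245553 / 100" and s' = "126491107 / 100" and m = "180246"
      and e = "1 / 50000" and f = "1 / 50000" and h = "1 / 100000", OF _ _ _ _ _ search_400000000000_1600000000000])
    (simp_all add: interval_ok_def crit_ok_def power_divide)

text \<open>The three hints belong to \<open>p - 1 = 2 * P * q\<close>, where P is the product of
  all primes from 5 to 31 and q is 37, 41 or 43. There 3 does not divide \<open>p - 1\<close> and
  the criterion for {2} narrowly fails, but the three values of \<open>p\<close> are divisible by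
  61, 3 and 41.\<close>

lemma search_1600000000000_4000000000000:
  "run_search 1600000000000 4000000000000 (100, 400, 7543133) (100, 800, 6314399) (100, 1600, 5392349)
    [-61, -3, -41]"
  by code_simp

lemma small_primroots_upto_4000000000000: "small_primroots_upto 4000000000000"
  by (rule search_extend[OF small_primroots_upto_1600000000000, where \<kappa> = "3193 / 1000" and s = "63245553 / 50" and s' = "200000001 / 100" and m = "3539407 / 10"
      and e = "1 / 50000" and f = "1 / 50000" and h = "1 / 100000", OF _ _ _ _ _ search_1600000000000_4000000000000])
    (simp_all add: interval_ok_def crit_ok_def power_divide)

lemma small_primroot_prime:
  assumes "prime p"
  shows "small_primroot p"
proof (cases "p \<le> 4000000000000")
  case True
  hence "int p \<le> 4000000000000" by simp
  thus ?thesis using small_primroots_upto_4000000000000 assms by (simp add: small_primroots_upto_def)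
next
  case False
  thus ?thesis using assms by (intro small_primroot_large) auto
qed

theorem theorem1:
  fixes p :: nat
  assumes "prime p"
  shows "real (least_squarefree_primroot p) < real p powr 0.96
       \<and> (\<exists>n. n > 0 \<and> squarefree n \<and> residue_primroot p n \<and> n < p)"
proof -
  obtain n where n: "n > 0" "squarefree n" "residue_primroot p n" "real n < real p powr 0.96"
    using small_primroot_prime[OF assms] by (auto simp: small_primroot_def)
  have "least_squarefree_primroot p \<le> n"
    unfolding least_squarefree_primroot_def using n by (intro Least_le) blast
  hence "real (least_squarefree_primroot p) < real p powr 0.96" using n(4) by linarith
  moreover have "real p powr 0.96 \<le> real p powr 1"
    using prime_ge_2_nat[OF assms] by (intro powr_mono) auto
  hence "n < p" using n(4) prime_ge_2_nat[OF assms] by simp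
  ultimately show ?thesis using n by blast
qed

end
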